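(* Let $(A,\sigma,f)$ be a central simple $F$-algebra of degree $2n$ with quadratic pair, let $(L,\sigma_L)$ be an étale $F$-algebra of dimension $2n$ with involution, and let $\varepsilon\colon(L,\sigma_L)\hookrightarrow(A,\sigma,f)$ be an embedding of algebras with involution. Under the canonical identification $C\mathbf{Y}(L,\sigma_L)=\mathbf{X}C(L,\sigma_L)$, the diagram $$\begin{array}{ccc}C\mathbf{Y}(L,\sigma_L)&\xrightarrow{\;C(\varepsilon_* )\;}&C(\mathbf{Q}(\sigma,f))\\ \|&&\downarrow\psi\\ \mathbf{X}C(L,\sigma_L)&\xrightarrow{\;C(\varepsilon)_*\;}&\mathbb{SB}(C(A,\sigma,f))\end{array}$$ commutes, i.e. $\psi\circ C(\varepsilon_* )=C(\varepsilon)_*$.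
   Context: $F$ is an arbitrary field, $F_s$ a separable closure, $\Gamma=\operatorname{Gal}(F_s/F)$, $n\ge1$; the subscript $s$ denotes scalar extension to $F_s$. Étale algebras. An étale $F$-algebra of dimension $m$ is a commutative $F$-algebra $L$ with $L\otimes_FF_s\cong F_s^m$; $\mathbf{X}(L)=\operatorname{Hom}_{F\text{-alg}}(L,F_s)$ with the $\Gamma$-action on values. An involution on $L$ is an $F$-algebra automorphism $\sigma_L$ of order 2 such that $\xi\mapsto\xi\circ\sigma_L$ has no fixed point on $\mathbf{X}(L)$. Put $L_0=\{x\in L\mid\sigma_L(x)=x\}$. $C\mathbf{Y}(L,\sigma_L)$ is the $\Gamma$-set of $n$-element subsets $\omega\subset\mathbf{X}(L)$ containing no pair $\{\xi,\xi\circ\sigma_L\}$. The Clifford algebra is $C(L,\sigma_L)=e\cdot(L^{\otimes n})^{\mathfrak{S}_n}$, where $\mathfrak{S}_n$ permutes the factors and $e\in L_0^{\otimes n}\subset L^{\otimes n}$ is the idempotent with $(\xi_1\otimes\cdots\otimes\xi_n)(e)=1$ if $\xi_1,\dots,\xi_n\in\mathbf{X}(L_0)$ are pairwise distinct and $0$ otherwise; it is étale of dimension $2^n$, and the identification $C\mathbf{Y}(L,\sigma_L)=\mathbf{X}C(L,\sigma_L)$ sends $\omega=\{\xi_1,\dots,\xi_n\}$ to the restriction of $\xi_1\otimes\cdots\otimes\xi_n$ to $C(L,\sigma_L)$. The linear map $c_L\colon L\to C(L,\sigma_L)$ is $c_L(x)=e\cdot(x\otimes1\otimes\cdots\otimes1+\cdots+1\otimes\cdots\otimes1\otimes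 x)$. Quadratic pairs. $\operatorname{Sym}$, $\operatorname{Skew}$ denote the subspaces where $\sigma(x)=x$, resp. $\sigma(x)=-x$. A quadratic pair on a central simple $F$-algebra $A$ of degree $2n$ is $(\sigma,f)$ with $\sigma$ an $F$-linear involution on $A$ and $f\colon\operatorname{Sym}(A,\sigma)\to F$ linear such that $\dim_F\operatorname{Sym}(A,\sigma)=n(2n+1)$, $\operatorname{Trd}_A(\operatorname{Skew}(A,\sigma))=\{0\}$, $f(x+\sigma(x))=\operatorname{Trd}_A(x)$ for $x\in A$. If $q$ is a nonsingular quadratic form with polar form $b_q$ on $V$, identify $v\otimes w\in V\otimes V$ with $x\mapsto v\,b_q(w,x)$; the adjoint quadratic pair on $\operatorname{End}V$ consists of the involution adjoint to $b_q$ and the $f$ with $f(v\otimes v)=q(v)$. Over $F_s$, $A_s\cong\operatorname{End}_{F_s}V$ with $(\sigma_s,f_s)$ adjoint to a hyperbolic form $q$ unique up to a scalar. An embedding of algebras with involution $\varepsilon\colon(L,\sigma_L)\hookrightarrow(A,\sigma,f)$ is an $F$-algebra embedding with (a) $\varepsilon\circ\sigma_L=\sigma\circ\varepsilon$ and (b) $f(x)=\operatorname{Trd}_A(\varepsilon(\ell)x)$ for all $x\in\operatorname{Sym}(A,\sigma)$ and all $\ell\in L$ with $\ell+\sigma_L(\ell)=1$. The map $C(\varepsilon_* )$. A right ideal $I\subset A_s$ is isotropic if $\sigma_s(I)I=\{0\}$ and $f_s(I\cap\operatorname{Sym}(A_s,\sigma_s))=\{0\}$. $C(\mathbf{Q}(\sigma,f))$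 is the set of isotropic right ideals of $A_s$ of dimension $2n^2$ (the maximal linear varieties of the quadric $\mathbf{Q}(\sigma,f)$). For $\xi\in\mathbf{X}(L)$, $\varepsilon_*(\xi)=\{x\in A_s\mid(1\otimes\xi(\ell))x=(\varepsilon(\ell)\otimes1)x\ \forall\ell\in L\}$, and $C(\varepsilon_* )(\omega)=\sum_{\xi\in\omega}\varepsilon_*(\xi)$, which lies in $C(\mathbf{Q}(\sigma,f))$. Clifford algebra of $(A,\sigma,f)$ (as in the book of Knus–Merkurjev–Rost–Tignol, The Book of Involutions; the definition is as follows). Choose $\ell_0\in A$ with $f(s)=\operatorname{Trd}_A(\ell_0s)$ on $\operatorname{Sym}(A,\sigma)$; let $\operatorname{Sand}(\sum a_i\otimes b_i)(x)=\sum a_ixb_i$ and let $\sigma_2$ be the endomorphism of $A\otimes A$ with $\operatorname{Sand}(\sigma_2(u))(x)=\operatorname{Sand}(u)(\sigma(x))$. $C(A,\sigma,f)$ is the quotient of the tensor algebra $T(A)$ by the ideal generated by all $s-f(s)1$ ($s\in\operatorname{Sym}(A,\sigma)$) and all $u-\operatorname{Sand}(u)(\ell_0)$ ($\sigma_2(u)=u$), with canonical linear map $c_A\colon A\to C(A,\sigma,f)$. It is an Azumaya algebra of constant rank over its center $Z(A,\sigma,f)$, a quadratic étale $F$-algebra, with $\dim_FC(A,\sigma,f)=2^{2n-1}$, and it commutes with scalar extension. For $A=\operatorname{End}V$ with $(\sigma,f)$ adjoint to $q$ one has $C(A,\sigma,f)=C_0(V,q)$ (even Clifford algebra), $c_A(v\otimes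 w)=v\cdot w$. $C(\varepsilon)\colon C(L,\sigma_L)\hookrightarrow C(A,\sigma,f)$ is the unique $F$-algebra embedding with $C(\varepsilon)\circ c_L=c_A\circ\varepsilon$ (it exists). The map $C(\varepsilon)_*$. The points of $\mathbb{SB}(C(A,\sigma,f))$ are the right ideals of $C(A,\sigma,f)_s=C(A_s,\sigma_s,f_s)$ of $F_s$-dimension $2^{n-1}$. For $\eta\in\mathbf{X}C(L,\sigma_L)$, $C(\varepsilon)_*(\eta)=\{x\in C(A,\sigma,f)_s\mid(1\otimes\eta(c))x=(C(\varepsilon)(c)\otimes1)x\ \forall c\in C(L,\sigma_L)\}$. The map $\psi$. $B(A_s,\sigma_s,f_s)=V\otimes C_1(V,q)$ is the Clifford bimodule ($C_1(V,q)$ the odd part of the Clifford algebra), a right $C_0(V,q)$-module by right multiplication on $C_1(V,q)$, with the linear map $A_s=V\otimes V\to B(A_s,\sigma_s,f_s)$, $(v\otimes w)^b=v\otimes w$. For $I\in C(\mathbf{Q}(\sigma,f))$, $\psi(I)=\{x\in C(A_s,\sigma_s,f_s)\mid(\sigma_s(I))^b\cdot x=0\}$. *)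

theory Defs
  imports
    "HOL-Library.Poly_Mapping"
    "HOL-Library.FuncSet"
    "HOL-Computational_Algebra.Polynomial"
    "HOL-Combinatorics.Permutations"
begin

text \<open>
  Algebras are types of class \<^class>\<open>ring_1\<close> together with a scalar multiplication by a field.
  Objects built from given ones (tensor products, scalar extensions, quotients of tensor algebras)
  are handled up to isomorphism: a type with structure maps is said to be, say, a tensor product,
  if the structure maps exhibit it as the quotient of the free vector space (or free algebra) on
  the usual generators by the usual relations.
\<close>

section \<open>Algebras, homomorphisms, ideals\<close>

locale k_algebra = vector_space scale for scale :: "'k::field \<Rightarrow> 'a::ring_1 \<Rightarrow> 'a" +
  assumes scale_mult_left: "scale c (x * y) = scale c x * y"
    and scale_mult_right: "scale c (x * y) = x * scale c y"

definition lin_on ::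
  "('k \<Rightarrow> 'a::ab_group_add \<Rightarrow> 'a) \<Rightarrow> ('k \<Rightarrow> 'b::ab_group_add \<Rightarrow> 'b) \<Rightarrow> 'a set \<Rightarrow> ('a \<Rightarrow> 'b) \<Rightarrow> bool" where
  "lin_on s s' M h \<longleftrightarrow>
     (\<forall>x\<in>M. \<forall>y\<in>M. h (x + y) = h x + h y) \<and> (\<forall>c. \<forall>x\<in>M. h (s c x) = s' c (h x))"

text \<open>Homomorphism on the algebra \<open>M\<close> with unit \<open>u\<close>, which need not be the unit of the
  ambient ring: it is the idempotent \<open>e\<close> for the Clifford algebra of an \'etale algebra.\<close>

definition alg_hom_on ::
  "('k \<Rightarrow> 'a::ring_1 \<Rightarrow> 'a) \<Rightarrow> ('k \<Rightarrow> 'b::ring_1 \<Rightarrow> 'b) \<Rightarrow> 'a set \<Rightarrow> 'a \<Rightarrow> ('a \<Rightarrow> 'b) \<Rightarrow> bool" where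
  "alg_hom_on s s' M u h \<longleftrightarrow>
     lin_on s s' M h \<and> h u = 1 \<and> (\<forall>x\<in>M. \<forall>y\<in>M. h (x * y) = h x * h y)"

abbreviation alg_hom ::
  "('k \<Rightarrow> 'a::ring_1 \<Rightarrow> 'a) \<Rightarrow> ('k \<Rightarrow> 'b::ring_1 \<Rightarrow> 'b) \<Rightarrow> ('a \<Rightarrow> 'b) \<Rightarrow> bool" where
  "alg_hom s s' h \<equiv> alg_hom_on s s' UNIV 1 h"

definition two_sided_ideal :: "'a::ring_1 set \<Rightarrow> bool" where
  "two_sided_ideal I \<longleftrightarrow> 0 \<in> I \<and> (\<forall>x\<in>I. \<forall>y\<in>I. x + y \<in> I) \<and>
     (\<forall>x\<in>I. \<forall>a. a * x \<in> I \<and> x * a \<in> I)"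

definition ideal_generated :: "'a::ring_1 set \<Rightarrow> 'a set" where
  "ideal_generated R = \<Inter>{I. two_sided_ideal I \<and> R \<subseteq> I}"

definition right_ideal :: "'a::ring_1 set \<Rightarrow> bool" where
  "right_ideal I \<longleftrightarrow> 0 \<in> I \<and> (\<forall>x\<in>I. \<forall>y\<in>I. x + y \<in> I) \<and> (\<forall>x\<in>I. \<forall>a. x * a \<in> I)"

section \<open>Free vector spaces, tensor products, tensor algebras\<close>

text \<open>\<open>'x \<Rightarrow>\<^sub>0 'k\<close> is the vector space with basis \<open>'x\<close>, and \<open>'x list \<Rightarrow>\<^sub>0 'k\<close>, multiplied via
  concatenation of words, is the free associative algebra on \<open>'x\<close>.\<close>

instantiation list :: (type) monoid_add
begin
definition zero_list :: "'a list" where "zero_list = []"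
definition plus_list :: "'a list \<Rightarrow> 'a list \<Rightarrow> 'a list" where "plus_list xs ys = xs @ ys"
instance by standard (simp_all add: zero_list_def plus_list_def)
end

abbreviation gen :: "'x \<Rightarrow> 'x \<Rightarrow>\<^sub>0 'k::field" where
  "gen x \<equiv> Poly_Mapping.single x 1"

definition pm_scale :: "'k::field \<Rightarrow> ('x \<Rightarrow>\<^sub>0 'k) \<Rightarrow> ('x \<Rightarrow>\<^sub>0 'k)" where
  "pm_scale c p = Poly_Mapping.map ((*) c) p"

definition lin_ext :: "('k::field \<Rightarrow> 'a::ab_group_add \<Rightarrow> 'a) \<Rightarrow> ('x \<Rightarrow> 'a) \<Rightarrow> ('x \<Rightarrow>\<^sub>0 'k) \<Rightarrow> 'a" where
  "lin_ext s g p = (\<Sum>x\<in>Poly_Mapping.keys p. s (Poly_Mapping.lookup p x) (g x))"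

text \<open>The vector space on the whole type, with \<open>g\<close>, is the free vector space on \<open>X\<close> modulo the
  subspace spanned by \<open>R\<close>.\<close>

definition presents_space ::
  "('k::field \<Rightarrow> 'a::ab_group_add \<Rightarrow> 'a) \<Rightarrow> 'x set \<Rightarrow> ('x \<Rightarrow> 'a) \<Rightarrow> ('x \<Rightarrow>\<^sub>0 'k) set \<Rightarrow> bool" where
  "presents_space s X g R \<longleftrightarrow> vector_space s \<and>
     lin_ext s g ` {p. Poly_Mapping.keys p \<subseteq> X} = UNIV \<and>
     {p. Poly_Mapping.keys p \<subseteq> X \<and> lin_ext s g p = 0} = module.span pm_scale R"

text \<open>The linear map sending \<open>g x\<close> to \<open>h x\<close> for \<open>x \<in> X\<close>. It is evaluated on an arbitrary
  representative, so it is meaningful on the span of \<open>g ` X\<close> provided that \<open>h\<close> respects the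
  linear relations among the \<open>g x\<close>.\<close>

definition induced ::
  "('k::field \<Rightarrow> 'a::ab_group_add \<Rightarrow> 'a) \<Rightarrow> 'x set \<Rightarrow> ('x \<Rightarrow> 'a) \<Rightarrow>
   ('k \<Rightarrow> 'b::ab_group_add \<Rightarrow> 'b) \<Rightarrow> ('x \<Rightarrow> 'b) \<Rightarrow> 'a \<Rightarrow> 'b" where
  "induced s X g s' h u =
     lin_ext s' h (SOME p. Poly_Mapping.keys p \<subseteq> X \<and> lin_ext s g p = u)"

definition bilinear_rels ::
  "('k::field \<Rightarrow> 'm::ab_group_add \<Rightarrow> 'm) \<Rightarrow> 'm set \<Rightarrow> ('k \<Rightarrow> 'n::ab_group_add \<Rightarrow> 'n) \<Rightarrow> 'n set \<Rightarrow>
   (('m \<times> 'n) \<Rightarrow>\<^sub>0 'k) set" where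
  "bilinear_rels sM M sN N =
     {gen (x + x', y) - gen (x, y) - gen (x', y) | x x' y. x \<in> M \<and> x' \<in> M \<and> y \<in> N} \<union>
     {gen (x, y + y') - gen (x, y) - gen (x, y') | x y y'. x \<in> M \<and> y \<in> N \<and> y' \<in> N} \<union>
     {gen (sM c x, y) - Poly_Mapping.single (x, y) c | c x y. x \<in> M \<and> y \<in> N} \<union>
     {gen (x, sN c y) - Poly_Mapping.single (x, y) c | c x y. x \<in> M \<and> y \<in> N}"

definition tensor_product ::
  "('k::field \<Rightarrow> 'm::ab_group_add \<Rightarrow> 'm) \<Rightarrow> 'm set \<Rightarrow> ('k \<Rightarrow> 'n::ab_group_add \<Rightarrow> 'n) \<Rightarrow> 'n set \<Rightarrow>
   ('k \<Rightarrow> 't::ab_group_add \<Rightarrow> 't) \<Rightarrow> ('m \<Rightarrow> 'n \<Rightarrow> 't) \<Rightarrow> bool" where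
  "tensor_product sM M sN N sT t \<longleftrightarrow>
     presents_space sT (M \<times> N) (\<lambda>(x, y). t x y) (bilinear_rels sM M sN N)"

definition multilinear_rels ::
  "('k::field \<Rightarrow> 'm::ab_group_add \<Rightarrow> 'm) \<Rightarrow> nat \<Rightarrow> ('m list \<Rightarrow>\<^sub>0 'k) set" where
  "multilinear_rels s n =
     {gen (us @ [x + y] @ vs) - gen (us @ [x] @ vs) - gen (us @ [y] @ vs) | us vs x y.
        length us + 1 + length vs = n} \<union>
     {gen (us @ [s c x] @ vs) - Poly_Mapping.single (us @ [x] @ vs) c | us vs c x.
        length us + 1 + length vs = n}"

text \<open>The \<open>n\<close>-th tensor power of a commutative algebra, as an algebra; \<open>t [x\<^sub>1, \<dots>, x\<^sub>n]\<close> is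
  \<open>x\<^sub>1 \<otimes> \<dots> \<otimes> x\<^sub>n\<close>.\<close>

definition tensor_power ::
  "('k::field \<Rightarrow> 'l::comm_ring_1 \<Rightarrow> 'l) \<Rightarrow> nat \<Rightarrow> ('k \<Rightarrow> 't::comm_ring_1 \<Rightarrow> 't) \<Rightarrow> ('l list \<Rightarrow> 't) \<Rightarrow> bool" where
  "tensor_power s n sT t \<longleftrightarrow> k_algebra sT \<and>
     presents_space sT {xs. length xs = n} t (multilinear_rels s n) \<and>
     t (replicate n 1) = 1 \<and>
     (\<forall>xs ys. length xs = n \<and> length ys = n \<longrightarrow> t xs * t ys = t (map2 (*) xs ys))"

text \<open>\<open>C\<close>, with the linear map \<open>c\<close>, is the quotient of the tensor algebra of the vector space
  \<open>(M, s)\<close> by the ideal generated by (the classes of) \<open>R\<close>. The tensor algebra is itself the quotient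
  of the free algebra on \<open>M\<close> by the ideal generated by the relations of degree one making the
  generators depend linearly on \<open>M\<close>, so both ideals are merged.\<close>

definition tensor_algebra_quotient ::
  "('k::field \<Rightarrow> 'm::ab_group_add \<Rightarrow> 'm) \<Rightarrow> ('m list \<Rightarrow>\<^sub>0 'k) set \<Rightarrow>
   ('k \<Rightarrow> 'c::ring_1 \<Rightarrow> 'c) \<Rightarrow> ('m \<Rightarrow> 'c) \<Rightarrow> bool" where
  "tensor_algebra_quotient s R sC c \<longleftrightarrow> k_algebra sC \<and>
     (let \<pi> = lin_ext sC (\<lambda>w. prod_list (map c w)) in
        surj \<pi> \<and> {p. \<pi> p = 0} = ideal_generated (multilinear_rels s 1 \<union> R))"

section \<open>Separable closures and scalar extension\<close>

definition separable_poly :: "'k::field poly \<Rightarrow> bool" where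
  "separable_poly p \<longleftrightarrow> coprime p (pderiv p)"

definition separable_closure :: "('f::field \<Rightarrow> 's::field) \<Rightarrow> bool" where
  "separable_closure \<iota> \<longleftrightarrow>
     \<iota> 1 = 1 \<and> (\<forall>x y. \<iota> (x + y) = \<iota> x + \<iota> y) \<and> (\<forall>x y. \<iota> (x * y) = \<iota> x * \<iota> y) \<and>
     (\<forall>x. \<exists>p. p \<noteq> 0 \<and> separable_poly p \<and> poly (map_poly \<iota> p) x = 0) \<and>
     (\<forall>p::'s poly. separable_poly p \<and> degree p > 0 \<longrightarrow> (\<exists>x. poly p x = 0))"

abbreviation base_scale :: "('f::field \<Rightarrow> 's::field) \<Rightarrow> 'f \<Rightarrow> 's \<Rightarrow> 's" where
  "base_scale \<iota> \<equiv> (\<lambda>c x. \<iota> c * x)"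

text \<open>The algebra \<open>(A\<^sub>s, sAs)\<close> is \<open>A \<otimes>\<^sub>F F\<^sub>s\<close>, with \<open>j a = a \<otimes> 1\<close>, hence
  \<open>a \<otimes> x = sAs x (j a)\<close>.\<close>

definition scalar_extension ::
  "('f::field \<Rightarrow> 's::field) \<Rightarrow> ('f \<Rightarrow> 'a::ring_1 \<Rightarrow> 'a) \<Rightarrow> ('s \<Rightarrow> 'as::ring_1 \<Rightarrow> 'as) \<Rightarrow> ('a \<Rightarrow> 'as) \<Rightarrow> bool" where
  "scalar_extension \<iota> sA sAs j \<longleftrightarrow> k_algebra sA \<and> k_algebra sAs \<and>
     alg_hom sA (\<lambda>c. sAs (\<iota> c)) j \<and>
     tensor_product sA UNIV (base_scale \<iota>) UNIV (\<lambda>c. sAs (\<iota> c)) (\<lambda>a x. sAs x (j a))"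

section \<open>\'Etale algebras with involution and their Clifford algebras\<close>

definition etale ::
  "('f::field \<Rightarrow> 's::field) \<Rightarrow> ('f \<Rightarrow> 'l::comm_ring_1 \<Rightarrow> 'l) \<Rightarrow>
   ('s \<Rightarrow> 'ls::comm_ring_1 \<Rightarrow> 'ls) \<Rightarrow> ('l \<Rightarrow> 'ls) \<Rightarrow> nat \<Rightarrow> bool" where
  "etale \<iota> sL sLs jL m \<longleftrightarrow> scalar_extension \<iota> sL sLs jL \<and>
     (\<exists>\<theta> :: 'ls \<Rightarrow> nat \<Rightarrow> 's. bij_betw \<theta> UNIV {g. \<forall>i\<ge>m. g i = 0} \<and>
        (\<forall>x y. \<theta> (x + y) = (\<lambda>i. \<theta> x i + \<theta> y i)) \<and>
        (\<forall>x y. \<theta> (x * y) = (\<lambda>i. \<theta> x i * \<theta> y i)) \<and>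
        (\<forall>c x. \<theta> (sLs c x) = (\<lambda>i. c * \<theta> x i)))"

text \<open>The set \<open>X(M)\<close> for a subset \<open>M\<close> that is an algebra with unit \<open>u\<close>; the values outside \<open>M\<close>
  are normalised.\<close>

definition alg_points ::
  "('f::field \<Rightarrow> 's::field) \<Rightarrow> ('f \<Rightarrow> 'l::ring_1 \<Rightarrow> 'l) \<Rightarrow> 'l set \<Rightarrow> 'l \<Rightarrow> ('l \<Rightarrow> 's) set" where
  "alg_points \<iota> s M u = {\<xi> \<in> extensional M. alg_hom_on s (base_scale \<iota>) M u \<xi>}"

definition etale_involution ::
  "('f::field \<Rightarrow> 's::field) \<Rightarrow> ('f \<Rightarrow> 'l::comm_ring_1 \<Rightarrow> 'l) \<Rightarrow> ('l \<Rightarrow> 'l) \<Rightarrow> bool" where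
  "etale_involution \<iota> sL \<sigma>L \<longleftrightarrow> alg_hom sL sL \<sigma>L \<and> \<sigma>L \<circ> \<sigma>L = id \<and> \<sigma>L \<noteq> id \<and>
     (\<forall>\<xi> \<in> alg_points \<iota> sL UNIV 1. \<xi> \<circ> \<sigma>L \<noteq> \<xi>)"

abbreviation fixed_set :: "('a \<Rightarrow> 'a) \<Rightarrow> 'a set" where
  "fixed_set \<sigma> \<equiv> {x. \<sigma> x = x}"

definition CY ::
  "('f::field \<Rightarrow> 's::field) \<Rightarrow> ('f \<Rightarrow> 'l::comm_ring_1 \<Rightarrow> 'l) \<Rightarrow> ('l \<Rightarrow> 'l) \<Rightarrow> nat \<Rightarrow> ('l \<Rightarrow> 's) set set" where
  "CY \<iota> sL \<sigma>L n = {\<omega>. \<omega> \<subseteq> alg_points \<iota> sL UNIV 1 \<and> finite \<omega> \<and> card \<omega> = n \<and>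
     (\<forall>\<xi>\<in>\<omega>. \<xi> \<circ> \<sigma>L \<notin> \<omega>)}"

text \<open>The map \<open>\<xi>\<^sub>1 \<otimes> \<dots> \<otimes> \<xi>\<^sub>n\<close> on the subspace \<open>M\<^sup>\<otimes>\<^sup>n\<close> of \<open>L\<^sup>\<otimes>\<^sup>n\<close>.\<close>

definition tensor_point ::
  "('f::field \<Rightarrow> 's::field) \<Rightarrow> 'l set \<Rightarrow> ('f \<Rightarrow> 't::comm_ring_1 \<Rightarrow> 't) \<Rightarrow> ('l list \<Rightarrow> 't) \<Rightarrow>
   ('l \<Rightarrow> 's) list \<Rightarrow> 't \<Rightarrow> 's" where
  "tensor_point \<iota> M sT t \<xi>s =
     induced sT {xs. length xs = length \<xi>s \<and> set xs \<subseteq> M} t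
       (base_scale \<iota>) (\<lambda>xs. \<Prod>i<length \<xi>s. (\<xi>s ! i) (xs ! i))"

definition clifford_idempotent ::
  "('f::field \<Rightarrow> 's::field) \<Rightarrow> ('f \<Rightarrow> 'l::comm_ring_1 \<Rightarrow> 'l) \<Rightarrow> ('l \<Rightarrow> 'l) \<Rightarrow> nat \<Rightarrow>
   ('f \<Rightarrow> 't::comm_ring_1 \<Rightarrow> 't) \<Rightarrow> ('l list \<Rightarrow> 't) \<Rightarrow> 't \<Rightarrow> bool" where
  "clifford_idempotent \<iota> sL \<sigma>L n sT t e \<longleftrightarrow>
     e \<in> module.span sT (t ` {xs. length xs = n \<and> set xs \<subseteq> fixed_set \<sigma>L}) \<and> e * e = e \<and>
     (\<forall>\<xi>s. length \<xi>s = n \<and> set \<xi>s \<subseteq> alg_points \<iota> sL (fixed_set \<sigma>L) 1 \<longrightarrow>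
        tensor_point \<iota> (fixed_set \<sigma>L) sT t \<xi>s e = (if distinct \<xi>s then 1 else 0))"

definition permute_factors ::
  "nat \<Rightarrow> ('f::field \<Rightarrow> 't::comm_ring_1 \<Rightarrow> 't) \<Rightarrow> ('l list \<Rightarrow> 't) \<Rightarrow> (nat \<Rightarrow> nat) \<Rightarrow> 't \<Rightarrow> 't" where
  "permute_factors n sT t p = induced sT {xs. length xs = n} t sT (\<lambda>xs. t (permute_list p xs))"

definition etale_clifford ::
  "nat \<Rightarrow> ('f::field \<Rightarrow> 't::comm_ring_1 \<Rightarrow> 't) \<Rightarrow> ('l list \<Rightarrow> 't) \<Rightarrow> 't \<Rightarrow> 't set" where
  "etale_clifford n sT t e =
     (\<lambda>u. e * u) ` {u. \<forall>p. p permutes {..<n} \<longrightarrow> permute_factors n sT t p u = u}"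

definition etale_clifford_map ::
  "nat \<Rightarrow> ('l::comm_ring_1 list \<Rightarrow> 't::comm_ring_1) \<Rightarrow> 't \<Rightarrow> 'l \<Rightarrow> 't" where
  "etale_clifford_map n t e x = e * (\<Sum>i<n. t ((replicate n 1)[i := x]))"

text \<open>The identification of \<open>CY(L, \<sigma>\<^sub>L)\<close> with \<open>X C(L, \<sigma>\<^sub>L)\<close>; on symmetric tensors the enumeration of
  \<open>\<omega>\<close> is immaterial.\<close>

definition CY_point ::
  "('f::field \<Rightarrow> 's::field) \<Rightarrow> nat \<Rightarrow> ('f \<Rightarrow> 't::comm_ring_1 \<Rightarrow> 't) \<Rightarrow> ('l list \<Rightarrow> 't) \<Rightarrow> 't \<Rightarrow>
   ('l \<Rightarrow> 's) set \<Rightarrow> 't \<Rightarrow> 's" where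
  "CY_point \<iota> n sT t e \<omega> =
     restrict (tensor_point \<iota> UNIV sT t (SOME \<xi>s. distinct \<xi>s \<and> set \<xi>s = \<omega>))
       (etale_clifford n sT t e)"

section \<open>Central simple algebras and quadratic pairs\<close>

definition central_simple :: "('f::field \<Rightarrow> 'a::ring_1 \<Rightarrow> 'a) \<Rightarrow> nat \<Rightarrow> bool" where
  "central_simple s d \<longleftrightarrow> k_algebra s \<and>
     (\<exists>B. finite B \<and> module.span s B = UNIV) \<and> vector_space.dim s (UNIV :: 'a set) = d\<^sup>2 \<and>
     {z::'a. \<forall>x. z * x = x * z} = range (\<lambda>c. s c 1) \<and>
     (\<forall>I::'a set. two_sided_ideal I \<longrightarrow> I = {0} \<or> I = UNIV)"

definition endo_trace :: "('k::field \<Rightarrow> 'v::ab_group_add \<Rightarrow> 'v) \<Rightarrow> ('v \<Rightarrow> 'v) \<Rightarrow> 'k" where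
  "endo_trace s T =
     (let B = (SOME B. \<not> module.dependent s B \<and> module.span s B = UNIV)
      in \<Sum>b\<in>B. module.representation s B (T b) b)"

text \<open>\<open>\<Phi>\<close> is an isomorphism from \<open>A\<^sub>s\<close> onto \<open>End V\<close>, with \<open>V\<close> finite dimensional.\<close>

definition splitting ::
  "('s::field \<Rightarrow> 'as::ring_1 \<Rightarrow> 'as) \<Rightarrow> ('s \<Rightarrow> 'v::ab_group_add \<Rightarrow> 'v) \<Rightarrow> ('as \<Rightarrow> 'v \<Rightarrow> 'v) \<Rightarrow> bool" where
  "splitting sAs sV \<Phi> \<longleftrightarrow> vector_space sV \<and> (\<exists>B. finite B \<and> module.span sV B = UNIV) \<and>
     bij_betw \<Phi> UNIV {T. Vector_Spaces.linear sV sV T} \<and>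
     (\<forall>x y. \<Phi> (x + y) = (\<lambda>v. \<Phi> x v + \<Phi> y v)) \<and>
     (\<forall>x y. \<Phi> (x * y) = \<Phi> x \<circ> \<Phi> y) \<and>
     (\<forall>c x. \<Phi> (sAs c x) = (\<lambda>v. sV c (\<Phi> x v)))"

text \<open>Reduced trace of \<open>A\<close>: the trace in the split algebra \<open>A\<^sub>s\<close>, which takes values in \<open>F\<close> on \<open>A\<close>.\<close>

definition reduced_trace ::
  "('f::field \<Rightarrow> 's::field) \<Rightarrow> ('a \<Rightarrow> 'as) \<Rightarrow> ('s \<Rightarrow> 'v::ab_group_add \<Rightarrow> 'v) \<Rightarrow> ('as \<Rightarrow> 'v \<Rightarrow> 'v) \<Rightarrow>
   ('a \<Rightarrow> 'f) \<Rightarrow> bool" where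
  "reduced_trace \<iota> jA sV \<Phi> trd \<longleftrightarrow> (\<forall>a. \<iota> (trd a) = endo_trace sV (\<Phi> (jA a)))"

abbreviation Sym :: "('a \<Rightarrow> 'a) \<Rightarrow> 'a set" where
  "Sym \<sigma> \<equiv> {x. \<sigma> x = x}"

abbreviation Skew :: "('a::ring_1 \<Rightarrow> 'a) \<Rightarrow> 'a set" where
  "Skew \<sigma> \<equiv> {x. \<sigma> x = - x}"

text \<open>Only the values of \<open>f\<close> on \<open>Sym \<sigma>\<close> matter.\<close>

definition quadratic_pair ::
  "('f::field \<Rightarrow> 'a::ring_1 \<Rightarrow> 'a) \<Rightarrow> ('a \<Rightarrow> 'f) \<Rightarrow> nat \<Rightarrow> ('a \<Rightarrow> 'a) \<Rightarrow> ('a \<Rightarrow> 'f) \<Rightarrow> bool" where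
  "quadratic_pair s trd n \<sigma> f \<longleftrightarrow>
     lin_on s s UNIV \<sigma> \<and> (\<forall>x y. \<sigma> (x * y) = \<sigma> y * \<sigma> x) \<and> (\<forall>x. \<sigma> (\<sigma> x) = x) \<and>
     lin_on s (*) (Sym \<sigma>) f \<and>
     vector_space.dim s (Sym \<sigma>) = n * (2 * n + 1) \<and>
     trd ` Skew \<sigma> = {0} \<and>
     (\<forall>x. f (x + \<sigma> x) = trd x)"

text \<open>The pair \<open>(\<sigma>s, fs)\<close> on \<open>A\<^sub>s\<close> obtained from \<open>(\<sigma>, f)\<close> by scalar extension.\<close>

definition pair_extension ::
  "('f::field \<Rightarrow> 's::field) \<Rightarrow> ('s \<Rightarrow> 'as::ring_1 \<Rightarrow> 'as) \<Rightarrow> ('a::ring_1 \<Rightarrow> 'as) \<Rightarrow>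
   ('a \<Rightarrow> 'a) \<Rightarrow> ('a \<Rightarrow> 'f) \<Rightarrow> ('as \<Rightarrow> 'as) \<Rightarrow> ('as \<Rightarrow> 's) \<Rightarrow> bool" where
  "pair_extension \<iota> sAs jA \<sigma> f \<sigma>s fs \<longleftrightarrow>
     lin_on sAs sAs UNIV \<sigma>s \<and> (\<forall>a. \<sigma>s (jA a) = jA (\<sigma> a)) \<and>
     lin_on sAs (*) (Sym \<sigma>s) fs \<and> (\<forall>a\<in>Sym \<sigma>. fs (jA a) = \<iota> (f a))"

definition polar :: "('v::ab_group_add \<Rightarrow> 'k::field) \<Rightarrow> 'v \<Rightarrow> 'v \<Rightarrow> 'k" where
  "polar q v w = q (v + w) - q v - q w"

definition quadratic_form :: "('k::field \<Rightarrow> 'v::ab_group_add \<Rightarrow> 'v) \<Rightarrow> ('v \<Rightarrow> 'k) \<Rightarrow> bool" where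
  "quadratic_form s q \<longleftrightarrow> (\<forall>c v. q (s c v) = c\<^sup>2 * q v) \<and>
     (\<forall>w. lin_on s (*) UNIV (\<lambda>v. polar q v w))"

definition hyperbolic :: "('k::field \<Rightarrow> 'v::ab_group_add \<Rightarrow> 'v) \<Rightarrow> ('v \<Rightarrow> 'k) \<Rightarrow> bool" where
  "hyperbolic s q \<longleftrightarrow> quadratic_form s q \<and>
     (\<forall>v. (\<forall>w. polar q v w = 0) \<longrightarrow> v = 0) \<and>
     (\<exists>U W. module.subspace s U \<and> module.subspace s W \<and> U \<inter> W = {0} \<and>
        {u + w | u w. u \<in> U \<and> w \<in> W} = UNIV \<and> (\<forall>u\<in>U. q u = 0) \<and> (\<forall>w\<in>W. q w = 0))"

text \<open>The element of \<open>A\<^sub>s\<close> corresponding to \<open>v \<otimes> w \<in> V \<otimes> V\<close>, i.e. to the endomorphism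
  \<open>x \<mapsto> v b\<^sub>q(w, x)\<close>.\<close>

definition vtens ::
  "('s::field \<Rightarrow> 'v::ab_group_add \<Rightarrow> 'v) \<Rightarrow> ('v \<Rightarrow> 's) \<Rightarrow> ('as \<Rightarrow> 'v \<Rightarrow> 'v) \<Rightarrow> 'v \<Rightarrow> 'v \<Rightarrow> 'as" where
  "vtens sV q \<Phi> v w = inv \<Phi> (\<lambda>x. sV (polar q w x) v)"

definition adjoint_pair ::
  "('s::field \<Rightarrow> 'v::ab_group_add \<Rightarrow> 'v) \<Rightarrow> ('v \<Rightarrow> 's) \<Rightarrow> ('as::ring_1 \<Rightarrow> 'v \<Rightarrow> 'v) \<Rightarrow>
   ('as \<Rightarrow> 'as) \<Rightarrow> ('as \<Rightarrow> 's) \<Rightarrow> bool" where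
  "adjoint_pair sV q \<Phi> \<sigma>s fs \<longleftrightarrow>
     (\<forall>x v w. polar q v (\<Phi> x w) = polar q (\<Phi> (\<sigma>s x) v) w) \<and>
     (\<forall>v. fs (vtens sV q \<Phi> v v) = q v)"

definition involution_embedding ::
  "('f::field \<Rightarrow> 'l::comm_ring_1 \<Rightarrow> 'l) \<Rightarrow> ('l \<Rightarrow> 'l) \<Rightarrow> ('f \<Rightarrow> 'a::ring_1 \<Rightarrow> 'a) \<Rightarrow> ('a \<Rightarrow> 'f) \<Rightarrow>
   ('a \<Rightarrow> 'a) \<Rightarrow> ('a \<Rightarrow> 'f) \<Rightarrow> ('l \<Rightarrow> 'a) \<Rightarrow> bool" where
  "involution_embedding sL \<sigma>L sA trd \<sigma> f \<epsilon> \<longleftrightarrow> alg_hom sL sA \<epsilon> \<and> inj \<epsilon> \<and>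
     \<epsilon> \<circ> \<sigma>L = \<sigma> \<circ> \<epsilon> \<and>
     (\<forall>x\<in>Sym \<sigma>. \<forall>l. l + \<sigma>L l = 1 \<longrightarrow> f x = trd (\<epsilon> l * x))"

section \<open>Clifford algebras\<close>

text \<open>An element \<open>u\<close> of \<open>A \<otimes> A\<close> is given by a combination of words of length 2. As
  \<open>Sand(\<sigma>\<^sub>2(u)) = Sand(u) \<circ> \<sigma>\<close> determines \<open>\<sigma>\<^sub>2(u)\<close>, the condition \<open>\<sigma>\<^sub>2(u) = u\<close> reads
  \<open>Sand(u) \<circ> \<sigma> = Sand(u)\<close>.\<close>

definition Sand :: "('f::field \<Rightarrow> 'a::ring_1 \<Rightarrow> 'a) \<Rightarrow> ('a list \<Rightarrow>\<^sub>0 'f) \<Rightarrow> 'a \<Rightarrow> 'a" where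
  "Sand s u x = lin_ext s (\<lambda>w. w ! 0 * x * w ! 1) u"

definition clifford_rels ::
  "('f::field \<Rightarrow> 'a::ring_1 \<Rightarrow> 'a) \<Rightarrow> ('a \<Rightarrow> 'a) \<Rightarrow> ('a \<Rightarrow> 'f) \<Rightarrow> 'a \<Rightarrow> ('a list \<Rightarrow>\<^sub>0 'f) set" where
  "clifford_rels s \<sigma> f l0 =
     {gen [x] - Poly_Mapping.single [] (f x) | x. x \<in> Sym \<sigma>} \<union>
     {u - gen [Sand s u l0] | u.
        Poly_Mapping.keys u \<subseteq> {w. length w = 2} \<and> Sand s u \<circ> \<sigma> = Sand s u}"

definition clifford_algebra ::
  "('f::field \<Rightarrow> 'a::ring_1 \<Rightarrow> 'a) \<Rightarrow> ('a \<Rightarrow> 'f) \<Rightarrow> ('a \<Rightarrow> 'a) \<Rightarrow> ('a \<Rightarrow> 'f) \<Rightarrow>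
   ('f \<Rightarrow> 'c::ring_1 \<Rightarrow> 'c) \<Rightarrow> ('a \<Rightarrow> 'c) \<Rightarrow> bool" where
  "clifford_algebra s trd \<sigma> f sC c \<longleftrightarrow>
     (\<exists>l0. (\<forall>x\<in>Sym \<sigma>. f x = trd (l0 * x)) \<and>
        tensor_algebra_quotient s (clifford_rels s \<sigma> f l0) sC c)"

definition quadratic_clifford_algebra ::
  "('k::field \<Rightarrow> 'v::ab_group_add \<Rightarrow> 'v) \<Rightarrow> ('v \<Rightarrow> 'k) \<Rightarrow> ('k \<Rightarrow> 'c::ring_1 \<Rightarrow> 'c) \<Rightarrow> ('v \<Rightarrow> 'c) \<Rightarrow> bool" where
  "quadratic_clifford_algebra sV q sC i \<longleftrightarrow>
     tensor_algebra_quotient sV {gen [v, v] - Poly_Mapping.single [] (q v) | v. True} sC i"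

definition clifford_even :: "('k::field \<Rightarrow> 'c::ring_1 \<Rightarrow> 'c) \<Rightarrow> ('v \<Rightarrow> 'c) \<Rightarrow> 'c set" where
  "clifford_even sC i = module.span sC {prod_list (map i vs) | vs. even (length vs)}"

definition clifford_odd :: "('k::field \<Rightarrow> 'c::ring_1 \<Rightarrow> 'c) \<Rightarrow> ('v \<Rightarrow> 'c) \<Rightarrow> 'c set" where
  "clifford_odd sC i = module.span sC {prod_list (map i vs) | vs. odd (length vs)}"

text \<open>The identification \<open>C(A\<^sub>s, \<sigma>\<^sub>s, f\<^sub>s) = C\<^sub>0(V, q)\<close>.\<close>

definition even_clifford_iso ::
  "('s::field \<Rightarrow> 'v::ab_group_add \<Rightarrow> 'v) \<Rightarrow> ('v \<Rightarrow> 's) \<Rightarrow> ('as \<Rightarrow> 'v \<Rightarrow> 'v) \<Rightarrow>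
   ('s \<Rightarrow> 'cs::ring_1 \<Rightarrow> 'cs) \<Rightarrow> ('as \<Rightarrow> 'cs) \<Rightarrow> ('s \<Rightarrow> 'cl::ring_1 \<Rightarrow> 'cl) \<Rightarrow> ('v \<Rightarrow> 'cl) \<Rightarrow>
   ('cs \<Rightarrow> 'cl) \<Rightarrow> bool" where
  "even_clifford_iso sV q \<Phi> sCs cAs sCl i \<Psi> \<longleftrightarrow>
     alg_hom sCs sCl \<Psi> \<and> bij_betw \<Psi> UNIV (clifford_even sCl i) \<and>
     (\<forall>v w. \<Psi> (cAs (vtens sV q \<Phi> v w)) = i v * i w)"

text \<open>\<open>C(\<epsilon>)\<close>, an embedding of the subset \<open>C(L, \<sigma>\<^sub>L)\<close> of the tensor power, whose unit is \<open>e\<close>.\<close>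

definition clifford_embedding ::
  "nat \<Rightarrow> ('f::field \<Rightarrow> 't::comm_ring_1 \<Rightarrow> 't) \<Rightarrow> ('l::comm_ring_1 list \<Rightarrow> 't) \<Rightarrow> 't \<Rightarrow>
   ('f \<Rightarrow> 'c::ring_1 \<Rightarrow> 'c) \<Rightarrow> ('a \<Rightarrow> 'c) \<Rightarrow> ('l \<Rightarrow> 'a) \<Rightarrow> ('t \<Rightarrow> 'c) \<Rightarrow> bool" where
  "clifford_embedding n sT t e sC cA \<epsilon> C\<epsilon> \<longleftrightarrow>
     alg_hom_on sT sC (etale_clifford n sT t e) e C\<epsilon> \<and> inj_on C\<epsilon> (etale_clifford n sT t e) \<and>
     (\<forall>l. C\<epsilon> (etale_clifford_map n t e l) = cA (\<epsilon> l))"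

section \<open>The four maps\<close>

definition isotropic_ideals ::
  "('s::field \<Rightarrow> 'as::ring_1 \<Rightarrow> 'as) \<Rightarrow> nat \<Rightarrow> ('as \<Rightarrow> 'as) \<Rightarrow> ('as \<Rightarrow> 's) \<Rightarrow> 'as set set" where
  "isotropic_ideals sAs n \<sigma>s fs = {I. right_ideal I \<and>
     (\<forall>x\<in>I. \<forall>y\<in>I. \<sigma>s x * y = 0) \<and> (\<forall>x \<in> I \<inter> Sym \<sigma>s. fs x = 0) \<and>
     vector_space.dim sAs I = 2 * n\<^sup>2}"

definition severi_brauer_points :: "('s::field \<Rightarrow> 'cs::ring_1 \<Rightarrow> 'cs) \<Rightarrow> nat \<Rightarrow> 'cs set set" where
  "severi_brauer_points sCs n = {J. right_ideal J \<and> vector_space.dim sCs J = 2 ^ (n - 1)}"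

definition eps_star ::
  "('s \<Rightarrow> 'as::ring_1 \<Rightarrow> 'as) \<Rightarrow> ('a \<Rightarrow> 'as) \<Rightarrow> ('l \<Rightarrow> 'a) \<Rightarrow> ('l \<Rightarrow> 's) \<Rightarrow> 'as set" where
  "eps_star sAs jA \<epsilon> \<xi> = {x. \<forall>l. sAs (\<xi> l) x = jA (\<epsilon> l) * x}"

definition C_eps_star ::
  "('s \<Rightarrow> 'as::ring_1 \<Rightarrow> 'as) \<Rightarrow> ('a \<Rightarrow> 'as) \<Rightarrow> ('l \<Rightarrow> 'a) \<Rightarrow> ('l \<Rightarrow> 's) set \<Rightarrow> 'as set" where
  "C_eps_star sAs jA \<epsilon> \<omega> = {\<Sum>\<xi>\<in>\<omega>. y \<xi> | y. \<forall>\<xi>\<in>\<omega>. y \<xi> \<in> eps_star sAs jA \<epsilon> \<xi>}"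

text \<open>\<open>C(\<epsilon>)\<^sub>*\<close>, for the algebra \<open>C\<close> carried by \<open>M\<close>.\<close>

definition Ceps_star ::
  "('s \<Rightarrow> 'cs::ring_1 \<Rightarrow> 'cs) \<Rightarrow> ('c \<Rightarrow> 'cs) \<Rightarrow> 't set \<Rightarrow> ('t \<Rightarrow> 'c) \<Rightarrow> ('t \<Rightarrow> 's) \<Rightarrow> 'cs set" where
  "Ceps_star sCs jC M C\<epsilon> \<eta> = {x. \<forall>c\<in>M. sCs (\<eta> c) x = jC (C\<epsilon> c) * x}"

text \<open>The Clifford bimodule \<open>V \<otimes> C\<^sub>1(V, q)\<close>, with tensor map \<open>tB\<close>: the linear map from
  \<open>A\<^sub>s = V \<otimes> V\<close>, and the right action of \<open>C\<^sub>0(V, q)\<close>.\<close>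

definition bimodule_map ::
  "('s::field \<Rightarrow> 'as::ring_1 \<Rightarrow> 'as) \<Rightarrow> ('s \<Rightarrow> 'v::ab_group_add \<Rightarrow> 'v) \<Rightarrow> ('v \<Rightarrow> 's) \<Rightarrow>
   ('as \<Rightarrow> 'v \<Rightarrow> 'v) \<Rightarrow> ('v \<Rightarrow> 'cl) \<Rightarrow> ('s \<Rightarrow> 'b::ab_group_add \<Rightarrow> 'b) \<Rightarrow>
   ('v \<Rightarrow> 'cl \<Rightarrow> 'b) \<Rightarrow> 'as \<Rightarrow> 'b" where
  "bimodule_map sAs sV q \<Phi> i sB tB =
     induced sAs UNIV (\<lambda>(v, w). vtens sV q \<Phi> v w) sB (\<lambda>(v, w). tB v (i w))"

definition bimodule_act ::
  "('s::field \<Rightarrow> 'cl::ring_1 \<Rightarrow> 'cl) \<Rightarrow> ('v \<Rightarrow> 'cl) \<Rightarrow> ('s \<Rightarrow> 'b::ab_group_add \<Rightarrow> 'b) \<Rightarrow>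
   ('v \<Rightarrow> 'cl \<Rightarrow> 'b) \<Rightarrow> 'b \<Rightarrow> 'cl \<Rightarrow> 'b" where
  "bimodule_act sCl i sB tB y x =
     induced sB (UNIV \<times> clifford_odd sCl i) (\<lambda>(v, w). tB v w) sB (\<lambda>(v, w). tB v (w * x)) y"

definition psi ::
  "('s::field \<Rightarrow> 'as::ring_1 \<Rightarrow> 'as) \<Rightarrow> ('s \<Rightarrow> 'v::ab_group_add \<Rightarrow> 'v) \<Rightarrow> ('v \<Rightarrow> 's) \<Rightarrow>
   ('as \<Rightarrow> 'v \<Rightarrow> 'v) \<Rightarrow> ('as \<Rightarrow> 'as) \<Rightarrow> ('s \<Rightarrow> 'cl::ring_1 \<Rightarrow> 'cl) \<Rightarrow> ('v \<Rightarrow> 'cl) \<Rightarrow> ('cs \<Rightarrow> 'cl) \<Rightarrow>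
   ('s \<Rightarrow> 'b::ab_group_add \<Rightarrow> 'b) \<Rightarrow> ('v \<Rightarrow> 'cl \<Rightarrow> 'b) \<Rightarrow> 'as set \<Rightarrow> 'cs set" where
  "psi sAs sV q \<Phi> \<sigma>s sCl i \<Psi> sB tB I =
     {x. \<forall>y\<in>I. bimodule_act sCl i sB tB (bimodule_map sAs sV q \<Phi> i sB tB (\<sigma>s y)) (\<Psi> x) = 0}"

end

theory Submission
  imports Defs
begin

text \<open>
  Over \<open>F\<^sub>s\<close> the idempotents \<open>E \<xi>\<close> of \<open>L\<^sub>s\<close> are mapped by \<open>\<epsilon>\<close> to \<open>2n\<close> orthogonal idempotents of \<open>End V\<close>, so
  their images are lines, pairwise orthogonal for the polar form except for \<open>\<xi>\<close> and \<open>\<xi> \<circ> \<sigma>\<^sub>L\<close>, and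
  isotropic by condition (b) on \<open>\<epsilon>\<close>. For \<open>\<omega>\<close> in \<open>CY\<close> one obtains a hyperbolic basis \<open>u \<xi>, w \<xi>\<close> indexed by
  \<open>\<xi> \<in> \<omega>\<close>, with \<open>\<epsilon>(E \<xi>) = u \<xi> \<otimes> w \<xi>\<close> and \<open>\<epsilon>(E (\<xi> \<circ> \<sigma>\<^sub>L)) = w \<xi> \<otimes> u \<xi>\<close>. The ideal attached to \<open>\<omega>\<close> is \<open>Hom(V, U)\<close>
  with \<open>U\<close> spanned by the \<open>u \<xi>\<close>, and its image under \<open>\<psi>\<close> is the set of \<open>x \<in> C\<^sub>0(V, q)\<close> with \<open>u \<xi> \<cdot> x = 0\<close> for
  all \<open>\<xi> \<in> \<omega>\<close>, i.e. with \<open>u \<xi> \<cdot> w \<xi> \<cdot> x = x\<close>. Since \<open>C(\<epsilon>)(c\<^sub>L(l))\<close> is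
  \<open>\<Sum>\<^sub>\<xi> \<xi>(l) u \<xi> \<cdot> w \<xi> + \<xi>(\<sigma>\<^sub>L l) w \<xi> \<cdot> u \<xi>\<close>, these are the \<open>x\<close> on which every \<open>c\<^sub>L(l)\<close> acts through the character of
  \<open>\<omega>\<close>, and such \<open>x\<close> are multiplied by this character by all of \<open>C(L, \<sigma>\<^sub>L)\<close>.
\<close>

section \<open>Linear algebra\<close>

text \<open>The \<open>E \<xi>\<close> exist only over \<open>F\<^sub>s\<close>, whereas
  \<open>c_L\<close>, \<open>C(\<epsilon>)\<close> and condition (b) live over \<open>F\<close>. So
  linear maps are lifted along the scalar extensions, and identities of lifted maps are tested on
  elements coming from \<open>F\<close>.

  Four points lie behind the overview. The bound dim V \<le> 2n is read off from the dimension of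
  \<open>A\<close>; together with \<open>\<epsilon>(E \<xi>)\<close> \<noteq> 0 it makes the images
  lines. In characteristic 2 the polar form does not control \<open>q\<close>, so condition (b) has
  to be made effective by producing some \<open>l\<close> with \<open>l + \<sigma>L l = 1\<close>.
  The dimension 2^(n-1) on the Clifford side comes from explicit products of frame vectors, whose
  independence follows from the Clifford relations and 1 \<noteq> 0. Finally, to pass from the
  elements \<open>c_L(l)\<close> to all of \<open>C(L, \<sigma>\<^sub>L)\<close>, a linear map on it
  is expanded over n-tuples of points; the product of the \<open>c_L(E \<xi>)\<close> over \<xi>
  \<in> \<omega> removes every tuple that does not enumerate \<omega>.\<close>

definition field_hom :: "('f::field \<Rightarrow> 's::field) \<Rightarrow> bool" where
  "field_hom \<iota> \<longleftrightarrow> \<iota> 1 = 1 \<and> (\<forall>x y. \<iota> (x + y) = \<iota> x + \<iota> y) \<and> (\<forall>x y. \<iota> (x * y) = \<iota> x * \<iota> y)"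

lemma separable_closure_field_hom: "separable_closure \<iota> \<Longrightarrow> field_hom \<iota>"
  by (simp add: separable_closure_def field_hom_def)

lemma field_hom_0: "field_hom \<iota> \<Longrightarrow> \<iota> 0 = 0"
  unfolding field_hom_def by (metis add_cancel_right_left)

lemma vector_space_restrict:
  assumes "vector_space sW" "field_hom \<iota>"
  shows "vector_space (\<lambda>c. sW (\<iota> c))"
proof -
  interpret vector_space sW by fact
  show ?thesis using assms(2)
    by unfold_locales (auto simp: field_hom_def algebra_simps)
qed

lemma vector_space_mult: "vector_space ((*) :: 'k::field \<Rightarrow> 'k \<Rightarrow> 'k)"
  by unfold_locales (auto simp: algebra_simps)

lemma k_algebra_vector_space: "k_algebra s \<Longrightarrow> vector_space s"
  by (simp add: k_algebra_def)

lemma linear_iff_lin_on: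
  "Vector_Spaces.linear s s' h \<longleftrightarrow> vector_space s \<and> vector_space s' \<and> lin_on s s' UNIV h"
  by (auto simp: Vector_Spaces.linear_iff lin_on_def)

lemma linear_compose':
  "Vector_Spaces.linear s s' f \<Longrightarrow> Vector_Spaces.linear s' s'' g \<Longrightarrow> Vector_Spaces.linear s s'' (\<lambda>x. g (f x))"
  using Vector_Spaces.linear_compose[of s s' f s'' g] by (simp add: comp_def)

lemma linear_zero_map: "vector_space s \<Longrightarrow> vector_space s' \<Longrightarrow> Vector_Spaces.linear s s' (\<lambda>_. 0)"
  by (simp add: Vector_Spaces.linear_iff module.scale_zero_right module_iff_vector_space)

lemma linear_restrict:
  "Vector_Spaces.linear s s' h \<Longrightarrow> field_hom \<iota> \<Longrightarrow>
   Vector_Spaces.linear (\<lambda>c. s (\<iota> c)) (\<lambda>c. s' (\<iota> c)) h"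
  by (auto simp: Vector_Spaces.linear_iff vector_space_restrict)

lemma linear_scale_map: "vector_space s \<Longrightarrow> Vector_Spaces.linear s s (s c)"
  using module.module_hom_scale_self module_hom_iff_linear module_iff_vector_space by blast

lemma linear_addD: "Vector_Spaces.linear s s' h \<Longrightarrow> h (x + y) = h x + h y"
  and linear_scaleD: "Vector_Spaces.linear s s' h \<Longrightarrow> h (s c x) = s' c (h x)"
  and linear_domD: "Vector_Spaces.linear s s' h \<Longrightarrow> vector_space s"
  and linear_codD: "Vector_Spaces.linear s s' h \<Longrightarrow> vector_space s'"
  by (auto simp: Vector_Spaces.linear_iff)

lemma linear_sumD:
  assumes "Vector_Spaces.linear s s' h"
  shows "h (sum g S) = (\<Sum>a\<in>S. h (g a))"
proof -
  interpret Vector_Spaces.linear s s' h by fact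
  show ?thesis by (rule sum)
qed

lemma linear_0D:
  assumes "Vector_Spaces.linear s s' h"
  shows "h 0 = 0"
proof -
  interpret Vector_Spaces.linear s s' h by fact
  show ?thesis by (rule zero)
qed

lemma linear_diffD:
  assumes "Vector_Spaces.linear s s' h"
  shows "h (x - y) = h x - h y"
proof -
  interpret Vector_Spaces.linear s s' h by fact
  show ?thesis by (rule diff)
qed

lemma linear_eq_spanD:
  assumes "Vector_Spaces.linear s s' f" "Vector_Spaces.linear s s' g"
    and "\<And>b. b \<in> B \<Longrightarrow> f b = g b" and "x \<in> module.span s B"
  shows "f x = g x"
proof -
  interpret f: Vector_Spaces.linear s s' f by fact
  interpret vector_space_pair s s' by unfold_locales
  show ?thesis using linear_eq_on[OF assms(1,2) assms(4)] assms(3) by auto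
qed

text \<open>Meant for maps that carry information only on a subspace, such as \<open>fs\<close> on
  \<open>Sym \<sigma>s\<close> or a map on \<open>C(L, \<sigma>\<^sub>L)\<close>: once extended,
  they can be treated as linear maps on the whole space.\<close>

lemma lin_on_extend:
  assumes "vector_space s" "vector_space s'" "module.subspace s M" "lin_on s s' M f"
  obtains g where "Vector_Spaces.linear s s' g" "\<And>x. x \<in> M \<Longrightarrow> g x = f x"
proof -
  interpret vector_space_pair s s' using assms(1,2) by (simp add: vector_space_pair_def)
  obtain B where B: "B \<subseteq> M" "vs1.independent B" "M \<subseteq> vs1.span B"
    using vs1.maximal_independent_subset[of M] by blast
  obtain g where g: "Vector_Spaces.linear s s' g" "\<forall>x\<in>B. g x = f x"
    using linear_independent_extend[OF B(2)] by blast
  have M: "vs1.span B = M" using B(1,3) assms(3) by (simp add: vs1.span_subspace)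
  have f0: "f 0 = 0"
    using assms(4) vs1.subspace_0[OF assms(3)] unfolding lin_on_def
    by (metis add_cancel_right_left)
  have "x \<in> M \<and> g x = f x" if "x \<in> vs1.span B" for x
    using that
  proof (induction rule: vs1.span_induct_alt)
    case base
    then show ?case using f0 linear_0D[OF g(1)] vs1.subspace_0[OF assms(3)] by simp
  next
    case (step c x y)
    then have x: "x \<in> M" and y: "y \<in> M" "g y = f y" using B(1) by auto
    have sx: "s c x \<in> M" by (rule vs1.subspace_scale[OF assms(3) x])
    then have "f (s c x + y) = s' c (f x) + f y"
      using assms(4) x y(1) by (simp add: lin_on_def)
    then show ?case
      using step(1) sx y g(2) vs1.subspace_add[OF assms(3)]
      by (simp add: linear_addD[OF g(1)] linear_scaleD[OF g(1)])
  qed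
  then show ?thesis using that g(1) M by blast
qed

text \<open>A section of \<open>h\<close> on its image, defined on the whole codomain. It makes
  \<open>x - \<rho> (h x)\<close> a projection onto the kernel of \<open>h\<close>, a formula that
  survives scalar extension.\<close>

lemma linear_generalized_inverse:
  assumes "Vector_Spaces.linear s s' h"
  obtains \<rho> where "Vector_Spaces.linear s' s \<rho>" "\<And>x. h (\<rho> (h x)) = h x"
proof -
  interpret Vector_Spaces.linear s s' h by fact
  interpret vector_space_pair s s' by unfold_locales
  show ?thesis
    using linear_exists_right_inverse_on[OF assms vs1.subspace_UNIV] that by blast
qed

lemma linear_left_inverse:
  assumes "Vector_Spaces.linear s s' h" "inj h"
  obtains \<rho> where "Vector_Spaces.linear s' s \<rho>" "\<And>x. \<rho> (h x) = x"
proof -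
  interpret Vector_Spaces.linear s s' h by fact
  interpret vector_space_pair s s' by unfold_locales
  show ?thesis
    using linear_injective_left_inverse[OF assms] that by (auto simp: fun_eq_iff)
qed

lemma functional_separating:
  assumes "vector_space s" "module.subspace s M" "x \<notin> M"
  obtains \<phi> where "Vector_Spaces.linear s (*) \<phi>" "\<And>y. y \<in> M \<Longrightarrow> \<phi> y = 0" "\<phi> x = 1"
proof -
  interpret vector_space_pair s "(*)" using assms(1) vector_space_mult by (simp add: vector_space_pair_def)
  obtain B where B: "B \<subseteq> M" "vs1.independent B" "M \<subseteq> vs1.span B"
    using vs1.maximal_independent_subset[of M] by blast
  have M: "vs1.span B = M" using B(1,3) assms(2) by (simp add: vs1.span_subspace)
  have "vs1.independent (insert x B)"
    using B(2) assms(3) M by (simp add: vs1.independent_insertI)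
  then obtain \<phi> where \<phi>: "Vector_Spaces.linear s (*) \<phi>" "\<forall>y\<in>insert x B. \<phi> y = (if y = x then 1 else 0)"
    using linear_independent_extend[of _ "\<lambda>y. if y = x then 1 else 0"] by blast
  have "\<phi> y = 0" if "y \<in> M" for y
  proof (rule linear_eq_spanD[OF \<phi>(1), of "\<lambda>_. 0"])
    show "Vector_Spaces.linear s (*) (\<lambda>_. 0)" by (simp add: linear_zero)
    show "\<phi> b = 0" if "b \<in> B" for b using \<phi>(2) that assms(3) B(1) by auto
    show "y \<in> vs1.span B" using that M by simp
  qed
  then show ?thesis using that \<phi> by auto
qed

text \<open>A coincidence \<open>g i = g j\<close> is itself a relation, with coefficients 1 and -1,
  so the hypothesis yields injectivity as well as independence of the image.\<close>

lemma independent_family: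
  assumes "vector_space s" "finite I" "\<And>a i. (\<Sum>i\<in>I. s (a i) (g i)) = 0 \<Longrightarrow> i \<in> I \<Longrightarrow> a i = 0"
  shows "inj_on g I \<and> \<not> module.dependent s (g ` I)"
proof -
  interpret vector_space s by fact
  have inj: "inj_on g I"
  proof (rule inj_onI, rule ccontr)
    fix i j assume ij: "i \<in> I" "j \<in> I" "g i = g j" "i \<noteq> j"
    let ?a = "\<lambda>k. if k = i then 1 else if k = j then -1 else (0::'a)"
    have "(\<Sum>k\<in>I. s (?a k) (g k)) = (\<Sum>k\<in>{i,j}. s (?a k) (g k))"
      using ij(1,2) assms(2) by (intro sum.mono_neutral_right) auto
    also have "\<dots> = 0" using ij by simp
    finally show False using assms(3)[of ?a i] ij(1) by simp
  qed
  have "independent (g ` I)"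
  proof (rule independent_if_scalars_zero)
    fix f x assume sum0: "(\<Sum>x\<in>g ` I. s (f x) x) = 0" and "x \<in> g ` I"
    then obtain i where "i \<in> I" "x = g i" by auto
    then show "f x = 0" using assms(3)[of "\<lambda>i. f (g i)"] sum0 by (simp add: sum.reindex[OF inj])
  qed (use assms(2) in simp)
  with inj show ?thesis by simp
qed

lemma family_coefficient_zero:
  assumes "vector_space s" "inj_on g I" "\<not> module.dependent s (g ` I)" "finite I"
    "(\<Sum>i\<in>I. s (a i) (g i)) = 0" "i \<in> I"
  shows "a i = 0"
proof -
  interpret vector_space s by fact
  let ?f = "\<lambda>x. a (the_inv_into I g x)"
  have "(\<Sum>x\<in>g ` I. s (?f x) x) = 0"
    using assms(5) by (simp add: sum.reindex[OF assms(2)] the_inv_into_f_f[OF assms(2)])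
  then have "?f (g i) = 0"
    by (rule independentD[OF assms(3), rotated -2]) (use assms in auto)
  then show ?thesis by (simp add: the_inv_into_f_f[OF assms(2,6)])
qed

section \<open>Free vector spaces, presentations and maps induced on generators\<close>

lemma lookup_pm_scale: "Poly_Mapping.lookup (pm_scale c p) x = c * Poly_Mapping.lookup p x"
  by (simp add: pm_scale_def Poly_Mapping.map.rep_eq when_def)

lemma vector_space_pm_scale: "vector_space pm_scale"
  by unfold_locales (auto intro!: poly_mapping_eqI simp: lookup_pm_scale lookup_add algebra_simps)

lemma lin_ext_superset:
  assumes "vector_space s" "finite Y" "Poly_Mapping.keys p \<subseteq> Y"
  shows "lin_ext s g p = (\<Sum>x\<in>Y. s (Poly_Mapping.lookup p x) (g x))"
proof -
  interpret vector_space s by fact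
  show ?thesis unfolding lin_ext_def using assms(2,3)
    by (intro sum.mono_neutral_left) (auto simp: in_keys_iff)
qed

lemma linear_lin_ext:
  assumes "vector_space s"
  shows "Vector_Spaces.linear pm_scale s (lin_ext s g)"
proof -
  interpret vector_space s by fact
  have "lin_ext s g (p + q) = lin_ext s g p + lin_ext s g q" for p q
  proof -
    let ?Y = "Poly_Mapping.keys p \<union> Poly_Mapping.keys q"
    have "Poly_Mapping.keys (p + q) \<subseteq> ?Y" by (rule Poly_Mapping.keys_add)
    then show ?thesis
      by (simp add: lin_ext_superset[OF assms, of ?Y] lookup_add scale_left_distrib sum.distrib)
  qed
  moreover have "lin_ext s g (pm_scale c p) = s c (lin_ext s g p)" for c p
  proof -
    have "Poly_Mapping.keys (pm_scale c p) \<subseteq> Poly_Mapping.keys p"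
      by (auto simp: in_keys_iff lookup_pm_scale)
    then show ?thesis
      by (simp add: lin_ext_superset[OF assms, of "Poly_Mapping.keys p"] lookup_pm_scale scale_sum_right)
  qed
  ultimately show ?thesis
    using assms vector_space_pm_scale by (simp add: Vector_Spaces.linear_iff)
qed

lemma lin_ext_single:
  assumes "vector_space s"
  shows "lin_ext s g (Poly_Mapping.single x c) = s c (g x)"
proof -
  interpret vector_space s by fact
  show ?thesis by (cases "c = 0") (simp_all add: lin_ext_def)
qed

lemma lin_ext_image:
  assumes "vector_space s"
  shows "lin_ext s g ` {p. Poly_Mapping.keys p \<subseteq> X} = module.span s (g ` X)"
proof -
  interpret vector_space s by fact
  interpret P: vector_space pm_scale by (rule vector_space_pm_scale)
  interpret L: Vector_Spaces.linear pm_scale s "lin_ext s g" by (rule linear_lin_ext[OF assms])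
  have "P.subspace {p. Poly_Mapping.keys p \<subseteq> X}"
    by (rule P.subspaceI) (auto simp: in_keys_iff lookup_pm_scale lookup_add subset_eq)
  then have "subspace (lin_ext s g ` {p. Poly_Mapping.keys p \<subseteq> X})"
    by (rule L.subspace_image)
  moreover have "g ` X \<subseteq> lin_ext s g ` {p. Poly_Mapping.keys p \<subseteq> X}"
  proof
    fix y assume "y \<in> g ` X"
    then obtain x where "x \<in> X" "y = g x" by auto
    then show "y \<in> lin_ext s g ` {p. Poly_Mapping.keys p \<subseteq> X}"
      by (intro image_eqI[of _ _ "gen x"]) (auto simp: lin_ext_single[OF assms])
  qed
  moreover have "lin_ext s g ` {p. Poly_Mapping.keys p \<subseteq> X} \<subseteq> span (g ` X)"
    by (auto simp: lin_ext_def intro!: span_sum span_scale intro: span_base)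
  ultimately show ?thesis using span_minimal by blast
qed

lemma presents_space_span:
  "presents_space s X g R \<Longrightarrow> module.span s (g ` X) = UNIV"
  by (simp add: presents_space_def lin_ext_image[symmetric])

text \<open>\<open>G\<close> is \<open>lin_ext s' h\<close> composed with a linear section \<gamma>
  of the presentation. Since \<open>\<gamma> (g x)\<close> and \<open>gen x\<close> represent the
  same vector, they differ by an element of the span of \<open>R\<close>, on which
  \<open>lin_ext s' h\<close> vanishes.\<close>

lemma presents_space_lift:
  assumes "presents_space s X g R" "vector_space s'" "\<And>r. r \<in> R \<Longrightarrow> lin_ext s' h r = 0"
  shows "\<exists>G. Vector_Spaces.linear s s' G \<and> (\<forall>x\<in>X. G (g x) = h x)"
proof -
  have vs: "vector_space s" and ker: "{p. Poly_Mapping.keys p \<subseteq> X \<and> lin_ext s g p = 0} = module.span pm_scale R"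
    and im: "lin_ext s g ` {p. Poly_Mapping.keys p \<subseteq> X} = UNIV"
    using assms(1) by (auto simp: presents_space_def)
  interpret P: vector_space pm_scale by (rule vector_space_pm_scale)
  interpret vector_space_pair pm_scale s using vs by (simp add: vector_space_pair_def P.vector_space_axioms)
  let ?K = "{p. Poly_Mapping.keys p \<subseteq> X}"
  have "P.subspace ?K"
    by (rule P.subspaceI) (auto simp: in_keys_iff lookup_pm_scale lookup_add subset_eq)
  then obtain \<gamma> where \<gamma>: "range \<gamma> \<subseteq> ?K" "Vector_Spaces.linear s pm_scale \<gamma>"
      "\<forall>v\<in>lin_ext s g ` ?K. lin_ext s g (\<gamma> v) = v"
    using linear_exists_right_inverse_on[OF linear_lin_ext[OF vs]] by blast
  note hl = linear_lin_ext[OF assms(2), of h] and gl = linear_lin_ext[OF vs, of g]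
  have "lin_ext s' h (\<gamma> (g x)) = h x" if "x \<in> X" for x
  proof -
    have "Poly_Mapping.keys (\<gamma> (g x)) \<subseteq> X" using \<gamma>(1) by auto
    then have "\<gamma> (g x) - gen x \<in> ?K"
      using keys_diff[of "\<gamma> (g x)" "gen x"] that by auto
    moreover have "lin_ext s g (\<gamma> (g x) - gen x) = 0"
      using \<gamma>(3) im by (simp add: linear_diffD[OF gl] lin_ext_single[OF vs])
    ultimately have "\<gamma> (g x) - gen x \<in> module.span pm_scale R" using ker by blast
    then have "lin_ext s' h (\<gamma> (g x) - gen x) = 0"
    proof (rule linear_eq_spanD[OF hl, of "\<lambda>_. 0", rotated 2])
      show "Vector_Spaces.linear pm_scale s' (\<lambda>_. 0)"
        by (rule linear_zero_map[OF vector_space_pm_scale assms(2)])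
    qed (use assms(3) in auto)
    then show ?thesis
      by (simp add: linear_diffD[OF hl] lin_ext_single[OF assms(2)] vector_space.vector_space_assms(4)[OF assms(2)])
  qed
  then show ?thesis using linear_compose'[OF \<gamma>(2) hl] by blast
qed

text \<open>\<open>induced\<close> evaluates at an arbitrarily chosen representative. As soon as
  some linear \<open>G\<close> has the prescribed values on the generators, the choice is
  immaterial; this is how permutations of factors, tensor points and the bimodule maps become
  computable.\<close>

lemma induced_eq:
  assumes "Vector_Spaces.linear s s' G" "\<And>x. x \<in> X \<Longrightarrow> G (g x) = h x" "u \<in> module.span s (g ` X)"
  shows "induced s X g s' h u = G u"
proof -
  have vs: "vector_space s" "vector_space s'" using assms(1) linear_domD linear_codD by blast+
  have "u \<in> lin_ext s g ` {p. Poly_Mapping.keys p \<subseteq> X}"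
    using assms(3) by (simp add: lin_ext_image[OF vs(1)])
  then have "\<exists>p. Poly_Mapping.keys p \<subseteq> X \<and> lin_ext s g p = u" by blast
  define p where "p = (SOME p. Poly_Mapping.keys p \<subseteq> X \<and> lin_ext s g p = u)"
  then have p: "Poly_Mapping.keys p \<subseteq> X" "lin_ext s g p = u"
    using someI_ex[OF \<open>\<exists>p. _ p\<close>] by auto
  have "induced s X g s' h u = lin_ext s' h p" by (simp add: induced_def p_def)
  also have "\<dots> = G (lin_ext s g p)"
    using p(1) assms(2)
    by (auto simp: lin_ext_def linear_sumD[OF assms(1)] linear_scaleD[OF assms(1)] intro!: sum.cong)
  finally show ?thesis using p(2) by simp
qed

section \<open>Universal property of scalar extension\<close>

lemma scalar_extension_span:
  assumes "scalar_extension \<iota> sA sAs j"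
  shows "module.span sAs (range j) = UNIV"
proof -
  have vs: "vector_space sAs" and ps: "presents_space (\<lambda>c. sAs (\<iota> c)) (UNIV \<times> UNIV) (\<lambda>(a, x). sAs x (j a)) (bilinear_rels sA UNIV (base_scale \<iota>) UNIV)"
    using assms by (auto simp: scalar_extension_def tensor_product_def k_algebra_vector_space)
  interpret vector_space sAs by fact
  interpret F: vector_space "\<lambda>c. sAs (\<iota> c)" using ps by (simp add: presents_space_def)
  have "F.subspace (span (range j))"
    by (rule F.subspaceI) (auto intro: span_add span_scale span_zero)
  moreover have "(\<lambda>(a, x). sAs x (j a)) ` (UNIV \<times> UNIV) \<subseteq> span (range j)"
    by (auto intro: span_scale span_base)
  ultimately show ?thesis
    using F.span_minimal presents_space_span[OF ps] by blast
qed

lemma scalar_extension_linear: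
  assumes "scalar_extension \<iota> sA sAs j" "field_hom \<iota>"
  shows "Vector_Spaces.linear sA (\<lambda>c. sAs (\<iota> c)) j"
  using assms by (auto simp: scalar_extension_def linear_iff_lin_on alg_hom_on_def k_algebra_vector_space vector_space_restrict)

text \<open>The presentation of the tensor product is one of vector spaces over \<open>F\<close>, so
  it only provides an \<open>F\<close>-linear map. That this map commutes with all scalars of
  \<open>F\<^sub>s\<close> is then checked on the generators \<open>sAs x (j a)\<close>.\<close>

lemma scalar_extension_lift:
  assumes se: "scalar_extension \<iota> sA sAs j" and \<iota>: "field_hom \<iota>" and vW: "vector_space sW"
    and h: "Vector_Spaces.linear sA (\<lambda>c. sW (\<iota> c)) h"
  obtains H where "Vector_Spaces.linear sAs sW H" "\<And>a. H (j a) = h a"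
proof -
  have vs: "vector_space sAs" and ps: "presents_space (\<lambda>c. sAs (\<iota> c)) (UNIV \<times> UNIV) (\<lambda>(a, x). sAs x (j a)) (bilinear_rels sA UNIV (base_scale \<iota>) UNIV)"
    using se by (auto simp: scalar_extension_def tensor_product_def k_algebra_vector_space)
  interpret S: vector_space sAs by fact
  interpret W: vector_space sW by fact
  have vWF: "vector_space (\<lambda>c. sW (\<iota> c))" by (rule vector_space_restrict[OF vW \<iota>])
  have ad: "h (x + y) = h x + h y" and sc: "h (sA c x) = sW (\<iota> c) (h x)" for x y c
    using linear_addD[OF h] linear_scaleD[OF h] by auto
  let ?h = "\<lambda>(a, x). sW x (h a)"
  note hl = linear_lin_ext[OF vWF, of ?h]
  have rel: "lin_ext (\<lambda>c. sW (\<iota> c)) ?h r = 0" if "r \<in> bilinear_rels sA UNIV (base_scale \<iota>) UNIV" for r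
    using that \<iota> unfolding bilinear_rels_def
    by (auto simp: linear_diffD[OF hl] lin_ext_single[OF vWF] ad sc W.scale_left_distrib W.scale_right_distrib
        field_hom_def mult.commute)
  obtain G where G: "Vector_Spaces.linear (\<lambda>c. sAs (\<iota> c)) (\<lambda>c. sW (\<iota> c)) G"
      "\<And>p. G ((\<lambda>(a, x). sAs x (j a)) p) = ?h p"
    using presents_space_lift[where h = ?h, OF ps vWF rel] by auto
  have G': "G (sAs x (j a)) = sW x (h a)" for a x using G(2)[of "(a, x)"] by simp
  have "G (sAs c u) = sW c (G u)" for c u
  proof (rule linear_eq_spanD[of "\<lambda>c. sAs (\<iota> c)" "\<lambda>c. sW (\<iota> c)" "\<lambda>u. G (sAs c u)" "\<lambda>u. sW c (G u)"])
    show "Vector_Spaces.linear (\<lambda>c. sAs (\<iota> c)) (\<lambda>c. sW (\<iota> c)) (\<lambda>u. G (sAs c u))"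
      by (rule linear_compose'[OF linear_restrict[OF linear_scale_map[OF vs] \<iota>] G(1)])
    show "Vector_Spaces.linear (\<lambda>c. sAs (\<iota> c)) (\<lambda>c. sW (\<iota> c)) (\<lambda>u. sW c (G u))"
      by (rule linear_compose'[OF G(1) linear_restrict[OF linear_scale_map[OF vW] \<iota>]])
    show "u \<in> module.span (\<lambda>c. sAs (\<iota> c)) ((\<lambda>(a, x). sAs x (j a)) ` (UNIV \<times> UNIV))"
      using presents_space_span[OF ps] by simp
    show "G (sAs c b) = sW c (G b)" if "b \<in> (\<lambda>(a, x). sAs x (j a)) ` (UNIV \<times> UNIV)" for b
      using that by (auto simp: G')
  qed
  moreover have "G (x + y) = G x + G y" for x y using linear_addD[OF G(1)] .
  ultimately have "Vector_Spaces.linear sAs sW G" using vs vW by (simp add: Vector_Spaces.linear_iff)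
  moreover have "G (j a) = h a" for a using G'[of 1 a] by simp
  ultimately show ?thesis using that by blast
qed

lemma scalar_extension_ext:
  assumes "scalar_extension \<iota> sA sAs j" "Vector_Spaces.linear sAs sW f" "Vector_Spaces.linear sAs sW g"
    "\<And>a. f (j a) = g (j a)"
  shows "f x = g x"
  using linear_eq_spanD[OF assms(2,3), of "range j" x] scalar_extension_span[OF assms(1)] assms(4) by auto

lemma k_algebra_mult: "k_algebra ((*) :: 'k::field \<Rightarrow> 'k \<Rightarrow> 'k)"
  by (auto simp: k_algebra_def k_algebra_axioms_def vector_space_mult)

lemma linear_mult_left: "k_algebra s \<Longrightarrow> Vector_Spaces.linear s s (\<lambda>x. x * y)"
  and linear_mult_right: "k_algebra s \<Longrightarrow> Vector_Spaces.linear s s (\<lambda>x. y * x)"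
  by (auto simp: Vector_Spaces.linear_iff k_algebra_def k_algebra_axioms_def algebra_simps)

lemma scalar_extension_mult:
  assumes se: "scalar_extension \<iota> sA sAs j" and kW: "k_algebra sW" and H: "Vector_Spaces.linear sAs sW H"
    and mult: "\<And>a b. H (j (a * b)) = H (j a) * H (j b)"
  shows "H (x * y) = H x * H y"
proof -
  have kA: "k_algebra sAs" and j: "\<And>a b. j (a * b) = j a * j b"
    using se by (auto simp: scalar_extension_def alg_hom_on_def)
  have 1: "H (j a * y) = H (j a) * H y" for a y
    by (rule scalar_extension_ext[OF se linear_compose'[OF linear_mult_right[OF kA] H]
        linear_compose'[OF H linear_mult_right[OF kW]]])
      (simp add: mult flip: j)
  show ?thesis
    by (rule scalar_extension_ext[OF se linear_compose'[OF linear_mult_left[OF kA] H]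
        linear_compose'[OF H linear_mult_left[OF kW]]]) (rule 1)
qed

section \<open>Points of \'etale algebras\<close>

text \<open>\<open>ev \<xi>\<close> is the extension of \<open>\<xi>\<close> to \<open>L\<^sub>s\<close>, and \<open>E \<xi>\<close> is the primitive idempotent of
  \<open>L\<^sub>s\<close> at which \<open>\<xi>\<close> does not vanish.\<close>

locale etale_coordinates =
  fixes \<iota> :: "'f::field \<Rightarrow> 's::field" and sL :: "'f \<Rightarrow> 'l::comm_ring_1 \<Rightarrow> 'l"
    and sLs :: "'s \<Rightarrow> 'ls::comm_ring_1 \<Rightarrow> 'ls" and jL :: "'l \<Rightarrow> 'ls"
    and ev :: "('l \<Rightarrow> 's) \<Rightarrow> 'ls \<Rightarrow> 's" and E :: "('l \<Rightarrow> 's) \<Rightarrow> 'ls"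
  assumes ext: "scalar_extension \<iota> sL sLs jL" and hom: "field_hom \<iota>"
    and fin: "finite (alg_points \<iota> sL UNIV 1)"
    and ev_linear: "\<xi> \<in> alg_points \<iota> sL UNIV 1 \<Longrightarrow> Vector_Spaces.linear sLs (*) (ev \<xi>)"
    and ev_j: "\<xi> \<in> alg_points \<iota> sL UNIV 1 \<Longrightarrow> ev \<xi> (jL l) = \<xi> l"
    and ev_E: "\<xi> \<in> alg_points \<iota> sL UNIV 1 \<Longrightarrow> \<zeta> \<in> alg_points \<iota> sL UNIV 1 \<Longrightarrow>
      ev \<xi> (E \<zeta>) = (if \<xi> = \<zeta> then 1 else 0)"
    and ev_eqI: "(\<And>\<xi>. \<xi> \<in> alg_points \<iota> sL UNIV 1 \<Longrightarrow> ev \<xi> x = ev \<xi> y) \<Longrightarrow> x = y"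
begin

abbreviation "X \<equiv> alg_points \<iota> sL UNIV 1"

lemma pointD:
  assumes "\<xi> \<in> X"
  shows "\<xi> (x + y) = \<xi> x + \<xi> y" "\<xi> (x * y) = \<xi> x * \<xi> y" "\<xi> 1 = 1" "\<xi> (sL c x) = \<iota> c * \<xi> x"
  using assms by (auto simp: alg_points_def alg_hom_on_def lin_on_def)

lemma jL_hom: "jL (x * y) = jL x * jL y" "jL 1 = 1" "jL (x + y) = jL x + jL y" "jL (sL c x) = sLs (\<iota> c) (jL x)"
  using ext by (auto simp: scalar_extension_def alg_hom_on_def lin_on_def)

lemma vs_L: "vector_space sL" and vs_Ls: "vector_space sLs"
  using ext by (auto simp: scalar_extension_def k_algebra_vector_space)

lemma ev_mult: "\<xi> \<in> X \<Longrightarrow> ev \<xi> (x * y) = ev \<xi> x * ev \<xi> y"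
  using scalar_extension_mult[OF ext k_algebra_mult ev_linear] by (simp add: ev_j pointD)

lemma ev_1: "\<xi> \<in> X \<Longrightarrow> ev \<xi> 1 = 1"
  using ev_j[of \<xi> 1] by (simp add: jL_hom pointD)

lemmas ev_sum = linear_sumD[OF ev_linear] and ev_scale = linear_scaleD[OF ev_linear]
  and ev_add = linear_addD[OF ev_linear]

lemma expand: "y = (\<Sum>\<xi>\<in>X. sLs (ev \<xi> y) (E \<xi>))"
  by (rule ev_eqI) (simp add: ev_sum ev_scale ev_E fin if_distrib[of "\<lambda>z. _ * z"] cong: if_cong)

lemma sum_E: "(\<Sum>\<xi>\<in>X. E \<xi>) = 1"
  by (rule ev_eqI) (simp add: ev_sum ev_E ev_1 fin)

lemma mult_E: "\<xi> \<in> X \<Longrightarrow> y * E \<xi> = sLs (ev \<xi> y) (E \<xi>)"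
  by (rule ev_eqI) (auto simp: ev_scale ev_mult ev_E)

lemma E_mult_E: "\<xi> \<in> X \<Longrightarrow> \<zeta> \<in> X \<Longrightarrow> E \<xi> * E \<zeta> = (if \<xi> = \<zeta> then E \<xi> else 0)"
  by (rule ev_eqI) (auto simp: ev_mult ev_E linear_0D[OF ev_linear])

text \<open>Over \<open>F\<^sub>s\<close> the sum of the \<open>E \<xi>\<close> with \<xi> \<in>
  \<omega> is such an element, because \<omega> contains exactly one point of each conjugate pair.
  This descends: if 1 were not of the form \<open>l + \<sigma>L l\<close>, a functional on
  \<open>L\<close> vanishing on all these elements but not at 1 would extend to
  \<open>L\<^sub>s\<close> and contradict the solution found there.\<close>

lemma exists_trace_one:
  assumes \<sigma>: "alg_hom sL sL \<sigma>L" and mem: "\<And>\<xi>. \<xi> \<in> X \<Longrightarrow> \<xi> \<in> \<omega> \<longleftrightarrow> \<xi> \<circ> \<sigma>L \<notin> \<omega>"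
    and \<omega>: "\<omega> \<subseteq> X"
  obtains l where "l + \<sigma>L l = 1"
proof -
  interpret L: vector_space sL by (rule vs_L)
  have \<sigma>D: "\<sigma>L (x + y) = \<sigma>L x + \<sigma>L y" "\<sigma>L (x * y) = \<sigma>L x * \<sigma>L y" "\<sigma>L 1 = 1" "\<sigma>L (sL c x) = sL c (\<sigma>L x)" for x y c
    using \<sigma> by (auto simp: alg_hom_on_def lin_on_def)
  have \<sigma>lin: "Vector_Spaces.linear sL sL \<sigma>L" by (simp add: Vector_Spaces.linear_iff vs_L \<sigma>D)
  have X\<sigma>: "\<xi> \<circ> \<sigma>L \<in> X" if "\<xi> \<in> X" for \<xi>
    using that by (auto simp: alg_points_def alg_hom_on_def lin_on_def \<sigma>D)
  define R where "R = range (\<lambda>l. l + \<sigma>L l)"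
  have "1 \<in> R"
  proof (rule ccontr)
    assume n: "1 \<notin> R"
    have "L.subspace R"
    proof (rule L.subspaceI)
      show "0 \<in> R" unfolding R_def by (rule range_eqI[of _ _ 0]) (simp add: linear_0D[OF \<sigma>lin])
      show "x + y \<in> R" if "x \<in> R" "y \<in> R" for x y
      proof -
        obtain a b where "x = a + \<sigma>L a" "y = b + \<sigma>L b" using \<open>x \<in> R\<close> \<open>y \<in> R\<close> by (auto simp: R_def)
        then show ?thesis unfolding R_def by (intro range_eqI[of _ _ "a + b"]) (simp add: \<sigma>D algebra_simps)
      qed
      show "sL c x \<in> R" if "x \<in> R" for x c
      proof -
        obtain a where "x = a + \<sigma>L a" using \<open>x \<in> R\<close> by (auto simp: R_def)
        then show ?thesis unfolding R_def by (intro range_eqI[of _ _ "sL c a"]) (simp add: \<sigma>D L.scale_right_distrib)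
      qed
    qed
    then obtain \<phi> where \<phi>: "Vector_Spaces.linear sL (*) \<phi>" "\<And>y. y \<in> R \<Longrightarrow> \<phi> y = 0" "\<phi> 1 = 1"
      using functional_separating[OF vs_L _ n] by metis
    have "Vector_Spaces.linear sL (\<lambda>c. (*) (\<iota> c)) (\<lambda>x. \<iota> (\<phi> x))"
      using \<phi>(1) hom vs_L vector_space_restrict[OF vector_space_mult hom]
      by (auto simp: Vector_Spaces.linear_iff field_hom_def)
    then obtain \<Phi> where \<Phi>: "Vector_Spaces.linear sLs (*) \<Phi>" "\<And>a. \<Phi> (jL a) = \<iota> (\<phi> a)"
      using scalar_extension_lift[OF ext hom vector_space_mult] by metis
    obtain \<sigma>s where \<sigma>s: "Vector_Spaces.linear sLs sLs \<sigma>s" "\<And>a. \<sigma>s (jL a) = jL (\<sigma>L a)"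
      using scalar_extension_lift[OF ext hom vs_Ls linear_compose'[OF \<sigma>lin scalar_extension_linear[OF ext hom]]]
      by metis
    have ev_\<sigma>s: "ev \<xi> (\<sigma>s y) = ev (\<xi> \<circ> \<sigma>L) y" if "\<xi> \<in> X" for \<xi> y
      by (rule scalar_extension_ext[OF ext linear_compose'[OF \<sigma>s(1) ev_linear[OF that]] ev_linear[OF X\<sigma>[OF that]]])
        (simp add: \<sigma>s(2) ev_j that X\<sigma>)
    define y where "y = (\<Sum>\<xi>\<in>\<omega>. E \<xi>)"
    have fin\<omega>: "finite \<omega>" using \<omega> fin finite_subset by blast
    have evy: "ev \<xi> y = (if \<xi> \<in> \<omega> then 1 else 0)" if "\<xi> \<in> X" for \<xi>
    proof -
      have "ev \<xi> y = (\<Sum>\<zeta>\<in>\<omega>. if \<xi> = \<zeta> then 1 else 0)"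
        unfolding y_def ev_sum[OF that] using \<omega> that by (intro sum.cong) (auto simp: ev_E)
      then show ?thesis using fin\<omega> by simp
    qed
    have "y + \<sigma>s y = jL 1"
      by (rule ev_eqI) (use mem in \<open>auto simp: ev_add ev_\<sigma>s evy X\<sigma> jL_hom ev_1\<close>)
    then have "\<Phi> (y + \<sigma>s y) = 1" using \<Phi>(2) \<phi>(3) hom by (simp add: field_hom_def)
    moreover have "\<Phi> (y + \<sigma>s y) = 0"
    proof (rule scalar_extension_ext[OF ext, of "(*)" "\<lambda>y. \<Phi> (y + \<sigma>s y)" "\<lambda>_. 0"])
      show "Vector_Spaces.linear sLs (*) (\<lambda>y. \<Phi> (y + \<sigma>s y))"
        using \<Phi>(1) \<sigma>s(1) by (auto simp: Vector_Spaces.linear_iff algebra_simps)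
      show "Vector_Spaces.linear sLs (*) (\<lambda>y. 0)"
        by (rule linear_zero_map[OF vs_Ls vector_space_mult])
      have "\<phi> (a + \<sigma>L a) = 0" for a using \<phi>(2) by (auto simp: R_def)
      then show "\<Phi> (jL a + \<sigma>s (jL a)) = 0" for a
        by (simp add: \<sigma>s(2) \<Phi>(2) field_hom_0[OF hom] flip: jL_hom)
    qed
    ultimately show False by simp
  qed
  then show ?thesis using that by (auto simp: R_def)
qed

end

text \<open>The points are the coordinates of \<theta> restricted to \<open>L\<close>. Conversely, a
  point extends to a multiplicative functional \<open>H\<close> on \<open>L\<^sub>s\<close>; the
  coordinate idempotents \<open>d i\<close> sum to 1, so \<open>H (d i) = 1\<close> for some
  \<open>i\<close>, and \<open>y * d i = sLs (\<theta> y i) (d i)\<close> then identifies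
  \<open>H\<close> with the \<open>i\<close>-th coordinate.\<close>

lemma etale_imp_coordinates:
  fixes \<iota> :: "'f::field \<Rightarrow> 's::field" and sL :: "'f \<Rightarrow> 'l::comm_ring_1 \<Rightarrow> 'l"
    and sLs :: "'s \<Rightarrow> 'ls::comm_ring_1 \<Rightarrow> 'ls"
  assumes et: "etale \<iota> sL sLs jL m" and hom: "field_hom \<iota>"
  obtains ev E where "etale_coordinates \<iota> sL sLs jL ev E" "card (alg_points \<iota> sL UNIV 1) = m"
proof -
  obtain \<theta> :: "'ls \<Rightarrow> nat \<Rightarrow> 's" where bij: "bij_betw \<theta> UNIV {g. \<forall>i\<ge>m. g i = 0}"
    and add: "\<And>x y. \<theta> (x + y) = (\<lambda>i. \<theta> x i + \<theta> y i)"
    and mult: "\<And>x y. \<theta> (x * y) = (\<lambda>i. \<theta> x i * \<theta> y i)"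
    and scale: "\<And>c x. \<theta> (sLs c x) = (\<lambda>i. c * \<theta> x i)" and ext: "scalar_extension \<iota> sL sLs jL"
    using et unfolding etale_def by blast
  have kL: "k_algebra sL" "k_algebra sLs" and vLs: "vector_space sLs"
    using ext by (auto simp: scalar_extension_def k_algebra_vector_space)
  have jL: "jL (x * y) = jL x * jL y" "jL 1 = 1" "jL (x + y) = jL x + jL y" "jL (sL c x) = sLs (\<iota> c) (jL x)" for x y c
    using ext by (auto simp: scalar_extension_def alg_hom_on_def lin_on_def)
  have \<theta>0: "\<theta> x i = 0" if "i \<ge> m" for x i using bij that by (auto simp: bij_betw_def)
  have ex: "\<exists>x. \<theta> x = (\<lambda>k. if k < m then g k else 0)" for g
  proof -
    have "(\<lambda>k. if k < m then g k else 0) \<in> range \<theta>" using bij by (auto simp: bij_betw_def)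
    then show ?thesis by (metis rangeE)
  qed
  define d where "d = (\<lambda>i. SOME x. \<theta> x = (\<lambda>k. if k < m then (if k = i then 1 else 0) else 0))"
  have d: "\<theta> (d i) k = (if k < m \<and> k = i then 1 else 0)" for i k
    using someI_ex[OF ex[of "\<lambda>k. if k = i then 1 else 0"]] by (simp add: d_def)
  have inj: "x = y" if "\<And>i. i < m \<Longrightarrow> \<theta> x i = \<theta> y i" for x y
  proof -
    have "\<theta> x i = \<theta> y i" for i using that \<theta>0 by (cases "i < m") auto
    then have "\<theta> x = \<theta> y" by blast
    then show ?thesis using bij by (metis bij_betw_imp_inj_on injD)
  qed
  \<comment> \<open>Preservation of the unit is deduced from surjectivity: the preimage
    \<open>u\<close> of the all-ones vector satisfies \<open>u * 1 = u\<close>.\<close>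
  have \<theta>1: "\<theta> 1 i = (if i < m then 1 else 0)" for i
  proof -
    obtain u where u: "\<theta> u = (\<lambda>k. if k < m then 1 else 0)" using ex[of "\<lambda>_. 1"] by auto
    have "\<theta> u i * \<theta> 1 i = \<theta> u i" using fun_cong[OF mult[of u 1], of i] by simp
    then show ?thesis using u \<theta>0[of i] by (auto split: if_splits)
  qed
  have lin: "Vector_Spaces.linear sLs (*) (\<lambda>x. \<theta> x i)" for i
    by (simp add: Vector_Spaces.linear_iff vLs vector_space_mult add scale)
  have sum: "\<theta> (sum g S) i = (\<Sum>a\<in>S. \<theta> (g a) i)" for g S i
    by (rule linear_sumD[OF lin])
  define pt where "pt = (\<lambda>i x. \<theta> (jL x) i)"
  let ?X = "alg_points \<iota> sL UNIV 1"
  have pt_in: "pt i \<in> ?X" if "i < m" for i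
    using that by (auto simp: alg_points_def alg_hom_on_def lin_on_def pt_def jL add mult scale \<theta>1)
  have pt_inj: "inj_on pt {..<m}"
  proof (rule inj_onI)
    fix i k assume ik: "i \<in> {..<m}" "k \<in> {..<m}" "pt i = pt k"
    have "\<theta> (d i) i = \<theta> (d i) k"
      by (rule scalar_extension_ext[OF ext lin lin]) (use ik(3) in \<open>simp add: pt_def fun_eq_iff\<close>)
    then show "i = k" using ik d by (simp split: if_splits)
  qed
  have pt_surj: "\<xi> \<in> pt ` {..<m}" if \<xi>: "\<xi> \<in> ?X" for \<xi>
  proof -
    have \<xi>D: "\<xi> (x + y) = \<xi> x + \<xi> y" "\<xi> (x * y) = \<xi> x * \<xi> y" "\<xi> 1 = 1" "\<xi> (sL c x) = \<iota> c * \<xi> x" for x y c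
      using \<xi> by (auto simp: alg_points_def alg_hom_on_def lin_on_def)
    have "Vector_Spaces.linear sL (\<lambda>c. (*) (\<iota> c)) \<xi>"
      using vector_space_restrict[OF vector_space_mult hom] kL(1)
      by (simp add: Vector_Spaces.linear_iff \<xi>D k_algebra_vector_space)
    then obtain H where H: "Vector_Spaces.linear sLs (*) H" "\<And>a. H (jL a) = \<xi> a"
      using scalar_extension_lift[OF ext hom vector_space_mult] by metis
    have Hm: "H (x * y) = H x * H y" for x y
      by (rule scalar_extension_mult[OF ext k_algebra_mult H(1)]) (simp add: H(2) \<xi>D)
    have "(\<Sum>i<m. d i) = jL 1"
      by (rule inj) (simp add: jL sum d \<theta>1 cong: if_cong)
    then have "(\<Sum>i<m. H (d i)) = 1" using linear_sumD[OF H(1), of d "{..<m}"] H(2) \<xi>D by simp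
    then obtain i where i: "i < m" "H (d i) \<noteq> 0" by (metis (no_types, lifting) lessThan_iff sum.neutral zero_neq_one)
    have "d i * d i = d i" by (rule inj) (simp add: mult d)
    then have "H (d i) = 1" using i(2) Hm[of "d i" "d i"] by simp
    have "H y = \<theta> y i" for y
    proof -
      have "y * d i = sLs (\<theta> y i) (d i)" by (rule inj) (simp add: mult d scale)
      then have "H y * H (d i) = \<theta> y i * H (d i)" using Hm linear_scaleD[OF H(1)] by metis
      then show ?thesis using \<open>H (d i) = 1\<close> by simp
    qed
    then have "\<xi> = pt i" using H(2) by (auto simp: pt_def fun_eq_iff)
    then show ?thesis using i(1) by blast
  qed
  have X: "?X = pt ` {..<m}" using pt_in pt_surj by auto
  let ?k = "inv_into {..<m} pt"
  have k: "?k (pt i) = i" if "i < m" for i using pt_inj that by simp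
  have "etale_coordinates \<iota> sL sLs jL (\<lambda>\<xi> y. \<theta> y (?k \<xi>)) (\<lambda>\<xi>. d (?k \<xi>))"
  proof (rule etale_coordinates.intro)
    fix \<xi> \<zeta> assume "\<xi> \<in> ?X" "\<zeta> \<in> ?X"
    then show "\<theta> (d (?k \<zeta>)) (?k \<xi>) = (if \<xi> = \<zeta> then 1 else 0)"
      using pt_inj by (auto simp: X k d inj_on_eq_iff)
  next
    fix x y assume "\<And>\<xi>. \<xi> \<in> ?X \<Longrightarrow> \<theta> x (?k \<xi>) = \<theta> y (?k \<xi>)"
    then have "\<theta> x i = \<theta> y i" if "i < m" for i using k that X by (metis imageI lessThan_iff)
    then show "x = y" by (rule inj)
  next
    fix \<xi> l assume "\<xi> \<in> ?X"
    then show "\<theta> (jL l) (?k \<xi>) = \<xi> l" by (auto simp: X k) (simp add: pt_def)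
  qed (use ext hom lin X in auto)
  moreover have "card ?X = m" using pt_inj by (simp add: X card_image)
  ultimately show ?thesis using that by blast
qed

text \<open>An additive group is not the union of two proper subgroups; apply this to the subgroups
  of \<open>L\<close> where \<open>\<zeta>\<close> agrees with \<open>\<xi>\<close> and where it agrees with \<open>\<xi> \<circ> \<sigma>\<^sub>L\<close>.\<close>

lemma points_agree_on_fixed:
  fixes \<xi> \<zeta> :: "'l::comm_ring_1 \<Rightarrow> 's::field"
  assumes \<sigma>: "alg_hom sL sL \<sigma>L" "\<sigma>L \<circ> \<sigma>L = id"
    and \<xi>: "\<xi> \<in> alg_points \<iota> sL UNIV 1" and \<zeta>: "\<zeta> \<in> alg_points \<iota> sL UNIV 1"
    and eq: "\<And>x. \<sigma>L x = x \<Longrightarrow> \<xi> x = \<zeta> x"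
  shows "\<zeta> = \<xi> \<or> \<zeta> = \<xi> \<circ> \<sigma>L"
proof -
  have \<sigma>D: "\<sigma>L (x + y) = \<sigma>L x + \<sigma>L y" "\<sigma>L (x * y) = \<sigma>L x * \<sigma>L y" "\<sigma>L (\<sigma>L x) = x" for x y
    using \<sigma> by (auto simp: alg_hom_on_def lin_on_def fun_eq_iff)
  have \<xi>D: "\<xi> (x + y) = \<xi> x + \<xi> y" "\<xi> (x * y) = \<xi> x * \<xi> y" for x y
    using \<xi> by (auto simp: alg_points_def alg_hom_on_def lin_on_def)
  have \<zeta>D: "\<zeta> (x + y) = \<zeta> x + \<zeta> y" "\<zeta> (x * y) = \<zeta> x * \<zeta> y" for x y
    using \<zeta> by (auto simp: alg_points_def alg_hom_on_def lin_on_def)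
  \<comment> \<open>\<open>x + \<sigma>L x\<close> and \<open>x * \<sigma>L x\<close> are fixed by
    \<open>\<sigma>L\<close>, so \<open>\<zeta> x\<close> is a root of the quadratic polynomial with
    roots \<open>\<xi> x\<close> and \<open>\<xi> (\<sigma>L x)\<close>.\<close>
  have or: "\<zeta> x = \<xi> x \<or> \<zeta> x = \<xi> (\<sigma>L x)" for x
  proof -
    have "\<xi> x + \<xi> (\<sigma>L x) = \<zeta> x + \<zeta> (\<sigma>L x)"
      using eq[of "x + \<sigma>L x"] by (simp add: \<sigma>D \<xi>D \<zeta>D add.commute)
    moreover have "\<xi> x * \<xi> (\<sigma>L x) = \<zeta> x * \<zeta> (\<sigma>L x)"
      using eq[of "x * \<sigma>L x"] by (simp add: \<sigma>D \<xi>D \<zeta>D mult.commute)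
    ultimately have "(\<zeta> x - \<xi> x) * (\<zeta> x - \<xi> (\<sigma>L x)) = 0" by algebra
    then show ?thesis by simp
  qed
  show ?thesis
  proof (rule ccontr)
    assume "\<not> ?thesis"
    then obtain x y where xy: "\<zeta> x \<noteq> \<xi> x" "\<zeta> y \<noteq> \<xi> (\<sigma>L y)" by (auto simp: fun_eq_iff)
    then have "\<zeta> x = \<xi> (\<sigma>L x)" "\<zeta> y = \<xi> y" using or by blast+
    then show False using or[of "x + y"] xy by (simp add: \<zeta>D \<xi>D \<sigma>D)
  qed
qed

text \<open>\<omega> and its conjugate are disjoint and have \<open>n\<close> elements each, so
  together they exhaust the \<open>2 * n\<close> points.\<close>

lemma CY_partition:
  fixes \<iota> :: "'f::field \<Rightarrow> 's::field" and \<sigma>L :: "'l::comm_ring_1 \<Rightarrow> 'l"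
  assumes \<sigma>: "alg_hom sL sL \<sigma>L" "\<sigma>L \<circ> \<sigma>L = id"
    and fin: "finite (alg_points \<iota> sL UNIV 1)" and card: "card (alg_points \<iota> sL UNIV 1) = 2 * n"
    and \<omega>: "\<omega> \<in> CY \<iota> sL \<sigma>L n" and \<xi>: "\<xi> \<in> alg_points \<iota> sL UNIV 1"
  shows "\<xi> \<in> \<omega> \<longleftrightarrow> \<xi> \<circ> \<sigma>L \<notin> \<omega>"
proof -
  have \<sigma>\<sigma>: "(\<zeta> \<circ> \<sigma>L) \<circ> \<sigma>L = \<zeta>" for \<zeta> :: "'l \<Rightarrow> 's" using \<sigma>(2) by (simp add: comp_assoc)
  let ?\<omega>' = "(\<lambda>\<zeta>. \<zeta> \<circ> \<sigma>L) ` \<omega>"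
  have om: "\<omega> \<subseteq> alg_points \<iota> sL UNIV 1" "finite \<omega>" "card \<omega> = n" "\<And>\<zeta>. \<zeta> \<in> \<omega> \<Longrightarrow> \<zeta> \<circ> \<sigma>L \<notin> \<omega>"
    using \<omega> by (auto simp: CY_def)
  have "inj_on (\<lambda>\<zeta>. \<zeta> \<circ> \<sigma>L) \<omega>" 
    by (rule inj_onI) (use \<sigma>\<sigma> in \<open>metis (no_types, lifting)\<close>)
  then have "card ?\<omega>' = n" by (simp add: card_image om)
  moreover have "\<omega> \<inter> ?\<omega>' = {}" using om(4) by auto
  ultimately have "card (\<omega> \<union> ?\<omega>') = 2 * n" using om by (simp add: card_Un_disjoint)
  moreover have "\<omega> \<union> ?\<omega>' \<subseteq> alg_points \<iota> sL UNIV 1"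
    using om(1) \<sigma>(1) by (auto simp: alg_points_def alg_hom_on_def lin_on_def)
  ultimately have "\<omega> \<union> ?\<omega>' = alg_points \<iota> sL UNIV 1"
    using card fin by (metis card_subset_eq)
  then consider "\<xi> \<in> \<omega>" | \<zeta> where "\<zeta> \<in> \<omega>" "\<xi> = \<zeta> \<circ> \<sigma>L" using \<xi> by blast
  then have "\<xi> \<in> \<omega> \<or> \<xi> \<circ> \<sigma>L \<in> \<omega>" using \<sigma>\<sigma> by cases simp_all
  then show ?thesis using om(4) by blast
qed

section \<open>Algebras generated by hyperbolic pairs\<close>

text \<open>A subset of the first \<open>n - 1\<close> indices acquires the required parity in
  exactly one way, by adding the last index or not.\<close>

lemma card_subsets_parity:
  assumes "n \<ge> 1"
  shows "card {J. J \<subseteq> {..<n} \<and> even (n + card J)} = 2 ^ (n - 1)"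
proof -
  obtain m where n: "n = Suc m" using assms by (cases n) auto
  let ?f = "\<lambda>K. if even (n + card K) then K else insert m K"
  have fin: "finite K" if "K \<subseteq> {..<k}" for K and k :: nat using that finite_subset by blast
  have "bij_betw ?f (Pow {..<m}) {J. J \<subseteq> {..<n} \<and> even (n + card J)}"
  proof (rule bij_betw_byWitness[where f' = "\<lambda>J. J - {m}"])
    show "\<forall>K\<in>Pow {..<m}. ?f K - {m} = K" by auto
    show "\<forall>J\<in>{J. J \<subseteq> {..<n} \<and> even (n + card J)}. ?f (J - {m}) = J"
      using fin by (auto simp: insert_absorb card_Diff_singleton_if card_gt_0_iff)
    show "?f ` Pow {..<m} \<subseteq> {J. J \<subseteq> {..<n} \<and> even (n + card J)}"
    proof (intro image_subsetI)
      fix K assume K: "K \<in> Pow {..<m}"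
      then have "m \<notin> K" "finite K" using fin by auto
      then show "?f K \<in> {J. J \<subseteq> {..<n} \<and> even (n + card J)}" using K n by auto
    qed
    show "(\<lambda>J. J - {m}) ` {J. J \<subseteq> {..<n} \<and> even (n + card J)} \<subseteq> Pow {..<m}"
      using n less_Suc_eq by auto
  qed
  then have "card {J. J \<subseteq> {..<n} \<and> even (n + card J)} = card (Pow {..<m})"
    by (simp add: bij_betw_same_card)
  then show ?thesis by (simp add: card_Pow n)
qed

lemma anticommute_prod:
  fixes a b c :: "'c::ring_1"
  assumes "a * b = - (b * a)" "a * c = - (c * a)"
  shows "a * (b * c) = b * c * a"
proof -
  have "a * (b * c) = - (b * (a * c))" by (simp add: assms(1) flip: mult.assoc)
  also have "\<dots> = b * c * a" by (simp add: assms(2) mult.assoc)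
  finally show ?thesis .
qed

text \<open>The relations between the images in \<open>C(V, q)\<close> of a hyperbolic basis. All
  that follows in this locale, including the non-vanishing statements, is derived from them and from
  1 \<noteq> 0.\<close>

locale hyperbolic_pairs =
  fixes n :: nat and u w :: "nat \<Rightarrow> 'c::ring_1"
  assumes uu: "i < n \<Longrightarrow> u i * u i = 0" and ww: "i < n \<Longrightarrow> w i * w i = 0"
    and uw: "i < n \<Longrightarrow> u i * w i + w i * u i = 1"
    and anti_uu: "i < n \<Longrightarrow> j < n \<Longrightarrow> i \<noteq> j \<Longrightarrow> u i * u j = - (u j * u i)"
    and anti_ww: "i < n \<Longrightarrow> j < n \<Longrightarrow> i \<noteq> j \<Longrightarrow> w i * w j = - (w j * w i)"
    and anti_uw: "i < n \<Longrightarrow> j < n \<Longrightarrow> i \<noteq> j \<Longrightarrow> u i * w j = - (w j * u i)"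
begin

lemma anti_wu: "i < n \<Longrightarrow> j < n \<Longrightarrow> i \<noteq> j \<Longrightarrow> w i * u j = - (u j * w i)"
  using anti_uw[of j i] by simp

lemma uwu: "i < n \<Longrightarrow> u i * (w i * u i) = u i" and wuw: "i < n \<Longrightarrow> w i * (u i * w i) = w i"
proof -
  assume i: "i < n"
  have "u i * (w i * u i) = u i * (1 - u i * w i)" using uw[OF i] by (metis add_diff_cancel_left')
  then show "u i * (w i * u i) = u i" by (simp add: right_diff_distrib uu[OF i] flip: mult.assoc)
  have "w i * (u i * w i) = w i * (1 - w i * u i)" using uw[OF i] by (metis add_diff_cancel_right')
  then show "w i * (u i * w i) = w i" by (simp add: right_diff_distrib ww[OF i] flip: mult.assoc)
qed

text \<open>Up to sign, \<open>weight J n\<close> is the product of all \<open>u k\<close> and the \<open>w k\<close> with \<open>k \<in> J\<close>. In this form it is an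
  eigenvector for right multiplication by each \<open>u i * w i\<close>, with eigenvalue 1 if \<open>i \<in> J\<close> and 0
  otherwise.\<close>

definition factor :: "nat set \<Rightarrow> nat \<Rightarrow> 'c" where
  "factor J k = (if k \<in> J then u k * w k else u k)"

primrec weight :: "nat set \<Rightarrow> nat \<Rightarrow> 'c" where
  "weight J 0 = 1" |
  "weight J (Suc m) = weight J m * factor J m"

text \<open>The sign is 1 for a factor of degree two and -1 for a single \<open>u m\<close>. It is
  the same for \<open>u j\<close> and \<open>w j\<close>, so that it cancels when the product
  \<open>u j * w j\<close> is moved across.\<close>

lemma factor_swap:
  assumes "j < n" "m < n" "j \<noteq> m"
  shows "\<exists>s\<in>{1, -1}. u j * factor J m = s * (factor J m * u j) \<and> w j * factor J m = s * (factor J m * w j)"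
proof (cases "m \<in> J")
  case True
  have "u j * (u m * w m) = u m * w m * u j" "w j * (u m * w m) = u m * w m * w j"
    using assms
    by (auto intro!: anticommute_prod anti_uu[of j m] anti_uw[of j m] anti_ww[of j m] anti_wu[of j m])
  then show ?thesis using True by (simp add: factor_def)
next
  case False
  then show ?thesis using assms anti_uu[of j m] anti_wu[of j m] by (simp add: factor_def)
qed

lemma weight_swap:
  assumes "m \<le> j" "j < n"
  shows "\<exists>s\<in>{1, -1}. u j * weight J m = s * (weight J m * u j) \<and> w j * weight J m = s * (weight J m * w j)"
  using assms(1)
proof (induction m)
  case 0
  then show ?case by simp
next
  case (Suc m)
  then obtain s where s: "s \<in> {1, -1}" "u j * weight J m = s * (weight J m * u j)"
      "w j * weight J m = s * (weight J m * w j)"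
    by (metis Suc_leD)
  have "m < n" "j \<noteq> m" using Suc.prems assms(2) by auto
  then obtain t where t: "t \<in> {1, -1}" "u j * factor J m = t * (factor J m * u j)" "w j * factor J m = t * (factor J m * w j)"
    using factor_swap[OF assms(2), of m J] by blast
  have *: "x * (weight J m * factor J m) = (s * t) * (weight J m * factor J m * x)"
    if "x * weight J m = s * (weight J m * x)" "x * factor J m = t * (factor J m * x)" for x
  proof -
    have "x * (weight J m * factor J m) = s * (weight J m * (x * factor J m))"
      using that(1) by (simp flip: mult.assoc)
    also have "\<dots> = s * (weight J m * (t * (factor J m * x)))" by (simp add: that(2))
    also have "\<dots> = (s * t) * (weight J m * factor J m * x)" using t(1) by (auto simp: mult.assoc)
    finally show ?thesis .
  qed
  have "s * t \<in> {1, -1}" using s(1) t(1) by auto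
  then show ?case using *[OF s(2) t(2)] *[OF s(3) t(3)] by (intro bexI[of _ "s * t"]) simp_all
qed

text \<open>Let \<open>g = weight J m\<close> and suppose \<open>g * u m * w m = 0\<close>. Left
  multiplication by \<open>w m\<close>, which passes \<open>g\<close> up to sign, gives
  \<open>g * w m * u m * w m = g * w m = 0\<close>. Then \<open>g * u m * w m\<close> and
  \<open>g * w m * u m\<close> both vanish, and their sum is \<open>g\<close>.\<close>

lemma weight_nonzero: "m \<le> n \<Longrightarrow> weight J m \<noteq> 0"
proof (induction m)
  case (Suc m)
  let ?g = "weight J m"
  have m: "m < n" using Suc.prems by simp
  show ?case
  proof
    assume "weight J (Suc m) = 0"
    then have "?g * factor J m = 0" by simp
    then have guw: "?g * (u m * w m) = 0"
      by (auto simp: factor_def split: if_splits) (metis mult.assoc mult_zero_left)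
    obtain s where s: "s \<in> {1, -1}" "w m * ?g = s * (?g * w m)" using weight_swap[OF order_refl m, of J] by blast
    have "s * (?g * (w m * (u m * w m))) = w m * (?g * (u m * w m))"
      using s(2) by (simp flip: mult.assoc)
    then have "?g * w m = 0" using guw s(1) by (auto simp: wuw[OF m])
    then have "?g * (w m * u m) = 0" by (metis mult.assoc mult_zero_left)
    then have "?g * (u m * w m + w m * u m) = 0" by (simp add: guw distrib_left)
    then show False using Suc by (simp add: uw[OF m])
  qed
qed simp

lemma u_mult_weight: "i < m \<Longrightarrow> m \<le> n \<Longrightarrow> u i * weight J m = 0"
proof (induction m)
  case (Suc m)
  show ?case
  proof (cases "i = m")
    case True
    then obtain s where s: "u m * weight J m = s * (weight J m * u m)"
      using weight_swap[of m m J] Suc.prems by (meson Suc_le_lessD order_refl)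
    have "u m * factor J m = 0" using Suc.prems True by (simp add: factor_def uu flip: mult.assoc)
    have "u m * weight J (Suc m) = s * (weight J m * (u m * factor J m))"
      using s by (simp flip: mult.assoc)
    then show ?thesis using True \<open>u m * factor J m = 0\<close> by simp
  next
    case False
    then show ?thesis using Suc by (simp flip: mult.assoc)
  qed
qed simp

lemma weight_mult_uw: "i < m \<Longrightarrow> m \<le> n \<Longrightarrow> weight J m * (u i * w i) = (if i \<in> J then weight J m else 0)"
proof (induction m)
  case (Suc m)
  show ?case
  proof (cases "i = m")
    case True
    have "factor J m * (u m * w m) = (if m \<in> J then factor J m else 0)"
      using Suc.prems wuw[of m] True by (auto simp: factor_def uu mult.assoc) (simp add: uu flip: mult.assoc)
    then show ?thesis using True by (simp add: mult.assoc)
  next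
    case False
    then have i: "i < n" "m < n" "i < m" "m \<le> n" using Suc.prems by auto
    obtain s where s: "s \<in> {1, -1}" "u i * factor J m = s * (factor J m * u i)" "w i * factor J m = s * (factor J m * w i)"
      using factor_swap[OF i(1,2) False, of J] by blast
    have "u i * w i * factor J m = u i * (s * (factor J m * w i))" by (simp add: s(3) mult.assoc)
    also have "\<dots> = s * (u i * factor J m * w i)" using s(1) by (auto simp: mult.assoc)
    also have "\<dots> = factor J m * (u i * w i)" using s by (auto simp: mult.assoc)
    finally have "weight J (Suc m) * (u i * w i) = weight J m * (u i * w i) * factor J m"
      by (simp add: mult.assoc)
    then show ?thesis using Suc.IH[OF i(3,4)] by simp
  qed
qed simp

text \<open>Different weights have different systems of eigenvalues. The element \<open>e n\<close>,
  a product of factors \<open>u i * w i\<close> for \<open>i \<in> K\<close> and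
  \<open>1 - u i * w i\<close> for the other \<open>i\<close>, fixes \<open>weight K n\<close> from
  the right and kills every other weight.\<close>

lemma weight_independent:
  assumes "vector_space sC" "k_algebra sC"
    and "(\<Sum>J\<in>Pow {..<n}. sC (a J) (weight J n)) = 0" "K \<subseteq> {..<n}"
  shows "a K = 0"
proof -
  interpret k_algebra sC by fact
  define e where "e m = prod_list (map (\<lambda>i. if i \<in> K then u i * w i else 1 - u i * w i) [0..<m])" for m
  have e: "weight J n * e m = (if J \<inter> {..<m} = K \<inter> {..<m} then weight J n else 0)" if "m \<le> n" for J m
    using that
  proof (induction m)
    case (Suc m)
    have "e (Suc m) = e m * (if m \<in> K then u m * w m else 1 - u m * w m)" by (simp add: e_def)
    moreover have "(J \<inter> {..<Suc m} = K \<inter> {..<Suc m}) \<longleftrightarrow> J \<inter> {..<m} = K \<inter> {..<m} \<and> (m \<in> J \<longleftrightarrow> m \<in> K)"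
      by (auto simp: lessThan_Suc)
    ultimately show ?case
      using Suc weight_mult_uw[of m n J] by (simp add: right_diff_distrib flip: mult.assoc)
  qed (simp add: e_def)
  have "0 = (\<Sum>J\<in>Pow {..<n}. sC (a J) (weight J n)) * e n" by (simp add: assms(3))
  also have "\<dots> = (\<Sum>J\<in>Pow {..<n}. sC (a J) (weight J n * e n))"
    by (simp add: sum_distrib_right scale_mult_left)
  also have "\<dots> = (\<Sum>J\<in>Pow {..<n}. if J = K then sC (a J) (weight J n) else 0)"
  proof (rule sum.cong)
    fix J assume "J \<in> Pow {..<n}"
    then have "J \<inter> {..<n} = J" "K \<inter> {..<n} = K" using assms(4) by auto
    then show "sC (a J) (weight J n * e n) = (if J = K then sC (a J) (weight J n) else 0)" by (simp add: e)
  qed simp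
  also have "\<dots> = sC (a K) (weight K n)" using assms(4) by simp
  finally show ?thesis using weight_nonzero[of n K] by simp
qed

lemma weight_cong: "J \<inter> {..<m} = K \<inter> {..<m} \<Longrightarrow> weight J m = weight K m"
proof (induction m)
  case (Suc m)
  then have "J \<inter> {..<m} = K \<inter> {..<m}" "m \<in> J \<longleftrightarrow> m \<in> K" by (auto simp: lessThan_Suc)
  then show ?case using Suc.IH by (simp add: factor_def)
qed simp

text \<open>Up to sign, right multiplication by \<open>u i\<close> removes the factor
  \<open>w i\<close> and right multiplication by \<open>w i\<close> inserts it, as for fermionic
  annihilation and creation operators. Hence the weights span a space stable under right
  multiplication by frame vectors.\<close>

lemma weight_mult_u:
  "i < m \<Longrightarrow> m \<le> n \<Longrightarrow> \<exists>s\<in>{1, -1}. weight J m * u i = (if i \<in> J then s * weight (J - {i}) m else 0)"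
proof (induction m)
  case (Suc m)
  show ?case
  proof (cases "i = m")
    case True
    have "factor J m * u m = (if m \<in> J then u m else 0)"
      using Suc.prems uwu[of m] True by (auto simp: factor_def uu mult.assoc)
    moreover have "weight (J - {m}) m = weight J m" by (rule weight_cong) auto
    ultimately show ?thesis using True by (intro bexI[of _ 1]) (simp_all add: mult.assoc factor_def)
  next
    case False
    then have i: "i < n" "m < n" "i < m" "m \<le> n" using Suc.prems by auto
    obtain s where s: "s \<in> {1, -1}" "u i * factor J m = s * (factor J m * u i)"
      using factor_swap[OF i(1,2) False, of J] by blast
    obtain t where t: "t \<in> {1, -1}" "weight J m * u i = (if i \<in> J then t * weight (J - {i}) m else 0)"
      using Suc.IH[OF i(3,4)] by blast
    have "factor J m * u i = s * (u i * factor J m)" using s by auto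
    then have "weight J (Suc m) * u i = weight J m * (s * (u i * factor J m))" by (simp add: mult.assoc)
    also have "\<dots> = s * (weight J m * u i) * factor J m" using s(1) by (auto simp: mult.assoc)
    also have "\<dots> = (if i \<in> J then (s * t) * weight (J - {i}) (Suc m) else 0)"
      using False by (simp add: t(2) mult.assoc factor_def)
    finally show ?thesis using s(1) t(1) by (intro bexI[of _ "s * t"]) auto
  qed
qed simp

lemma weight_mult_w:
  "i < m \<Longrightarrow> m \<le> n \<Longrightarrow> \<exists>s\<in>{1, -1}. weight J m * w i = (if i \<in> J then 0 else s * weight (insert i J) m)"
proof (induction m)
  case (Suc m)
  show ?case
  proof (cases "i = m")
    case True
    have "factor J m * w m = (if m \<in> J then 0 else u m * w m)"
      using Suc.prems True by (auto simp: factor_def ww mult.assoc)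
    moreover have "weight (insert m J) m = weight J m" by (rule weight_cong) auto
    ultimately show ?thesis using True by (intro bexI[of _ 1]) (simp_all add: mult.assoc factor_def)
  next
    case False
    then have i: "i < n" "m < n" "i < m" "m \<le> n" using Suc.prems by auto
    obtain s where s: "s \<in> {1, -1}" "w i * factor J m = s * (factor J m * w i)"
      using factor_swap[OF i(1,2) False, of J] by blast
    obtain t where t: "t \<in> {1, -1}" "weight J m * w i = (if i \<in> J then 0 else t * weight (insert i J) m)"
      using Suc.IH[OF i(3,4)] by blast
    have "factor J m * w i = s * (w i * factor J m)" using s by auto
    then have "weight J (Suc m) * w i = weight J m * (s * (w i * factor J m))" by (simp add: mult.assoc)
    also have "\<dots> = s * (weight J m * w i) * factor J m" using s(1) by (auto simp: mult.assoc)
    also have "\<dots> = (if i \<in> J then 0 else (s * t) * weight (insert i J) (Suc m))"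
      using False by (simp add: t(2) mult.assoc factor_def)
    finally show ?thesis using s(1) t(1) by (intro bexI[of _ "s * t"]) auto
  qed
qed simp

text \<open>\<open>weight J n\<close> is a product of \<open>n + card J\<close> vectors, so
  \<open>b\<close> selects the parity of the degree; \<open>weights True\<close> lies in the even
  part.\<close>

definition weights :: "bool \<Rightarrow> 'c set" where
  "weights b = {weight J n | J. J \<subseteq> {..<n} \<and> even (n + card J) = b}"

lemma weight_as_product:
  "m \<le> n \<Longrightarrow> \<exists>xs. weight J m = prod_list xs \<and> set xs \<subseteq> u ` {..<n} \<union> w ` {..<n} \<and>
     length xs = m + card (J \<inter> {..<m})"
proof (induction m)
  case (Suc m)
  then obtain xs where xs: "weight J m = prod_list xs" "set xs \<subseteq> u ` {..<n} \<union> w ` {..<n}"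
      "length xs = m + card (J \<inter> {..<m})" by auto
  show ?case
  proof (cases "m \<in> J")
    case True
    then have "J \<inter> {..<Suc m} = insert m (J \<inter> {..<m})" by (auto simp: lessThan_Suc)
    then show ?thesis using xs True Suc.prems
      by (intro exI[of _ "xs @ [u m, w m]"]) (auto simp: factor_def)
  next
    case False
    then have "J \<inter> {..<Suc m} = J \<inter> {..<m}" by (auto simp: lessThan_Suc)
    then show ?thesis using xs False Suc.prems
      by (intro exI[of _ "xs @ [u m]"]) (auto simp: factor_def)
  qed
qed simp

context
  fixes sC :: "'k::field \<Rightarrow> 'c \<Rightarrow> 'c"
  assumes kC: "k_algebra sC"
begin

interpretation k_algebra sC by (rule kC)

lemma weights_mult_vector:
  assumes x: "x \<in> span (weights b)" and v: "v \<in> span (u ` {..<n} \<union> w ` {..<n})"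
  shows "x * v \<in> span (weights (\<not> b))"
proof -
  have sgn: "s * y \<in> span (weights c)" if "s \<in> {1, -1}" "y \<in> span (weights c)" for s y c
    using that by (auto intro: span_neg)
  have *: "weight J n * v' \<in> span (weights (\<not> b))"
    if J: "J \<subseteq> {..<n}" "even (n + card J) = b" and v': "v' \<in> u ` {..<n} \<union> w ` {..<n}" for J v'
  proof -
    have finJ: "finite J" using J(1) finite_subset by blast
    from v' consider i where "i < n" "v' = u i" | i where "i < n" "v' = w i" by auto
    then show ?thesis
    proof cases
      case 1
      obtain s where s: "s \<in> {1, -1}" "weight J n * u i = (if i \<in> J then s * weight (J - {i}) n else 0)"
        using weight_mult_u[OF 1(1) order_refl] by blast
      show ?thesis
      proof (cases "i \<in> J")
        case True
        then have "card J = Suc (card (J - {i}))" using finJ by (metis card_Suc_Diff1)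
        then have "weight (J - {i}) n \<in> weights (\<not> b)" using J by (auto simp: weights_def)
        then show ?thesis using s True 1 sgn span_base by simp
      qed (use s 1 in \<open>simp add: span_zero\<close>)
    next
      case 2
      obtain s where s: "s \<in> {1, -1}" "weight J n * w i = (if i \<in> J then 0 else s * weight (insert i J) n)"
        using weight_mult_w[OF 2(1) order_refl] by blast
      show ?thesis
      proof (cases "i \<in> J")
        case False
        then have "card (insert i J) = Suc (card J)" using finJ by simp
        then have "weight (insert i J) n \<in> weights (\<not> b)" using J 2 by (auto simp: weights_def)
        then show ?thesis using s False 2 sgn span_base by simp
      qed (use s 2 in \<open>simp add: span_zero\<close>)
    qed
  qed
  have "x * v' \<in> span (weights (\<not> b))" if v': "v' \<in> u ` {..<n} \<union> w ` {..<n}" for v'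
    using x
  proof (induction rule: span_induct_alt)
    case (step c y z)
    then obtain J where "y = weight J n" "J \<subseteq> {..<n}" "even (n + card J) = b" by (auto simp: weights_def)
    then show ?case using *[of J v'] v' step
      by (simp add: distrib_right span_add span_scale flip: scale_mult_left)
  qed (simp add: span_zero)
  note ** = this
  show ?thesis using v
  proof (induction rule: span_induct_alt)
    case (step c y z)
    then show ?case using **[of y]
      by (simp add: distrib_left span_add span_scale flip: scale_mult_right)
  qed (simp add: span_zero)
qed

lemma weights_mult_prod_list:
  assumes "set vs \<subseteq> span (u ` {..<n} \<union> w ` {..<n})" "x \<in> span (weights b)"
  shows "x * prod_list vs \<in> span (weights (b = even (length vs)))"
  using assms
proof (induction vs arbitrary: x b)
  case (Cons v vs)
  have "(x * v) * prod_list vs \<in> span (weights ((\<not> b) = even (length vs)))"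
    using Cons weights_mult_vector by simp
  moreover have "((\<not> b) = even (length vs)) = (b = even (length (v # vs)))" by auto
  ultimately show ?case by (simp add: mult.assoc)
qed simp

text \<open>If all \<open>u k\<close> kill \<open>z\<close>, then \<open>u k * w k * z = z\<close>
  for all \<open>k\<close>, hence \<open>z\<close> equals \<open>weight {..<n} n * z\<close>. The
  annihilator therefore consists of right multiples of the top weight by even elements, and these
  stay in the span of the even weights.\<close>

lemma annihilator_eq_span_weights:
  assumes M: "M \<subseteq> span (u ` {..<n} \<union> w ` {..<n})" "u ` {..<n} \<subseteq> M" "w ` {..<n} \<subseteq> M"
  shows "{z \<in> span {prod_list vs | vs. set vs \<subseteq> M \<and> even (length vs)}. \<forall>k<n. u k * z = 0} = span (weights True)"
    (is "?P = _")
proof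
  show "?P \<subseteq> span (weights True)"
  proof
    fix z assume "z \<in> ?P"
    then have z: "z \<in> span {prod_list vs | vs. set vs \<subseteq> M \<and> even (length vs)}" "\<And>k. k < n \<Longrightarrow> u k * z = 0"
      by auto
    have uwz: "u k * w k * z = z" if "k < n" for k
    proof -
      have "(u k * w k + w k * u k) * z = z" using that by (simp add: uw)
      then show ?thesis using z(2)[OF that] by (simp add: distrib_right mult.assoc)
    qed
    have "m \<le> n \<Longrightarrow> weight {..<n} m * z = z" for m
    proof (induction m)
      case (Suc m)
      then show ?case using uwz[of m] by (simp add: factor_def mult.assoc)
    qed simp
    then have "z = weight {..<n} n * z" by simp
    also have "\<dots> \<in> span (weights True)"
      using z(1)
    proof (induction rule: span_induct_alt)
      case (step c y x)
      then obtain vs where vs: "y = prod_list vs" "set vs \<subseteq> M" "even (length vs)" by auto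
      \<comment> \<open>The top weight has degree \<open>n + n\<close>, which is even for every
        \<open>n\<close>.\<close>
      have "weight {..<n} n \<in> span (weights True)"
        by (rule span_base) (auto simp: weights_def)
      then have "weight {..<n} n * prod_list vs \<in> span (weights (True = even (length vs)))"
        using vs(2) M(1) by (intro weights_mult_prod_list) auto
      then show ?case using vs step
        by (simp add: distrib_left span_add span_scale flip: scale_mult_right)
    qed (simp add: span_zero)
    finally show "z \<in> span (weights True)" .
  qed
  have "weight J n \<in> ?P" if J: "J \<subseteq> {..<n}" "even (n + card J)" for J
  proof -
    obtain xs where xs: "weight J n = prod_list xs" "set xs \<subseteq> u ` {..<n} \<union> w ` {..<n}"
        "length xs = n + card (J \<inter> {..<n})" using weight_as_product[of n J] by auto
    moreover have "J \<inter> {..<n} = J" using J by auto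
    ultimately have "even (length xs)" using J(2) by simp
    moreover have "set xs \<subseteq> M" using xs(2) M(2,3) by blast
    ultimately have "weight J n \<in> {prod_list vs | vs. set vs \<subseteq> M \<and> even (length vs)}" using xs(1) by blast
    then show ?thesis using u_mult_weight span_base by auto
  qed
  then have "weights True \<subseteq> ?P" by (auto simp: weights_def)
  moreover have "subspace ?P"
    by (rule subspaceI) (auto simp: span_zero span_add span_scale distrib_left simp flip: scale_mult_right)
  ultimately show "span (weights True) \<subseteq> ?P" by (rule span_minimal)
qed

lemma weights_basis:
  assumes "n \<ge> 1"
  shows "card (weights True) = 2 ^ (n - 1)" "independent (weights True)" "finite (weights True)"
proof -
  let ?I = "{J. J \<subseteq> {..<n} \<and> even (n + card J)}"
  have *: "inj_on (\<lambda>J. weight J n) (Pow {..<n}) \<and> independent ((\<lambda>J. weight J n) ` Pow {..<n})"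
    using weight_independent[OF k_algebra_vector_space[OF kC] kC]
    by (intro independent_family[OF k_algebra_vector_space[OF kC]]) auto
  have w: "weights True = (\<lambda>J. weight J n) ` ?I" and sub: "?I \<subseteq> Pow {..<n}" by (auto simp: weights_def)
  have "finite ?I" using sub by (rule finite_subset) simp
  then show "finite (weights True)" using w by simp
  show "card (weights True) = 2 ^ (n - 1)"
    using inj_on_subset[OF conjunct1[OF *] sub] card_subsets_parity[OF assms] by (simp add: w card_image)
  show "independent (weights True)"
    using w sub conjunct2[OF *] by (metis image_mono independent_mono)
qed

end

end

section \<open>Tensor powers\<close>

definition multilinear ::
  "('k::field \<Rightarrow> 'm::ab_group_add \<Rightarrow> 'm) \<Rightarrow> nat \<Rightarrow> ('k \<Rightarrow> 'w::ab_group_add \<Rightarrow> 'w) \<Rightarrow> ('m list \<Rightarrow> 'w) \<Rightarrow> bool" where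
  "multilinear s n sW h \<longleftrightarrow> (\<forall>zs k x y c. length zs = n \<and> k < n \<longrightarrow>
     h (zs[k := x + y]) = h (zs[k := x]) + h (zs[k := y]) \<and> h (zs[k := s c x]) = sW c (h (zs[k := x])))"

lemma multilinearD:
  assumes "multilinear s n sW h" "length zs = n" "k < n"
  shows "h (zs[k := x + y]) = h (zs[k := x]) + h (zs[k := y])" "h (zs[k := s c x]) = sW c (h (zs[k := x]))"
  using assms by (auto simp: multilinear_def)

lemma tensor_power_lift:
  assumes tp: "tensor_power s n sT t" and vW: "vector_space sW" and h: "multilinear s n sW h"
  shows "\<exists>G. Vector_Spaces.linear sT sW G \<and> (\<forall>xs. length xs = n \<longrightarrow> G (t xs) = h xs)"
proof -
  have ps: "presents_space sT {xs. length xs = n} t (multilinear_rels s n)"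
    using tp by (simp add: tensor_power_def)
  note hl = linear_lin_ext[OF vW, of h]
  interpret W: vector_space sW by fact
  have "lin_ext sW h r = 0" if r: "r \<in> multilinear_rels s n" for r
  proof -
    have up: "us @ [x] @ vs = (us @ [y] @ vs)[length us := x]" for us vs :: "'b list" and x y by simp
    from r consider us vs x y where "length us + 1 + length vs = n"
        "r = gen (us @ [x + y] @ vs) - gen (us @ [x] @ vs) - gen (us @ [y] @ vs)"
      | us vs c x where "length us + 1 + length vs = n"
        "r = gen (us @ [s c x] @ vs) - Poly_Mapping.single (us @ [x] @ vs) c"
      unfolding multilinear_rels_def by blast
    then show ?thesis
    proof cases
      case 1
      have "h (us @ [x + y] @ vs) = h (us @ [x] @ vs) + h (us @ [y] @ vs)"
        using multilinearD(1)[OF h, of "us @ [x] @ vs" "length us" x y] 1(1) by simp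
      then show ?thesis using 1(2) by (simp add: linear_diffD[OF hl] lin_ext_single[OF vW])
    next
      case 2
      have "h (us @ [s c x] @ vs) = sW c (h (us @ [x] @ vs))"
        using multilinearD(2)[OF h, of "us @ [x] @ vs" "length us" c x] 2(1) by simp
      then show ?thesis using 2(2) by (simp add: linear_diffD[OF hl] lin_ext_single[OF vW])
    qed
  qed
  then show ?thesis using presents_space_lift[OF ps vW, of h] by auto
qed

lemma tensor_power_span: "tensor_power s n sT t \<Longrightarrow> module.span sT (t ` {xs. length xs = n}) = UNIV"
  using presents_space_span[of sT "{xs. length xs = n}" t "multilinear_rels s n"]
  by (simp add: tensor_power_def)

lemma tensor_power_vector_space: "tensor_power s n sT t \<Longrightarrow> vector_space sT"
  by (simp add: tensor_power_def k_algebra_vector_space)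

lemma tensor_power_multilinear:
  assumes tp: "tensor_power s n sT t"
  shows "multilinear s n sT t"
proof -
  have vT: "vector_space sT" and R: "{p. Poly_Mapping.keys p \<subseteq> {xs. length xs = n} \<and> lin_ext sT t p = 0}
      = module.span pm_scale (multilinear_rels s n)"
    using tp by (auto simp: tensor_power_def presents_space_def)
  interpret T: vector_space sT by fact
  interpret P: vector_space pm_scale by (rule vector_space_pm_scale)
  note hl = linear_lin_ext[OF vT, of t]
  have zero: "lin_ext sT t r = 0" if "r \<in> multilinear_rels s n" for r
    using that R P.span_base by blast
  show ?thesis unfolding multilinear_def
  proof (intro allI impI conjI; elim conjE)
    fix zs :: "'b list" and k x y c assume zs: "length zs = n" "k < n"
    then have up: "zs[k := z] = take k zs @ [z] @ drop (Suc k) zs" for z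
      by (simp add: upd_conv_take_nth_drop)
    have len: "length (take k zs) + 1 + length (drop (Suc k) zs) = n" using zs by simp
    have "gen (zs[k := x + y]) - gen (zs[k := x]) - gen (zs[k := y]) \<in> multilinear_rels s n"
      unfolding multilinear_rels_def up using len by blast
    from zero[OF this] show "t (zs[k := x + y]) = t (zs[k := x]) + t (zs[k := y])"
      by (simp add: linear_diffD[OF hl] linear_addD[OF hl] lin_ext_single[OF vT] algebra_simps)
    have "gen (zs[k := s c x]) - Poly_Mapping.single (zs[k := x]) c \<in> multilinear_rels s n"
      unfolding multilinear_rels_def up using len by blast
    from zero[OF this] show "t (zs[k := s c x]) = sT c (t (zs[k := x]))"
      by (simp add: linear_diffD[OF hl] lin_ext_single[OF vT])
  qed
qed

lemma tensor_power_ext: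
  assumes "tensor_power s n sT t" "Vector_Spaces.linear sT sW f" "Vector_Spaces.linear sT sW g"
    "\<And>xs. length xs = n \<Longrightarrow> f (t xs) = g (t xs)"
  shows "f u = g u"
  by (rule linear_eq_spanD[OF assms(2,3), of "t ` {xs. length xs = n}"])
    (use assms(4) tensor_power_span[OF assms(1)] in auto)

lemma tensor_power_mult_ext:
  assumes tp: "tensor_power s n sT t" and kW: "k_algebra sW" and f: "Vector_Spaces.linear sT sW f"
    and g: "\<And>xs ys. length xs = n \<Longrightarrow> length ys = n \<Longrightarrow> f (t (map2 (*) xs ys)) = f (t xs) * f (t ys)"
  shows "f (u * v) = f u * f v"
proof -
  have kT: "k_algebra sT" and t: "\<And>xs ys. length xs = n \<Longrightarrow> length ys = n \<Longrightarrow> t xs * t ys = t (map2 (*) xs ys)"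
    using tp by (auto simp: tensor_power_def)
  have 1: "f (t xs * v) = f (t xs) * f v" if "length xs = n" for xs v
    by (rule tensor_power_ext[OF tp linear_compose'[OF linear_mult_right[OF kT] f]
        linear_compose'[OF f linear_mult_right[OF kW]]]) (simp add: that t g)
  show ?thesis
    by (rule tensor_power_ext[OF tp linear_compose'[OF linear_mult_left[OF kT] f]
        linear_compose'[OF f linear_mult_left[OF kW]]]) (rule 1)
qed

lemma k_algebra_restrict: "k_algebra sW \<Longrightarrow> field_hom \<iota> \<Longrightarrow> k_algebra (\<lambda>c. sW (\<iota> c))"
  by (auto simp: k_algebra_def k_algebra_axioms_def vector_space_restrict)

lemma permutes_less: "p permutes {..<n} \<Longrightarrow> i < n \<Longrightarrow> p i < n" for n :: nat
  using permutes_in_image[of p "{..<n}" i] by simp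

text \<open>\<open>permute_list p xs ! i\<close> is \<open>xs ! p i\<close>, so what stands at place
  \<open>k\<close> is moved to place \<open>inv p k\<close>.\<close>

lemma permute_list_update:
  assumes "p permutes {..<length zs}" "k < length zs"
  shows "permute_list p (zs[k := x]) = (permute_list p zs)[inv p k := x]"
proof (rule nth_equalityI)
  fix i assume "i < length (permute_list p (zs[k := x]))"
  then have i: "i < length zs" by simp
  moreover have "p i < length zs" using assms(1) i by (meson lessThan_iff permutes_in_image)
  moreover have "p i = k \<longleftrightarrow> i = inv p k" using permutes_inverses[OF assms(1)] by metis
  ultimately show "permute_list p (zs[k := x]) ! i = (permute_list p zs)[inv p k := x] ! i"
    using assms by (auto simp: permute_list_nth nth_list_update)
qed simp

lemma multilinear_permute:
  assumes "multilinear s n sW h" "p permutes {..<n}"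
  shows "multilinear s n sW (\<lambda>xs. h (permute_list p xs))"
  unfolding multilinear_def
proof (intro allI impI, elim conjE)
  fix zs :: "'b list" and k x y c assume zs: "length zs = n" "k < n"
  have "inv p k < n" using permutes_in_image[OF permutes_inv[OF assms(2)], of k] zs by simp
  then show "h (permute_list p (zs[k := x + y])) = h (permute_list p (zs[k := x])) + h (permute_list p (zs[k := y])) \<and>
      h (permute_list p (zs[k := s c x])) = sW c (h (permute_list p (zs[k := x])))"
    using zs assms(2) by (simp add: permute_list_update multilinearD[OF assms(1)])
qed

lemma
  assumes tp: "tensor_power s n sT t" and p: "p permutes {..<n}"
  shows permute_factors_linear: "Vector_Spaces.linear sT sT (permute_factors n sT t p)"
    and permute_factors_tensor: "length xs = n \<Longrightarrow> permute_factors n sT t p (t xs) = t (permute_list p xs)"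
proof -
  obtain G where G: "Vector_Spaces.linear sT sT G" "\<And>xs. length xs = n \<Longrightarrow> G (t xs) = t (permute_list p xs)"
    using tensor_power_lift[OF tp tensor_power_vector_space[OF tp] multilinear_permute[OF tensor_power_multilinear[OF tp] p]]
    by auto
  have "permute_factors n sT t p u = G u" for u
    unfolding permute_factors_def
    by (rule induced_eq[OF G(1)]) (use G(2) tensor_power_span[OF tp] in auto)
  then have "permute_factors n sT t p = G" by (rule ext)
  then show "Vector_Spaces.linear sT sT (permute_factors n sT t p)"
    and "length xs = n \<Longrightarrow> permute_factors n sT t p (t xs) = t (permute_list p xs)"
    using G by auto
qed

lemma permute_factors_mult:
  assumes tp: "tensor_power s n sT t" and p: "p permutes {..<n}"
  shows "permute_factors n sT t p (u * v) = permute_factors n sT t p u * permute_factors n sT t p v"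
proof (rule tensor_power_mult_ext[OF tp _ permute_factors_linear[OF tp p]])
  show "k_algebra sT" using tp by (simp add: tensor_power_def)
  fix xs ys :: "'b list" assume l: "length xs = n" "length ys = n"
  have "permute_list p (map2 (*) xs ys) = map2 (*) (permute_list p xs) (permute_list p ys)"
    using p l by (intro nth_equalityI) (simp_all add: permute_list_nth permutes_less[OF p])
  then show "permute_factors n sT t p (t (map2 (*) xs ys)) = permute_factors n sT t p (t xs) * permute_factors n sT t p (t ys)"
    using l tp by (simp add: permute_factors_tensor[OF tp p] tensor_power_def)
qed

lemma permute_factors_1:
  fixes t :: "'l::comm_ring_1 list \<Rightarrow> 't::comm_ring_1"
  assumes tp: "tensor_power s n sT t" and p: "p permutes {..<n}"
  shows "permute_factors n sT t p 1 = 1"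
proof -
  have "permute_list p (replicate n (1 :: 'l)) = replicate n 1"
    using p by (intro nth_equalityI) (simp_all add: permute_list_nth permutes_less[OF p])
  then show ?thesis using permute_factors_tensor[OF tp p, of "replicate n 1"] tp by (simp add: tensor_power_def)
qed

section \<open>Points of a tensor power\<close>

lemma multilinear_prod:
  assumes "\<And>\<xi>. \<xi> \<in> set \<xi>s \<Longrightarrow> Vector_Spaces.linear s (base_scale \<iota>) \<xi>" "length \<xi>s = n"
  shows "multilinear s n (base_scale \<iota>) (\<lambda>xs. \<Prod>i<n. (\<xi>s ! i) (xs ! i))"
  unfolding multilinear_def
proof (intro allI impI, elim conjE)
  fix zs :: "'a list" and k x y c assume zs: "length zs = n" "k < n"
  have lin: "Vector_Spaces.linear s (base_scale \<iota>) (\<xi>s ! k)" using assms zs by simp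
  have *: "(\<Prod>i<n. (\<xi>s ! i) (zs[k := z] ! i)) = (\<xi>s ! k) z * (\<Prod>i\<in>{..<n} - {k}. (\<xi>s ! i) (zs ! i))" for z
    using zs by (subst prod.remove[of _ k]) (auto intro!: prod.cong arg_cong2[of _ _ _ _ "(*)"])
  show "(\<Prod>i<n. (\<xi>s ! i) (zs[k := x + y] ! i)) = (\<Prod>i<n. (\<xi>s ! i) (zs[k := x] ! i)) + (\<Prod>i<n. (\<xi>s ! i) (zs[k := y] ! i)) \<and>
      (\<Prod>i<n. (\<xi>s ! i) (zs[k := s c x] ! i)) = \<iota> c * (\<Prod>i<n. (\<xi>s ! i) (zs[k := x] ! i))"
    unfolding * by (simp add: linear_addD[OF lin] linear_scaleD[OF lin] algebra_simps)
qed

text \<open>The last part compares points of a subspace \<open>M\<close> with points of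
  \<open>L\<close> extending them. It is applied with \<open>M\<close> the fixed algebra of the
  involution: the idempotent \<open>e\<close> is specified by its values at tuples of points of that
  algebra, but is evaluated at tuples of points of \<open>L\<close>.\<close>

lemma
  assumes tp: "tensor_power s n sT t" and hom: "field_hom \<iota>"
    and \<xi>s: "\<And>\<xi>. \<xi> \<in> set \<xi>s \<Longrightarrow> Vector_Spaces.linear s (base_scale \<iota>) \<xi>" "length \<xi>s = n"
  shows tensor_point_linear: "Vector_Spaces.linear sT (base_scale \<iota>) (tensor_point \<iota> UNIV sT t \<xi>s)"
    and tensor_point_tensor: "length xs = n \<Longrightarrow> tensor_point \<iota> UNIV sT t \<xi>s (t xs) = (\<Prod>i<n. (\<xi>s ! i) (xs ! i))"
    and tensor_point_subspace: "length \<zeta>s = n \<Longrightarrow> (\<And>i x. i < n \<Longrightarrow> x \<in> M \<Longrightarrow> (\<zeta>s ! i) x = (\<xi>s ! i) x) \<Longrightarrow>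
      u \<in> module.span sT (t ` {xs. length xs = n \<and> set xs \<subseteq> M}) \<Longrightarrow>
      tensor_point \<iota> M sT t \<zeta>s u = tensor_point \<iota> UNIV sT t \<xi>s u"
proof -
  obtain G where G: "Vector_Spaces.linear sT (base_scale \<iota>) G" "\<And>xs. length xs = n \<Longrightarrow> G (t xs) = (\<Prod>i<n. (\<xi>s ! i) (xs ! i))"
    using tensor_power_lift[OF tp vector_space_restrict[OF vector_space_mult hom] multilinear_prod[OF \<xi>s]] by auto
  have "tensor_point \<iota> UNIV sT t \<xi>s u = G u" for u
    unfolding tensor_point_def
    by (rule induced_eq[OF G(1)]) (use G(2) tensor_power_span[OF tp] \<xi>s(2) in auto)
  then have eq: "tensor_point \<iota> UNIV sT t \<xi>s = G" by (rule ext)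
  show "Vector_Spaces.linear sT (base_scale \<iota>) (tensor_point \<iota> UNIV sT t \<xi>s)"
    and "length xs = n \<Longrightarrow> tensor_point \<iota> UNIV sT t \<xi>s (t xs) = (\<Prod>i<n. (\<xi>s ! i) (xs ! i))"
    using eq G by auto
  assume \<zeta>s: "length \<zeta>s = n" "\<And>i x. i < n \<Longrightarrow> x \<in> M \<Longrightarrow> (\<zeta>s ! i) x = (\<xi>s ! i) x"
    and u: "u \<in> module.span sT (t ` {xs. length xs = n \<and> set xs \<subseteq> M})"
  show "tensor_point \<iota> M sT t \<zeta>s u = tensor_point \<iota> UNIV sT t \<xi>s u"
    unfolding eq unfolding tensor_point_def
  proof (rule induced_eq[OF G(1)])
    fix xs assume xs: "xs \<in> {xs. length xs = length \<zeta>s \<and> set xs \<subseteq> M}"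
    then have "(\<zeta>s ! i) (xs ! i) = (\<xi>s ! i) (xs ! i)" if "i < n" for i
      using \<zeta>s that by (intro \<zeta>s(2)) auto
    with xs show "G (t xs) = (\<Prod>i<length \<zeta>s. (\<zeta>s ! i) (xs ! i))"
      using \<zeta>s by (auto simp: G(2) intro!: prod.cong)
  qed (use u \<zeta>s(1) in simp)
qed

lemma tensor_point_permute:
  assumes tp: "tensor_power s n sT t" and hom: "field_hom \<iota>"
    and \<xi>s: "\<And>\<xi>. \<xi> \<in> set \<xi>s \<Longrightarrow> Vector_Spaces.linear s (base_scale \<iota>) \<xi>" "length \<xi>s = n"
    and p: "p permutes {..<n}"
  shows "tensor_point \<iota> UNIV sT t (permute_list p \<xi>s) (permute_factors n sT t p u) = tensor_point \<iota> UNIV sT t \<xi>s u"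
proof (rule tensor_power_ext[OF tp])
  have \<xi>s': "\<And>\<xi>. \<xi> \<in> set (permute_list p \<xi>s) \<Longrightarrow> Vector_Spaces.linear s (base_scale \<iota>) \<xi>" "length (permute_list p \<xi>s) = n"
    using \<xi>s p by auto
  show "Vector_Spaces.linear sT (base_scale \<iota>) (\<lambda>u. tensor_point \<iota> UNIV sT t (permute_list p \<xi>s) (permute_factors n sT t p u))"
    by (rule linear_compose'[OF permute_factors_linear[OF tp p] tensor_point_linear[OF tp hom \<xi>s']])
  show "Vector_Spaces.linear sT (base_scale \<iota>) (tensor_point \<iota> UNIV sT t \<xi>s)"
    by (rule tensor_point_linear[OF tp hom \<xi>s])
  fix xs :: "'b list" assume xs: "length xs = n"
  have "(\<Prod>i<n. (permute_list p \<xi>s ! i) (permute_list p xs ! i)) = (\<Prod>i<n. (\<xi>s ! p i) (xs ! p i))"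
    using p \<xi>s(2) xs by (intro prod.cong) (auto simp: permute_list_nth)
  also have "\<dots> = (\<Prod>i<n. (\<xi>s ! i) (xs ! i))"
    using prod.permute[OF p, of "\<lambda>i. (\<xi>s ! i) (xs ! i)"] by (simp add: comp_def)
  finally show "tensor_point \<iota> UNIV sT t (permute_list p \<xi>s) (permute_factors n sT t p (t xs)) = tensor_point \<iota> UNIV sT t \<xi>s (t xs)"
    using xs by (simp add: permute_factors_tensor[OF tp p] tensor_point_tensor[OF tp hom \<xi>s] tensor_point_tensor[OF tp hom \<xi>s'])
qed

section \<open>The Clifford algebra of an \'etale algebra\<close>

text \<open>Writes \<open>E \<xi>\<close> through elements of \<open>L\<close>, so that expressions
  such as \<open>c_L(E \<xi>)\<close> make sense as \<open>F\<^sub>s\<close>-combinations although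
  \<open>c_L\<close> is defined on \<open>L\<close> only.\<close>

lemma (in etale_coordinates) E_explicit:
  obtains A c where "\<And>\<xi>. finite (A \<xi>)" "\<And>\<xi>. E \<xi> = (\<Sum>a\<in>A \<xi>. sLs (c \<xi> a) (jL a))"
proof -
  interpret vector_space sLs by (rule vs_Ls)
  have "\<exists>A c. finite A \<and> E \<xi> = (\<Sum>a\<in>A. sLs (c a) (jL a))" for \<xi>
  proof -
    have "E \<xi> \<in> span (range jL)" using scalar_extension_span[OF ext] by simp
    then obtain S r where S: "finite S" "S \<subseteq> range jL" "E \<xi> = (\<Sum>y\<in>S. sLs (r y) y)"
      by (auto simp: span_explicit)
    have inv: "jL (inv jL y) = y" if "y \<in> S" for y using S(2) that by (auto intro: f_inv_into_f)
    define A where "A = inv jL ` S"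
    have A: "finite A" "inj_on jL A" "S = jL ` A"
      using S(1) inv by (auto simp: A_def image_image intro!: inj_onI)
    then show ?thesis using S by (intro exI[of _ A] exI[of _ "\<lambda>a. r (jL a)"]) (simp add: sum.reindex)
  qed
  then show ?thesis using that by metis
qed

lemma sum_lists_Suc:
  "(\<Sum>xs\<in>{xs. set xs \<subseteq> X \<and> length xs = Suc n}. g xs) =
    (\<Sum>x\<in>X. \<Sum>xs\<in>{xs. set xs \<subseteq> X \<and> length xs = n}. g (x # xs))"
proof -
  let ?S = "{xs. set xs \<subseteq> X \<and> length xs = n}"
  have eq: "{xs. set xs \<subseteq> X \<and> length xs = Suc n} = (\<lambda>(x, xs). x # xs) ` (X \<times> ?S)"
    by (auto simp: length_Suc_conv image_iff)
  have inj: "inj_on (\<lambda>(x, xs). x # xs) (X \<times> ?S)" by (auto simp: inj_on_def)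
  show ?thesis
    unfolding eq sum.reindex[OF inj] sum.cartesian_product by (simp add: case_prod_beta comp_def)
qed

context etale_coordinates
begin

abbreviation "point_lists m \<equiv> {\<xi>s. set \<xi>s \<subseteq> X \<and> length \<xi>s = m}"

text \<open>The \<open>E \<xi>\<close> form a basis of \<open>L\<^sub>s\<close> dual to the points,
  and \<open>w \<xi>s\<close> stands for the value of the extended map at the corresponding tuple of
  basis vectors. The induction extends one argument at a time to \<open>L\<^sub>s\<close>.\<close>

lemma multilinear_point_expansion:
  assumes vW: "vector_space sW" and h: "multilinear sL n (\<lambda>c. sW (\<iota> c)) h"
  shows "\<exists>w. \<forall>xs. length xs = n \<longrightarrow>
    h xs = (\<Sum>\<xi>s\<in>point_lists n. sW (\<Prod>i<n. (\<xi>s ! i) (xs ! i)) (w \<xi>s))"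
  using h
proof (induction n arbitrary: h)
  interpret W: vector_space sW by fact
  case 0
  have "point_lists 0 = {[]}" by auto
  then show ?case by (intro exI[of _ "\<lambda>_. h []"]) simp
next
  interpret W: vector_space sW by fact
  case (Suc n)
  obtain A c where A: "\<And>\<xi>. finite (A \<xi>)" and E: "\<And>\<xi>. E \<xi> = (\<Sum>a\<in>A \<xi>. sLs (c \<xi> a) (jL a))"
    using E_explicit by blast
  have "multilinear sL n (\<lambda>c. sW (\<iota> c)) (\<lambda>xs. h (a # xs))" for a
    unfolding multilinear_def
  proof (intro allI impI, elim conjE)
    fix zs :: "'l list" and k x y d assume zs: "length zs = n" "k < n"
    then show "h (a # zs[k := x + y]) = h (a # zs[k := x]) + h (a # zs[k := y]) \<and>
      h (a # zs[k := sL d x]) = sW (\<iota> d) (h (a # zs[k := x]))"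
      using multilinearD[OF Suc.prems, of "a # zs" "Suc k"] by simp
  qed
  then have "\<forall>a. \<exists>w. \<forall>xs. length xs = n \<longrightarrow>
      h (a # xs) = (\<Sum>\<xi>s\<in>point_lists n. sW (\<Prod>i<n. (\<xi>s ! i) (xs ! i)) (w \<xi>s))" by (intro allI Suc.IH)
  from choice[OF this] obtain w where w: "\<And>a xs. length xs = n \<Longrightarrow>
      h (a # xs) = (\<Sum>\<xi>s\<in>point_lists n. sW (\<Prod>i<n. (\<xi>s ! i) (xs ! i)) (w a \<xi>s))" by auto
  \<comment> \<open>The value at \<open>E (hd \<xi>s)\<close> of the extension in the first
    argument, computed from the explicit form of \<open>E\<close>.\<close>
  define v where "v \<xi>s = (\<Sum>a\<in>A (hd \<xi>s). sW (c (hd \<xi>s) a) (w a (tl \<xi>s)))" for \<xi>s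
  have "h (x # xs) = (\<Sum>\<xi>\<in>X. \<Sum>\<xi>s\<in>point_lists n.
      sW (\<xi> x * (\<Prod>i<n. (\<xi>s ! i) (xs ! i))) (v (\<xi> # \<xi>s)))" if xs: "length xs = n" for x xs
  proof -
    have "Vector_Spaces.linear sL (\<lambda>c. sW (\<iota> c)) (\<lambda>x. h (x # xs))"
      using multilinearD[OF Suc.prems, of "0 # xs" 0] xs
      by (simp add: Vector_Spaces.linear_iff vs_L vector_space_restrict[OF vW hom])
    then obtain H where H: "Vector_Spaces.linear sLs sW H" "\<And>a. H (jL a) = h (a # xs)"
      using scalar_extension_lift[OF ext hom vW] by metis
    have HE: "H (E \<xi>) = (\<Sum>a\<in>A \<xi>. sW (c \<xi> a) (h (a # xs)))" for \<xi>
      unfolding E by (simp add: linear_sumD[OF H(1)] linear_scaleD[OF H(1)] H(2))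
    have "h (x # xs) = (\<Sum>\<xi>\<in>X. sW (\<xi> x) (H (E \<xi>)))"
      using arg_cong[OF expand[of "jL x"], of H]
      by (simp add: H(2) linear_sumD[OF H(1)] linear_scaleD[OF H(1)] ev_j cong: sum.cong)
    also have "\<dots> = (\<Sum>\<xi>\<in>X. \<Sum>\<xi>s\<in>point_lists n.
      sW (\<xi> x * (\<Prod>i<n. (\<xi>s ! i) (xs ! i))) (v (\<xi> # \<xi>s)))"
    proof (rule sum.cong[OF refl])
      fix \<xi>
      have "H (E \<xi>) = (\<Sum>a\<in>A \<xi>. \<Sum>\<xi>s\<in>point_lists n.
          sW (\<Prod>i<n. (\<xi>s ! i) (xs ! i)) (sW (c \<xi> a) (w a \<xi>s)))"
        unfolding HE w[OF xs] by (simp add: W.scale_sum_right mult.commute)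
      also have "\<dots> = (\<Sum>\<xi>s\<in>point_lists n. sW (\<Prod>i<n. (\<xi>s ! i) (xs ! i)) (v (\<xi> # \<xi>s)))"
        by (subst sum.swap) (simp add: v_def W.scale_sum_right)
      finally show "sW (\<xi> x) (H (E \<xi>)) = (\<Sum>\<xi>s\<in>point_lists n.
          sW (\<xi> x * (\<Prod>i<n. (\<xi>s ! i) (xs ! i))) (v (\<xi> # \<xi>s)))"
        by (simp add: W.scale_sum_right)
    qed
    finally show ?thesis .
  qed
  note step = this
  show ?case
  proof (intro exI[of _ v] allI impI)
    fix zs :: "'l list" assume "length zs = Suc n"
    then obtain x xs where "zs = x # xs" "length xs = n" by (cases zs) auto
    then show "h zs = (\<Sum>\<xi>s\<in>point_lists (Suc n). sW (\<Prod>i<Suc n. (\<xi>s ! i) (zs ! i)) (v \<xi>s))"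
      by (simp add: step sum_lists_Suc prod.lessThan_Suc_shift del: prod.lessThan_Suc)
  qed
qed

lemma point_linear: "\<xi> \<in> X \<Longrightarrow> Vector_Spaces.linear sL (base_scale \<iota>) \<xi>"
  by (simp add: Vector_Spaces.linear_iff vs_L pointD vector_space_restrict[OF vector_space_mult hom])

end

locale etale_clifford_algebra = etale_coordinates \<iota> sL sLs jL ev E
  for \<iota> :: "'f::field \<Rightarrow> 's::field" and sL :: "'f \<Rightarrow> 'l::comm_ring_1 \<Rightarrow> 'l"
    and sLs :: "'s \<Rightarrow> 'ls::comm_ring_1 \<Rightarrow> 'ls" and jL :: "'l \<Rightarrow> 'ls"
    and ev :: "('l \<Rightarrow> 's) \<Rightarrow> 'ls \<Rightarrow> 's" and E :: "('l \<Rightarrow> 's) \<Rightarrow> 'ls" +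
  fixes \<sigma>L :: "'l \<Rightarrow> 'l" and n :: nat
    and sT :: "'f \<Rightarrow> 't::comm_ring_1 \<Rightarrow> 't" and t :: "'l list \<Rightarrow> 't" and e :: 't
  assumes tpow: "tensor_power sL n sT t" and idem: "clifford_idempotent \<iota> sL \<sigma>L n sT t e"
    and \<sigma>_hom: "alg_hom sL sL \<sigma>L" and \<sigma>_inv: "\<sigma>L \<circ> \<sigma>L = id"
begin

abbreviation "pt \<equiv> tensor_point \<iota> UNIV sT t"
abbreviation "CL \<equiv> etale_clifford n sT t e"
abbreviation "cL \<equiv> etale_clifford_map n t e"
abbreviation "tuples \<equiv> point_lists n"

lemma kT: "k_algebra sT"
  using tpow by (auto simp: tensor_power_def)

lemma pt_linear: "\<xi>s \<in> tuples \<Longrightarrow> Vector_Spaces.linear sT (base_scale \<iota>) (pt \<xi>s)"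
  and pt_tensor: "\<xi>s \<in> tuples \<Longrightarrow> length xs = n \<Longrightarrow> pt \<xi>s (t xs) = (\<Prod>i<n. (\<xi>s ! i) (xs ! i))"
  using tensor_point_linear[OF tpow hom point_linear] tensor_point_tensor[OF tpow hom point_linear] by blast+

lemma nth_tuple: "\<xi>s \<in> tuples \<Longrightarrow> i < n \<Longrightarrow> \<xi>s ! i \<in> X"
  using nth_mem by blast

lemma pt_mult: "\<xi>s \<in> tuples \<Longrightarrow> pt \<xi>s (u * v) = pt \<xi>s u * pt \<xi>s v"
  by (rule tensor_power_mult_ext[OF tpow k_algebra_restrict[OF k_algebra_mult hom] pt_linear])
    (auto simp: pt_tensor pointD nth_tuple prod.distrib)

text \<open>Here \<open>w \<xi>s\<close> can be read as the value of the extension of \<tau> at the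
  primitive idempotent of \<open>L\<^sup>\<otimes>\<^sup>n \<otimes> F\<^sub>s\<close> belonging to
  the tuple \<open>\<xi>s\<close>; the expansion works with tuples and keeps that algebra
  implicit.\<close>

lemma pt_expansion:
  assumes "vector_space sW" "Vector_Spaces.linear sT (\<lambda>c. sW (\<iota> c)) \<tau>"
  shows "\<exists>w. \<forall>x. \<tau> x = (\<Sum>\<xi>s\<in>tuples. sW (pt \<xi>s x) (w \<xi>s))"
proof -
  interpret W: vector_space sW by fact
  have ml: "multilinear sL n (\<lambda>c. sW (\<iota> c)) (\<lambda>xs. \<tau> (t xs))"
    using multilinearD[OF tensor_power_multilinear[OF tpow]]
    by (simp add: multilinear_def linear_addD[OF assms(2)] linear_scaleD[OF assms(2)])
  obtain w where w: "\<And>xs. length xs = n \<Longrightarrow> \<tau> (t xs) = (\<Sum>\<xi>s\<in>tuples. sW (\<Prod>i<n. (\<xi>s ! i) (xs ! i)) (w \<xi>s))"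
    using multilinear_point_expansion[OF assms(1) ml] by (elim exE) simp
  have "\<tau> x = (\<Sum>\<xi>s\<in>tuples. sW (pt \<xi>s x) (w \<xi>s))" for x
  proof (rule tensor_power_ext[OF tpow assms(2)])
    show "Vector_Spaces.linear sT (\<lambda>c. sW (\<iota> c)) (\<lambda>x. \<Sum>\<xi>s\<in>tuples. sW (pt \<xi>s x) (w \<xi>s))"
      using tensor_power_vector_space[OF tpow] vector_space_restrict[OF assms(1) hom]
      by (auto simp: Vector_Spaces.linear_iff W.scale_sum_right linear_addD[OF pt_linear] linear_scaleD[OF pt_linear]
          W.scale_left_distrib sum.distrib intro!: sum.cong)
  qed (simp add: w pt_tensor)
  then show ?thesis by (intro exI[of _ w] allI)
qed

lemma pt_e:
  assumes "\<xi>s \<in> tuples"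
  shows "pt \<xi>s e = (if distinct (map (\<lambda>\<xi>. restrict \<xi> (fixed_set \<sigma>L)) \<xi>s) then 1 else 0)"
proof -
  let ?r = "\<lambda>\<xi>. restrict \<xi> (fixed_set \<sigma>L)"
  have \<sigma>: "\<sigma>L (x + y) = \<sigma>L x + \<sigma>L y" "\<sigma>L (x * y) = \<sigma>L x * \<sigma>L y" "\<sigma>L 1 = 1" "\<sigma>L (sL c x) = sL c (\<sigma>L x)" for x y c
    using \<sigma>_hom by (auto simp: alg_hom_on_def lin_on_def)
  have r: "?r \<xi> \<in> alg_points \<iota> sL (fixed_set \<sigma>L) 1" if "\<xi> \<in> X" for \<xi>
    using pointD[OF that] by (auto simp: alg_points_def alg_hom_on_def lin_on_def \<sigma>)
  have span: "e \<in> module.span sT (t ` {xs. length xs = n \<and> set xs \<subseteq> fixed_set \<sigma>L})"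
    and e: "\<And>\<xi>s. length \<xi>s = n \<Longrightarrow> set \<xi>s \<subseteq> alg_points \<iota> sL (fixed_set \<sigma>L) 1 \<Longrightarrow>
        tensor_point \<iota> (fixed_set \<sigma>L) sT t \<xi>s e = (if distinct \<xi>s then 1 else 0)"
    using idem by (auto simp: clifford_idempotent_def)
  have "tensor_point \<iota> (fixed_set \<sigma>L) sT t (map ?r \<xi>s) e = pt \<xi>s e"
    using assms by (intro tensor_point_subspace[OF tpow hom point_linear _ _ _ span]) auto
  moreover have "tensor_point \<iota> (fixed_set \<sigma>L) sT t (map ?r \<xi>s) e = (if distinct (map ?r \<xi>s) then 1 else 0)"
    using assms r by (intro e) auto
  ultimately show ?thesis by simp
qed

definition symmetric :: "'t set" where
  "symmetric = {u. \<forall>p. p permutes {..<n} \<longrightarrow> permute_factors n sT t p u = u}"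

lemma symmetric_closed:
  "u \<in> symmetric \<Longrightarrow> v \<in> symmetric \<Longrightarrow> u + v \<in> symmetric"
  "u \<in> symmetric \<Longrightarrow> v \<in> symmetric \<Longrightarrow> u * v \<in> symmetric"
  "u \<in> symmetric \<Longrightarrow> sT c u \<in> symmetric" "1 \<in> symmetric"
  by (auto simp: symmetric_def permute_factors_mult[OF tpow] permute_factors_1[OF tpow]
      linear_addD[OF permute_factors_linear[OF tpow]] linear_scaleD[OF permute_factors_linear[OF tpow]])

lemma CL_eq: "CL = (\<lambda>u. e * u) ` symmetric"
  by (simp add: etale_clifford_def symmetric_def)

lemma ee: "e * e = e"
  using idem by (simp add: clifford_idempotent_def)

lemma CL_closed:
  "c \<in> CL \<Longrightarrow> d \<in> CL \<Longrightarrow> c + d \<in> CL" "c \<in> CL \<Longrightarrow> d \<in> CL \<Longrightarrow> c * d \<in> CL"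
  "c \<in> CL \<Longrightarrow> sT k c \<in> CL" "e \<in> CL"
proof -
  have sc: "sT k (e * u) = e * sT k u" for k u by (rule k_algebra.scale_mult_right[OF kT])
  have mu: "(e * u) * (e * v) = e * (u * v)" for u v by (metis ee mult.assoc mult.left_commute)
  show "c \<in> CL \<Longrightarrow> d \<in> CL \<Longrightarrow> c + d \<in> CL"
    unfolding CL_eq using symmetric_closed(1) by (auto simp flip: distrib_left)
  show "c \<in> CL \<Longrightarrow> d \<in> CL \<Longrightarrow> c * d \<in> CL"
    unfolding CL_eq using symmetric_closed(2) by (auto simp: mu)
  show "c \<in> CL \<Longrightarrow> sT k c \<in> CL"
    unfolding CL_eq using symmetric_closed(3) by (auto simp: sc)
  show "e \<in> CL"
    unfolding CL_eq using symmetric_closed(4) by (intro image_eqI[of _ _ 1]) auto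
qed

lemma cL_in_CL: "cL l \<in> CL"
proof -
  let ?g = "\<lambda>i. t ((replicate n 1)[i := l])"
  have "permute_factors n sT t p (\<Sum>i<n. ?g i) = (\<Sum>i<n. ?g i)" if p: "p permutes {..<n}" for p
  proof -
    have r: "permute_list p (replicate n (1 :: 'l)) = replicate n 1"
      using p by (intro nth_equalityI) (simp_all add: permute_list_nth permutes_less[OF p])
    have "permute_factors n sT t p (\<Sum>i<n. ?g i) = (\<Sum>i<n. ?g (inv p i))"
      using p by (simp add: linear_sumD[OF permute_factors_linear[OF tpow p]] permute_factors_tensor[OF tpow p]
          permute_list_update r)
    also have "\<dots> = (\<Sum>i<n. ?g i)" using sum.permute[OF permutes_inv[OF p], of ?g] by (simp add: comp_def)
    finally show ?thesis .
  qed
  then show ?thesis unfolding CL_eq etale_clifford_map_def by (auto simp: symmetric_def)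
qed

lemma pt_cL:
  assumes "\<xi>s \<in> tuples"
  shows "pt \<xi>s (cL l) = pt \<xi>s e * (\<Sum>i<n. (\<xi>s ! i) l)"
proof -
  have "pt \<xi>s (t ((replicate n 1)[i := l])) = (\<xi>s ! i) l" if i: "i < n" for i
  proof -
    have "pt \<xi>s (t ((replicate n 1)[i := l])) = (\<Prod>k<n. if k = i then (\<xi>s ! i) l else 1)"
      unfolding pt_tensor[OF assms, of "(replicate n 1)[i := l]", simplified]
    proof (rule prod.cong[OF refl])
      fix k assume "k \<in> {..<n}"
      then show "(\<xi>s ! k) ((replicate n 1)[i := l] ! k) = (if k = i then (\<xi>s ! i) l else 1)"
        using pointD(3)[OF nth_tuple[OF assms, of k]] by (cases "k = i") simp_all
    qed
    then show ?thesis using i by simp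
  qed
  then show ?thesis
    by (simp add: etale_clifford_map_def pt_mult[OF assms] linear_sumD[OF pt_linear[OF assms]])
qed

lemma pt_symmetric:
  assumes "\<xi>s \<in> tuples" "mset \<zeta>s = mset \<xi>s" "u \<in> symmetric"
  shows "pt \<zeta>s u = pt \<xi>s u"
proof -
  obtain p where p: "p permutes {..<length \<xi>s}" "permute_list p \<xi>s = \<zeta>s"
    using mset_eq_permutation[OF assms(2)] by blast
  then show ?thesis
    using tensor_point_permute[OF tpow hom point_linear, of \<xi>s p u] assms(1,3) by (auto simp: symmetric_def)
qed

end

locale etale_clifford_point = etale_clifford_algebra \<iota> sL sLs jL ev E \<sigma>L n sT t e
  for \<iota> :: "'f::field \<Rightarrow> 's::field" and sL :: "'f \<Rightarrow> 'l::comm_ring_1 \<Rightarrow> 'l"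
    and sLs :: "'s \<Rightarrow> 'ls::comm_ring_1 \<Rightarrow> 'ls" and jL ev E \<sigma>L n
    and sT :: "'f \<Rightarrow> 't::comm_ring_1 \<Rightarrow> 't" and t e +
  fixes \<omega> :: "('l \<Rightarrow> 's) set"
  assumes card_X: "card (alg_points \<iota> sL UNIV 1) = 2 * n" and \<omega>: "\<omega> \<in> CY \<iota> sL \<sigma>L n"
begin

abbreviation "\<eta> \<equiv> CY_point \<iota> n sT t e \<omega>"

lemma \<omega>D: "\<omega> \<subseteq> X" "finite \<omega>" "card \<omega> = n" "\<xi> \<in> \<omega> \<Longrightarrow> \<xi> \<circ> \<sigma>L \<notin> \<omega>"
  using \<omega> by (auto simp: CY_def)

lemma enumeration_tuple: "distinct \<xi>s \<Longrightarrow> set \<xi>s = \<omega> \<Longrightarrow> \<xi>s \<in> tuples"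
  using \<omega>D distinct_card by fastforce

text \<open>Two points with the same restriction to the fixed algebra are equal or conjugate, and
  \<omega> contains no conjugate pair. So the restrictions are pairwise distinct, which is the case
  in which \<open>e\<close> takes the value 1.\<close>

lemma pt_e_enumeration:
  assumes "distinct \<xi>s" "set \<xi>s = \<omega>"
  shows "pt \<xi>s e = 1"
proof -
  have "inj_on (\<lambda>\<xi>. restrict \<xi> (fixed_set \<sigma>L)) \<omega>"
  proof (rule inj_onI)
    fix \<xi> \<zeta> assume a: "\<xi> \<in> \<omega>" "\<zeta> \<in> \<omega>" "restrict \<xi> (fixed_set \<sigma>L) = restrict \<zeta> (fixed_set \<sigma>L)"
    then have "\<xi> x = \<zeta> x" if "\<sigma>L x = x" for x
      using that by (metis (mono_tags, lifting) mem_Collect_eq restrict_apply')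
    then have "\<zeta> = \<xi> \<or> \<zeta> = \<xi> \<circ> \<sigma>L"
      using points_agree_on_fixed[OF \<sigma>_hom \<sigma>_inv, of \<xi> \<iota> \<zeta>] a \<omega>D(1) by blast
    then show "\<xi> = \<zeta>" using a \<omega>D(4) by auto
  qed
  then show ?thesis using assms by (simp add: pt_e[OF enumeration_tuple] distinct_map)
qed

text \<open>\<open>CY_point\<close> evaluates at an enumeration picked by \<open>SOME\<close>. An
  element of \<open>CL\<close> is \<open>e * u\<close> with \<open>u\<close> symmetric: reordering
  the enumeration does not change the value of \<open>u\<close>, and \<open>e\<close> has value 1 at
  every enumeration of \<omega>.\<close>

lemma \<eta>_eq:
  assumes "distinct \<xi>s" "set \<xi>s = \<omega>" "c \<in> CL"
  shows "\<eta> c = pt \<xi>s c"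
proof -
  define \<zeta>s where "\<zeta>s = (SOME \<xi>s. distinct \<xi>s \<and> set \<xi>s = \<omega>)"
  then have \<zeta>s: "distinct \<zeta>s" "set \<zeta>s = \<omega>"
    using someI[of "\<lambda>\<xi>s. distinct \<xi>s \<and> set \<xi>s = \<omega>" \<xi>s] assms by auto
  obtain u where u: "u \<in> symmetric" "c = e * u" using assms(3) by (auto simp: CL_eq)
  have "mset \<zeta>s = mset \<xi>s" using assms \<zeta>s by (metis set_eq_iff_mset_eq_distinct)
  then have "pt \<zeta>s u = pt \<xi>s u" using pt_symmetric[OF enumeration_tuple] assms u by blast
  then have "pt \<zeta>s c = pt \<xi>s c"
    using u(2) pt_mult[OF enumeration_tuple[OF \<zeta>s]] pt_mult[OF enumeration_tuple[OF assms(1,2)]]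
    by (simp add: pt_e_enumeration assms(1,2) \<zeta>s)
  then show ?thesis using assms(3) by (simp add: CY_point_def flip: \<zeta>s_def)
qed

lemma enumeration:
  obtains \<xi>s where "distinct \<xi>s" "set \<xi>s = \<omega>"
  using finite_distinct_list[OF \<omega>D(2)] by blast

lemma \<eta>_cL: "\<eta> (cL l) = (\<Sum>\<xi>\<in>\<omega>. \<xi> l)"
proof -
  obtain \<xi>s where \<xi>s: "distinct \<xi>s" "set \<xi>s = \<omega>" by (rule enumeration)
  have "(\<Sum>i<n. (\<xi>s ! i) l) = (\<Sum>\<xi>\<in>\<omega>. \<xi> l)"
    using enumeration_tuple[OF \<xi>s] \<xi>s by (intro sum.reindex_bij_betw bij_betw_nth) auto
  then show ?thesis
    by (simp add: \<eta>_eq[OF \<xi>s cL_in_CL] pt_cL[OF enumeration_tuple[OF \<xi>s]] pt_e_enumeration[OF \<xi>s])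
qed

lemma \<eta>_point: "\<eta> \<in> alg_points \<iota> sT CL e"
proof -
  obtain \<xi>s where \<xi>s: "distinct \<xi>s" "set \<xi>s = \<omega>" by (rule enumeration)
  note t = enumeration_tuple[OF \<xi>s] and eq = \<eta>_eq[OF \<xi>s]
  show ?thesis
    using linear_addD[OF pt_linear[OF t]] linear_scaleD[OF pt_linear[OF t]]
    by (simp add: alg_points_def alg_hom_on_def lin_on_def eq CL_closed pt_mult[OF t] pt_e_enumeration[OF \<xi>s])
      (simp add: CY_point_def)
qed

text \<open>In \<open>C(L, \<sigma>\<^sub>L)\<^sub>s\<close> the product over \<open>\<xi> \<in> \<omega>\<close> of the elements \<open>c\<^sub>L(E \<xi>)\<close> is the primitive idempotent at
  \<open>\<omega>\<close>; the hypothesis says that each of these elements acts by 1.\<close>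

lemma character_unique:
  assumes vW: "vector_space sW" and \<tau>: "lin_on sT (\<lambda>c. sW (\<iota> c)) CL \<tau>"
    and act: "\<And>c l. c \<in> CL \<Longrightarrow> \<tau> (c * cL l) = sW (\<Sum>\<xi>\<in>\<omega>. \<xi> l) (\<tau> c)" and c: "c \<in> CL"
  shows "\<tau> c = sW (\<eta> c) (\<tau> e)"
proof -
  interpret W: vector_space sW by fact
  interpret T: vector_space sT by (rule tensor_power_vector_space[OF tpow])
  have "T.subspace CL"
  proof (rule T.subspaceI)
    show "0 \<in> CL" using CL_closed(3)[of e 0] CL_closed(4) by simp
  qed (use CL_closed in auto)
  then obtain \<tau>' where \<tau>': "Vector_Spaces.linear sT (\<lambda>c. sW (\<iota> c)) \<tau>'" "\<And>x. x \<in> CL \<Longrightarrow> \<tau>' x = \<tau> x"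
    using lin_on_extend[OF T.vector_space_axioms vector_space_restrict[OF vW hom] _ \<tau>] by blast
  obtain w where w: "\<And>x. \<tau>' x = (\<Sum>\<xi>s\<in>tuples. sW (pt \<xi>s x) (w \<xi>s))"
    using pt_expansion[OF vW \<tau>'(1)] by (elim exE) simp
  obtain A k where A: "\<And>\<xi>. finite (A \<xi>)" and E: "\<And>\<xi>. E \<xi> = (\<Sum>a\<in>A \<xi>. sLs (k \<xi> a) (jL a))"
    using E_explicit by blast
  have dual: "(\<Sum>a\<in>A \<xi>. k \<xi> a * \<zeta> a) = (if \<zeta> = \<xi> then 1 else 0)" if "\<xi> \<in> X" "\<zeta> \<in> X" for \<xi> \<zeta>
    using ev_E[OF that(2,1)] unfolding E by (simp add: ev_sum ev_scale ev_j that)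
  \<comment> \<open>The value of \<open>c_L(E \<xi>)\<close> at the tuple \<open>\<xi>s\<close>, via
    the expansion of \<open>E \<xi>\<close> in elements of \<open>L\<close>.\<close>
  define N where "N \<xi> \<xi>s = (\<Sum>a\<in>A \<xi>. k \<xi> a * pt \<xi>s (cL a))" for \<xi> \<xi>s
  \<comment> \<open>Each new factor multiplies the result by the sum of
    \<open>ev \<zeta> (E \<xi>)\<close> over \<zeta> \<in> \<omega>, which is 1. The element
    \<open>d\<close> must vary in the induction because it absorbs \<open>cL a\<close>.\<close>
  have *: "(\<Sum>\<xi>s\<in>tuples. sW (pt \<xi>s d * (\<Prod>\<xi>\<in>D. N \<xi> \<xi>s)) (w \<xi>s)) = \<tau> d"
    if "finite D" "D \<subseteq> \<omega>" "d \<in> CL" for D d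
    using that
  proof (induction D arbitrary: d rule: finite_induct)
    case empty
    then show ?case using w \<tau>' by simp
  next
    case (insert \<xi> D)
    then have \<xi>: "\<xi> \<in> X" "\<xi> \<in> \<omega>" using \<omega>D by auto
    have "pt \<xi>s d * (\<Prod>\<zeta>\<in>insert \<xi> D. N \<zeta> \<xi>s) = (\<Sum>a\<in>A \<xi>. k \<xi> a * (pt \<xi>s (d * cL a) * (\<Prod>\<zeta>\<in>D. N \<zeta> \<xi>s)))"
      if "\<xi>s \<in> tuples" for \<xi>s
      using insert.hyps by (simp add: N_def[of \<xi>] pt_mult[OF that] sum_distrib_left sum_distrib_right algebra_simps)
    then have "(\<Sum>\<xi>s\<in>tuples. sW (pt \<xi>s d * (\<Prod>\<zeta>\<in>insert \<xi> D. N \<zeta> \<xi>s)) (w \<xi>s)) =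
        (\<Sum>\<xi>s\<in>tuples. \<Sum>a\<in>A \<xi>. sW (k \<xi> a) (sW (pt \<xi>s (d * cL a) * (\<Prod>\<zeta>\<in>D. N \<zeta> \<xi>s)) (w \<xi>s)))"
      by (intro sum.cong) (simp_all add: W.scale_sum_left)
    also have "\<dots> = (\<Sum>a\<in>A \<xi>. \<Sum>\<xi>s\<in>tuples. sW (k \<xi> a) (sW (pt \<xi>s (d * cL a) * (\<Prod>\<zeta>\<in>D. N \<zeta> \<xi>s)) (w \<xi>s)))"
      by (rule sum.swap)
    also have "\<dots> = (\<Sum>a\<in>A \<xi>. sW (k \<xi> a) (\<tau> (d * cL a)))"
      by (intro sum.cong[OF refl], subst W.scale_sum_right[symmetric])
        (use insert.prems CL_closed(2) cL_in_CL in \<open>simp only: insert.IH insert_subset\<close>)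
    also have "\<dots> = sW (\<Sum>a\<in>A \<xi>. k \<xi> a * (\<Sum>\<zeta>\<in>\<omega>. \<zeta> a)) (\<tau> d)"
      using insert.prems by (simp only: act W.scale_scale W.scale_sum_left[of _ "A \<xi>"])
    also have "(\<Sum>a\<in>A \<xi>. k \<xi> a * (\<Sum>\<zeta>\<in>\<omega>. \<zeta> a)) = (\<Sum>\<zeta>\<in>\<omega>. \<Sum>a\<in>A \<xi>. k \<xi> a * \<zeta> a)"
      by (simp add: sum_distrib_left) (rule sum.swap)
    also have "\<dots> = (\<Sum>\<zeta>\<in>\<omega>. if \<zeta> = \<xi> then 1 else 0)"
      using \<omega>D(1) \<xi> by (intro sum.cong) (auto simp: dual)
    also have "\<dots> = 1" using \<xi> \<omega>D(2) by simp
    finally show ?case by simp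
  qed
  have N: "N \<xi> \<xi>s = pt \<xi>s e * (\<Sum>i<n. if \<xi>s ! i = \<xi> then 1 else 0)" if "\<xi> \<in> X" "\<xi>s \<in> tuples" for \<xi> \<xi>s
  proof -
    have "N \<xi> \<xi>s = pt \<xi>s e * (\<Sum>i<n. \<Sum>a\<in>A \<xi>. k \<xi> a * (\<xi>s ! i) a)"
      unfolding N_def pt_cL[OF that(2)] by (subst sum.swap) (simp add: sum_distrib_left mult.left_commute)
    then show ?thesis using dual nth_tuple that by simp
  qed
  \<comment> \<open>A tuple of length \<open>n\<close> whose entries cover \<omega> is an
    enumeration of \<omega>, and there \<open>pt \<xi>s c\<close> is \<open>\<eta> c\<close>. In any
    other tuple some \<xi> \<in> \<omega> is missing, and then \<open>N \<xi> \<xi>s = 0\<close>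
    makes both sides vanish.\<close>
  have "pt \<xi>s c * (\<Prod>\<xi>\<in>\<omega>. N \<xi> \<xi>s) = \<eta> c * (pt \<xi>s e * (\<Prod>\<xi>\<in>\<omega>. N \<xi> \<xi>s))" if \<xi>s: "\<xi>s \<in> tuples" for \<xi>s
  proof (cases "\<omega> \<subseteq> set \<xi>s")
    case True
    then have "distinct \<xi>s" "set \<xi>s = \<omega>"
      using \<xi>s \<omega>D(3) card_length[of \<xi>s] card_seteq[of "set \<xi>s" \<omega>] by (auto intro: card_distinct)
    then show ?thesis using c by (simp add: \<eta>_eq pt_e_enumeration)
  next
    case False
    then obtain \<xi> where \<xi>: "\<xi> \<in> \<omega>" "\<xi> \<notin> set \<xi>s" by blast
    then have "\<xi>s ! i \<noteq> \<xi>" if "i < n" for i using \<xi>s that nth_mem by fastforce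
    then have "N \<xi> \<xi>s = 0" using N \<xi>s \<xi> \<omega>D(1) by auto
    then have "(\<Prod>\<xi>\<in>\<omega>. N \<xi> \<xi>s) = 0" using \<xi>(1) \<omega>D(2) by auto
    then show ?thesis by simp
  qed
  then have "(\<Sum>\<xi>s\<in>tuples. sW (pt \<xi>s c * (\<Prod>\<xi>\<in>\<omega>. N \<xi> \<xi>s)) (w \<xi>s)) =
      (\<Sum>\<xi>s\<in>tuples. sW (\<eta> c * (pt \<xi>s e * (\<Prod>\<xi>\<in>\<omega>. N \<xi> \<xi>s))) (w \<xi>s))"
    by (intro sum.cong) simp_all
  also have "\<dots> = sW (\<eta> c) (\<Sum>\<xi>s\<in>tuples. sW (pt \<xi>s e * (\<Prod>\<xi>\<in>\<omega>. N \<xi> \<xi>s)) (w \<xi>s))"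
    by (simp add: W.scale_sum_right)
  finally show ?thesis unfolding *[OF \<omega>D(2) order_refl c] *[OF \<omega>D(2) order_refl CL_closed(4)] .
qed

end

section \<open>Endomorphisms of a quadratic space\<close>

text \<open>Independence of an indexed family, in which repetitions count as dependence. Unlike the
  version for sets it passes directly to families indexed by a product, as needed for
  tensors.\<close>

definition independent_on :: "('k::field \<Rightarrow> 'v::ab_group_add \<Rightarrow> 'v) \<Rightarrow> 'i set \<Rightarrow> ('i \<Rightarrow> 'v) \<Rightarrow> bool" where
  "independent_on s I g \<longleftrightarrow> (\<forall>a. (\<Sum>i\<in>I. s (a i) (g i)) = 0 \<longrightarrow> (\<forall>i\<in>I. a i = 0))"

lemma independent_on_imp:
  "vector_space s \<Longrightarrow> finite I \<Longrightarrow> independent_on s I g \<Longrightarrow> inj_on g I \<and> \<not> module.dependent s (g ` I)"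
  by (rule independent_family) (auto simp: independent_on_def)

lemma independent_imp_independent_on:
  "vector_space s \<Longrightarrow> finite B \<Longrightarrow> \<not> module.dependent s B \<Longrightarrow> independent_on s B (\<lambda>b. b)"
  unfolding independent_on_def using family_coefficient_zero[of s "\<lambda>b. b" B] by auto

text \<open>\<open>endo_trace\<close> refers to a chosen basis, but its value on a rank one
  endomorphism does not. Together with linearity this yields all the traces computed below.\<close>

lemma endo_trace_rank_one:
  assumes vV: "vector_space sV" and fin: "\<exists>B. finite B \<and> module.span sV B = UNIV"
    and \<phi>: "Vector_Spaces.linear sV (*) \<phi>"
  shows "endo_trace sV (\<lambda>x. sV (\<phi> x) v) = \<phi> v"
    and endo_trace_add: "endo_trace sV (\<lambda>x. S x + T x) = endo_trace sV S + endo_trace sV T"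
    and endo_trace_scale: "endo_trace sV (\<lambda>x. sV c (T x)) = c * endo_trace sV T"
proof -
  interpret vector_space sV by (rule vV)
  define B where "B = (SOME B. independent B \<and> span B = UNIV)"
  obtain C where C: "independent C" "UNIV \<subseteq> span C"
    by (rule maximal_independent_subset[of UNIV])
  then have "\<exists>B. independent B \<and> span B = UNIV" by (intro exI[of _ C]) auto
  then have B: "independent B" "span B = UNIV"
    using someI_ex[of "\<lambda>B. independent B \<and> span B = UNIV"] by (auto simp: B_def)
  obtain D where "finite D" "span D = UNIV" using fin by (elim exE conjE)
  then have finB: "finite B" using independent_span_bound[OF _ B(1)] by simp
  have tr: "endo_trace sV T = (\<Sum>b\<in>B. representation B (T b) b)" for T
    by (simp add: endo_trace_def B_def Let_def)
  have "\<phi> v = \<phi> (\<Sum>b\<in>B. sV (representation B v b) b)"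
    using sum_representation_eq[OF B(1), of v B] B(2) finB by simp
  also have "\<dots> = (\<Sum>b\<in>B. representation B v b * \<phi> b)"
    by (simp add: linear_sumD[OF \<phi>] linear_scaleD[OF \<phi>])
  finally show "endo_trace sV (\<lambda>x. sV (\<phi> x) v) = \<phi> v"
    by (simp add: tr representation_scale[OF B(1)] B(2) mult.commute)
  show "endo_trace sV (\<lambda>x. S x + T x) = endo_trace sV S + endo_trace sV T"
    by (simp add: tr representation_add[OF B(1)] B(2) sum.distrib)
  show "endo_trace sV (\<lambda>x. sV c (T x)) = c * endo_trace sV T"
    by (simp add: tr representation_scale[OF B(1)] B(2) sum_distrib_left)
qed

lemma polar_sym: "polar q v w = polar q w v"
  by (simp add: polar_def add.commute)

locale split_quadratic_space =
  fixes sAs :: "'s::field \<Rightarrow> 'as::ring_1 \<Rightarrow> 'as" and sV :: "'s \<Rightarrow> 'v::ab_group_add \<Rightarrow> 'v"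
    and \<Phi> :: "'as \<Rightarrow> 'v \<Rightarrow> 'v" and q :: "'v \<Rightarrow> 's" and \<sigma>s :: "'as \<Rightarrow> 'as"
  assumes kA: "k_algebra sAs" and split: "splitting sAs sV \<Phi>" and qf: "quadratic_form sV q"
    and nondeg: "(\<And>w. polar q v w = 0) \<Longrightarrow> v = 0"
    and \<sigma>s_linear: "lin_on sAs sAs UNIV \<sigma>s"
    and adjoint: "polar q v (\<Phi> x w) = polar q (\<Phi> (\<sigma>s x) v) w"
begin

abbreviation b where "b \<equiv> polar q"
abbreviation tens where "tens \<equiv> vtens sV q \<Phi>"
abbreviation trace where "trace x \<equiv> endo_trace sV (\<Phi> x)"

lemma vV: "vector_space sV" and fin_dim: "\<exists>B. finite B \<and> module.span sV B = UNIV"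
  and \<Phi>_bij: "bij_betw \<Phi> UNIV {T. Vector_Spaces.linear sV sV T}"
  and \<Phi>_add: "\<Phi> (x + y) = (\<lambda>v. \<Phi> x v + \<Phi> y v)" and \<Phi>_mult: "\<Phi> (x * y) v = \<Phi> x (\<Phi> y v)"
  and \<Phi>_scale: "\<Phi> (sAs c x) = (\<lambda>v. sV c (\<Phi> x v))"
  using split by (auto simp: splitting_def)

lemma vA: "vector_space sAs"
  using kA by (rule k_algebra_vector_space)

sublocale V: vector_space sV by (rule vV)
sublocale A: k_algebra sAs by (rule kA)

lemma \<Phi>_linear: "Vector_Spaces.linear sV sV (\<Phi> x)"
  using \<Phi>_bij by (auto simp: bij_betw_def)

lemma \<Phi>_apply_linear: "Vector_Spaces.linear sAs sV (\<lambda>x. \<Phi> x v)"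
  by (simp add: Vector_Spaces.linear_iff vV vA \<Phi>_add \<Phi>_scale)

lemmas \<Phi>_sum = linear_sumD[OF \<Phi>_apply_linear] and \<Phi>_0 = linear_0D[OF \<Phi>_apply_linear]

lemma \<Phi>_eqI: "(\<And>v. \<Phi> x v = \<Phi> y v) \<Longrightarrow> x = y"
  using \<Phi>_bij by (metis bij_betw_imp_inj_on ext injD)

lemma \<Phi>_1: "\<Phi> 1 v = v"
proof -
  have "(\<lambda>v. v) \<in> range \<Phi>" using \<Phi>_bij V.linear_id by (auto simp: bij_betw_def id_def)
  then obtain x where "\<Phi> x = (\<lambda>v. v)" by (metis rangeE)
  then show ?thesis using \<Phi>_mult[of 1 x v] by simp
qed

lemma b_linear: "Vector_Spaces.linear sV (*) (b w)"
proof -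
  have "lin_on sV (*) UNIV (\<lambda>v. b v w)" using qf by (simp add: quadratic_form_def)
  then have "Vector_Spaces.linear sV (*) (\<lambda>v. b v w)"
    using vV vector_space_mult by (simp add: linear_iff_lin_on)
  moreover have "(\<lambda>v. b v w) = b w" by (rule ext) (rule polar_sym)
  ultimately show ?thesis by simp
qed

lemmas b_add = linear_addD[OF b_linear] and b_scale = linear_scaleD[OF b_linear]
  and b_sum = linear_sumD[OF b_linear] and b_0 = linear_0D[OF b_linear]

lemma b_linear_left: "Vector_Spaces.linear sV (*) (\<lambda>v. b v w)"
proof -
  have "(\<lambda>v. b v w) = b w" by (rule ext) (rule polar_sym)
  then show ?thesis using b_linear by simp
qed

lemmas b_add_left = linear_addD[OF b_linear_left] and b_scale_left = linear_scaleD[OF b_linear_left]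
  and b_sum_left = linear_sumD[OF b_linear_left] and b_0_left = linear_0D[OF b_linear_left]

lemma b_eqI:
  assumes "\<And>w. b v w = b v' w"
  shows "v = v'"
proof -
  have "b (v - v') w = 0" for w using linear_diffD[OF b_linear_left, of v v' w] assms by simp
  then show ?thesis using nondeg[of "v - v'"] by simp
qed

lemma \<Phi>_tens: "\<Phi> (tens v w) x = sV (b w x) v"
proof -
  have "Vector_Spaces.linear sV sV (\<lambda>x. sV (b w x) v)"
    by (simp add: Vector_Spaces.linear_iff vV b_add b_scale V.scale_left_distrib)
  then have "(\<lambda>x. sV (b w x) v) \<in> range \<Phi>" using \<Phi>_bij by (simp add: bij_betw_def)
  then show ?thesis unfolding vtens_def by (simp add: f_inv_into_f)
qed

lemma tens_linear_right: "Vector_Spaces.linear sV sAs (tens v)"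
  by (auto simp: Vector_Spaces.linear_iff vV vA \<Phi>_tens \<Phi>_add \<Phi>_scale b_add_left b_scale_left V.scale_left_distrib
      intro!: \<Phi>_eqI)

lemma mult_tens: "x * tens v w = tens (\<Phi> x v) w"
  by (rule \<Phi>_eqI) (simp add: \<Phi>_mult \<Phi>_tens linear_scaleD[OF \<Phi>_linear])

lemma tens_mult: "tens v w * x = tens v (\<Phi> (\<sigma>s x) w)"
  by (rule \<Phi>_eqI) (simp add: \<Phi>_mult \<Phi>_tens adjoint)

lemma tens_mult_tens: "tens v w * tens v' w' = sAs (b w v') (tens v w')"
  by (rule \<Phi>_eqI) (simp add: \<Phi>_mult \<Phi>_tens \<Phi>_scale b_scale mult.commute)

lemma \<sigma>s_tens: "\<sigma>s (tens v w) = tens w v"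
  by (intro \<Phi>_eqI b_eqI) (simp add: \<Phi>_tens b_scale_left b_scale polar_sym[of q v] flip: adjoint)

lemma \<sigma>s_lin: "Vector_Spaces.linear sAs sAs \<sigma>s"
  using \<sigma>s_linear vA by (simp add: linear_iff_lin_on)

lemma trace_linear: "Vector_Spaces.linear sAs (*) (\<lambda>x. trace x)"
  by (simp add: Vector_Spaces.linear_iff vA vector_space_mult \<Phi>_add \<Phi>_scale
      endo_trace_add[OF vV fin_dim b_linear] endo_trace_scale[OF vV fin_dim b_linear])

lemma trace_tens: "trace (tens v w) = b w v"
proof -
  have "\<Phi> (tens v w) = (\<lambda>x. sV (b w x) v)" by (rule ext) (rule \<Phi>_tens)
  then show ?thesis using endo_trace_rank_one[OF vV fin_dim b_linear] by simp
qed

text \<open>Apply a relation to a vector \<open>x\<close> and compare coefficients of the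
  \<open>g i\<close>: for each \<open>i\<close> the vector with coefficients \<open>a (i, k)\<close>
  on the \<open>h k\<close> is orthogonal to every \<open>x\<close>, hence zero.\<close>

lemma independent_on_tens:
  assumes I: "finite I" "independent_on sV I g" and K: "finite K" "independent_on sV K h"
  shows "independent_on sAs (I \<times> K) (\<lambda>(i, k). tens (g i) (h k))"
  unfolding independent_on_def
proof (intro allI impI ballI)
  fix a p assume zero: "(\<Sum>p\<in>I \<times> K. sAs (a p) (case p of (i, k) \<Rightarrow> tens (g i) (h k))) = 0" and p: "p \<in> I \<times> K"
  have coeff: "(\<Sum>k\<in>K. a (i, k) * b (h k) x) = 0" if i: "i \<in> I" for i x
  proof -
    have "0 = \<Phi> (\<Sum>p\<in>I \<times> K. sAs (a p) (case p of (i, k) \<Rightarrow> tens (g i) (h k))) x" by (simp add: zero \<Phi>_0)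
    also have "\<dots> = (\<Sum>p\<in>I \<times> K. sV (a p * b (h (snd p)) x) (g (fst p)))"
      by (auto simp: \<Phi>_sum \<Phi>_scale \<Phi>_tens intro!: sum.cong)
    also have "\<dots> = (\<Sum>i\<in>I. sV (\<Sum>k\<in>K. a (i, k) * b (h k) x) (g i))"
      by (simp add: V.scale_sum_left sum.cartesian_product case_prod_beta)
    finally show ?thesis using I(2) i unfolding independent_on_def by force
  qed
  obtain i k where ik: "p = (i, k)" "i \<in> I" "k \<in> K" using p by auto
  have "(\<Sum>k\<in>K. sV (a (i, k)) (h k)) = 0"
    by (rule nondeg) (simp add: b_sum_left b_scale_left coeff[OF ik(2)])
  then show "a p = 0" using K(2)[unfolded independent_on_def, rule_format, of "\<lambda>k. a (i, k)"] ik by simp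
qed

text \<open>The tensors of pairs from \<open>B\<close> are \<open>(card B)\<^sup>2\<close>
  independent elements of \<open>A\<^sub>s\<close>. With \<open>m = 2 * n\<close> this bounds the
  dimension of \<open>V\<close> through that of \<open>A\<close>.\<close>

lemma independent_card_bound:
  assumes "module.span sAs G = UNIV" "finite G" "card G \<le> m\<^sup>2" "\<not> V.dependent B"
  shows "finite B \<and> card B \<le> m"
proof -
  obtain C where C: "finite C" "V.span C = UNIV" using fin_dim by (elim exE conjE)
  then have finB: "finite B" using V.independent_span_bound[OF C(1) assms(4)] by simp
  let ?g = "\<lambda>(i, k). tens i k"
  have "independent_on sAs (B \<times> B) ?g"
    using independent_imp_independent_on[OF vV finB assms(4)] finB by (intro independent_on_tens) auto
  then have inj: "inj_on ?g (B \<times> B)" and ind: "A.independent (?g ` (B \<times> B))"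
    using independent_on_imp[OF vA, of "B \<times> B" ?g] finB by auto
  have "card (?g ` (B \<times> B)) \<le> card G"
    using A.independent_span_bound[OF assms(2) ind] assms(1) by simp
  then have "(card B)\<^sup>2 \<le> m\<^sup>2"
    using inj assms(3) by (simp add: card_image card_cartesian_product power2_eq_square)
  then show ?thesis using finB by (simp add: power2_le_iff_abs_le)
qed

text \<open>Since \<open>V\<close> has dimension at most the number of idempotents, the images of the idempotents are lines.\<close>

lemma idempotent_frame:
  fixes P :: "'i \<Rightarrow> 'as"
  assumes X: "finite X" and orth: "\<And>\<xi> \<zeta>. \<xi> \<in> X \<Longrightarrow> \<zeta> \<in> X \<Longrightarrow> P \<xi> * P \<zeta> = (if \<xi> = \<zeta> then P \<xi> else 0)"
    and sum: "(\<Sum>\<xi>\<in>X. P \<xi>) = 1" and nz: "\<And>\<xi>. \<xi> \<in> X \<Longrightarrow> P \<xi> \<noteq> 0"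
    and bound: "\<And>B. \<not> V.dependent B \<Longrightarrow> card B \<le> card X"
    and \<tau>: "\<And>\<xi>. \<xi> \<in> X \<Longrightarrow> \<tau> \<xi> \<in> X" "\<And>\<xi>. \<xi> \<in> X \<Longrightarrow> \<tau> (\<tau> \<xi>) = \<xi>"
    and b\<tau>: "\<And>\<xi> \<zeta> v w. \<xi> \<in> X \<Longrightarrow> \<zeta> \<in> X \<Longrightarrow> \<zeta> \<noteq> \<tau> \<xi> \<Longrightarrow> b (\<Phi> (P \<xi>) v) (\<Phi> (P \<zeta>) w) = 0"
    and \<omega>: "\<And>\<xi>. \<xi> \<in> X \<Longrightarrow> \<xi> \<in> \<omega> \<longleftrightarrow> \<tau> \<xi> \<notin> \<omega>" "\<omega> \<subseteq> X"
  shows "\<exists>u w.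
    (\<forall>\<xi>\<in>\<omega>. P \<xi> = tens (u \<xi>) (w \<xi>) \<and> P (\<tau> \<xi>) = tens (w \<xi>) (u \<xi>)) \<and>
    (\<forall>\<xi>\<in>\<omega>. \<forall>\<zeta>\<in>\<omega>. b (u \<xi>) (w \<zeta>) = (if \<xi> = \<zeta> then 1 else 0) \<and> b (u \<xi>) (u \<zeta>) = 0 \<and> b (w \<xi>) (w \<zeta>) = 0)"
proof -
  have PP: "\<Phi> (P \<xi>) (\<Phi> (P \<zeta>) v) = (if \<xi> = \<zeta> then \<Phi> (P \<xi>) v else 0)" if "\<xi> \<in> X" "\<zeta> \<in> X" for \<xi> \<zeta> v
    using orth[OF that] by (simp add: \<Phi>_0 flip: \<Phi>_mult)
  have dec: "v = (\<Sum>\<xi>\<in>X. \<Phi> (P \<xi>) v)" for v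
    using sum by (simp add: \<Phi>_1 flip: \<Phi>_sum)
  have "\<exists>v. \<Phi> (P \<xi>) v \<noteq> 0" if "\<xi> \<in> X" for \<xi>
    using nz[OF that] \<Phi>_eqI[of "P \<xi>" 0] by (auto simp: \<Phi>_0)
  then obtain c where c: "\<And>\<xi>. \<xi> \<in> X \<Longrightarrow> \<Phi> (P \<xi>) (c \<xi>) \<noteq> 0" by metis
  define e where "e \<xi> = \<Phi> (P \<xi>) (c \<xi>)" for \<xi>
  have Pe: "\<Phi> (P \<xi>) (e \<zeta>) = (if \<xi> = \<zeta> then e \<xi> else 0)" if "\<xi> \<in> X" "\<zeta> \<in> X" for \<xi> \<zeta>
    using PP[OF that] by (simp add: e_def)
  have P_sum: "\<Phi> (P \<zeta>) (\<Sum>\<xi>\<in>X. sV (a \<xi>) (e \<xi>)) = sV (a \<zeta>) (e \<zeta>)" if "\<zeta> \<in> X" for a \<zeta>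
  proof -
    have "\<Phi> (P \<zeta>) (\<Sum>\<xi>\<in>X. sV (a \<xi>) (e \<xi>)) = (\<Sum>\<xi>\<in>X. if \<xi> = \<zeta> then sV (a \<zeta>) (e \<zeta>) else 0)"
      using that by (auto simp: linear_sumD[OF \<Phi>_linear] linear_scaleD[OF \<Phi>_linear] Pe intro!: sum.cong)
    then show ?thesis using X that by simp
  qed
  have "independent_on sV X e"
    unfolding independent_on_def
  proof (intro allI impI ballI)
    fix a \<zeta> assume "(\<Sum>\<xi>\<in>X. sV (a \<xi>) (e \<xi>)) = 0" "\<zeta> \<in> X"
    then show "a \<zeta> = 0" using P_sum[of \<zeta> a] c[of \<zeta>] by (simp add: linear_0D[OF \<Phi>_linear] e_def)
  qed
  then have inj: "inj_on e X" and ind: "V.independent (e ` X)"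
    using independent_on_imp[OF vV X] by auto
  \<comment> \<open>A vector outside the span would enlarge these \<open>card X\<close> independent
    vectors beyond the bound.\<close>
  have span: "v \<in> V.span (e ` X)" for v
  proof (rule ccontr)
    assume v: "v \<notin> V.span (e ` X)"
    then have "card (insert v (e ` X)) \<le> card X" using ind by (intro bound V.independent_insertI)
    moreover have "v \<notin> e ` X" using v V.span_base by blast
    ultimately show False using X inj by (simp add: card_image)
  qed
  have line: "\<exists>a. \<Phi> (P \<xi>) v = sV a (e \<xi>)" if "\<xi> \<in> X" for \<xi> v
  proof -
    obtain r where "v = (\<Sum>y\<in>e ` X. sV (r y) y)" using span[of v] X by (auto simp: V.span_finite)
    then have "v = (\<Sum>\<xi>\<in>X. sV (r (e \<xi>)) (e \<xi>))" by (simp add: sum.reindex[OF inj])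
    then have "\<Phi> (P \<xi>) v = sV (r (e \<xi>)) (e \<xi>)" using P_sum[OF that, of "\<lambda>\<xi>. r (e \<xi>)"] by simp
    then show ?thesis by blast
  qed
  have e_P: "e \<xi> = \<Phi> (P \<xi>) (e \<xi>)" if "\<xi> \<in> X" for \<xi> using Pe that by simp
  \<comment> \<open>In the decomposition of \<open>x\<close>, the components at all points other
    than \<open>\<tau> \<xi>\<close> are orthogonal to the image of \<open>P \<xi>\<close>.\<close>
  have b_dec: "b (\<Phi> (P \<xi>) v) x = b (\<Phi> (P \<xi>) v) (\<Phi> (P (\<tau> \<xi>)) x)" if "\<xi> \<in> X" for \<xi> v x
  proof -
    have "b (\<Phi> (P \<xi>) v) x = (\<Sum>\<zeta>\<in>X. b (\<Phi> (P \<xi>) v) (\<Phi> (P \<zeta>) x))"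
      by (subst dec[of x]) (simp add: b_sum)
    also have "\<dots> = (\<Sum>\<zeta>\<in>X. if \<zeta> = \<tau> \<xi> then b (\<Phi> (P \<xi>) v) (\<Phi> (P (\<tau> \<xi>)) x) else 0)"
      using that by (intro sum.cong) (auto simp: b\<tau>)
    finally show ?thesis using X \<tau>(1)[OF that] by simp
  qed
  \<comment> \<open>Nondegeneracy provides some \<open>x\<close> with
    \<open>b (e \<xi>) x \<noteq> 0\<close>; its component at \<open>\<tau> \<xi>\<close>, rescaled,
    is the vector dual to \<open>e \<xi>\<close>.\<close>
  have "\<exists>y. \<Phi> (P (\<tau> \<xi>)) y = y \<and> b (e \<xi>) y = 1" if \<xi>: "\<xi> \<in> X" for \<xi>
  proof -
    obtain x where x: "b (e \<xi>) x \<noteq> 0" using nondeg[of "e \<xi>"] c[OF \<xi>] by (auto simp: e_def)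
    let ?y = "sV (1 / b (e \<xi>) x) (\<Phi> (P (\<tau> \<xi>)) x)"
    have "\<Phi> (P (\<tau> \<xi>)) ?y = ?y" using PP \<tau>(1)[OF \<xi>] by (simp add: linear_scaleD[OF \<Phi>_linear])
    moreover have "b (e \<xi>) ?y = 1"
      using b_dec[OF \<xi>, of "c \<xi>" x] x by (simp add: b_scale e_def)
    ultimately show ?thesis by blast
  qed
  then obtain w where w: "\<And>\<xi>. \<xi> \<in> X \<Longrightarrow> \<Phi> (P (\<tau> \<xi>)) (w \<xi>) = w \<xi>" "\<And>\<xi>. \<xi> \<in> X \<Longrightarrow> b (e \<xi>) (w \<xi>) = 1"
    by metis
  have wX: "\<xi> \<in> X" if "\<xi> \<in> \<omega>" for \<xi> using that \<omega>(2) by blast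
  show ?thesis
  proof (rule exI[of _ e], rule exI[of _ w], intro conjI ballI)
    fix \<xi> assume \<xi>: "\<xi> \<in> \<omega>"
    then have X\<xi>: "\<xi> \<in> X" "\<tau> \<xi> \<in> X" using wX \<tau> by auto
    show "P \<xi> = tens (e \<xi>) (w \<xi>)"
    proof (rule \<Phi>_eqI)
      fix x
      obtain a where a: "\<Phi> (P \<xi>) x = sV a (e \<xi>)" using line X\<xi> by blast
      have "b (w \<xi>) x = b (w \<xi>) (\<Phi> (P \<xi>) x)"
        using b_dec[OF X\<xi>(2), of "w \<xi>" x] w(1)[OF X\<xi>(1)] \<tau>(2)[OF X\<xi>(1)] by simp
      also have "\<dots> = a" using w(2)[OF X\<xi>(1)] by (simp add: a b_scale polar_sym[of q "w \<xi>"])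
      finally show "\<Phi> (P \<xi>) x = \<Phi> (tens (e \<xi>) (w \<xi>)) x" by (simp add: \<Phi>_tens a)
    qed
    show "P (\<tau> \<xi>) = tens (w \<xi>) (e \<xi>)"
    proof (rule \<Phi>_eqI)
      fix x
      obtain a where a: "\<Phi> (P (\<tau> \<xi>)) x = sV a (e (\<tau> \<xi>))" using line X\<xi> by blast
      \<comment> \<open>\<open>w \<xi>\<close> lies on the line of \<open>P (\<tau> \<xi>)\<close>,
        so it is a multiple of \<open>e (\<tau> \<xi>)\<close>, with a nonzero factor because it
        pairs to 1 with \<open>e \<xi>\<close>.\<close>
      obtain d where d: "w \<xi> = sV d (e (\<tau> \<xi>))" using line[OF X\<xi>(2), of "w \<xi>"] w(1)[OF X\<xi>(1)] by auto
      have d0: "d \<noteq> 0" using w(2)[OF X\<xi>(1)] by (auto simp: d b_0)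
      then have e: "e (\<tau> \<xi>) = sV (1 / d) (w \<xi>)" by (simp add: d)
      have "b (e \<xi>) x = b (e \<xi>) (\<Phi> (P (\<tau> \<xi>)) x)"
        using b_dec[OF X\<xi>(1), of "e \<xi>" x] e_P[OF X\<xi>(1)] by simp
      also have "\<dots> = a / d" using w(2)[OF X\<xi>(1)] by (simp add: a e b_scale)
      finally show "\<Phi> (P (\<tau> \<xi>)) x = \<Phi> (tens (w \<xi>) (e \<xi>)) x" by (simp add: \<Phi>_tens a e)
    qed
    fix \<zeta> assume \<zeta>: "\<zeta> \<in> \<omega>"
    then have X\<zeta>: "\<zeta> \<in> X" "\<tau> \<zeta> \<in> X" using wX \<tau> by auto
    have "\<zeta> \<noteq> \<tau> \<xi>" using \<xi> \<zeta> \<omega>(1)[OF X\<xi>(1)] by auto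
    then show "b (e \<xi>) (e \<zeta>) = 0" using b\<tau>[OF X\<xi>(1) X\<zeta>(1)] e_P X\<xi> X\<zeta> by metis
    have "\<tau> \<zeta> \<noteq> \<tau> (\<tau> \<xi>)" using \<xi> \<zeta> \<omega>(1)[OF X\<zeta>(1)] \<tau>(2)[OF X\<xi>(1)] by auto
    then show "b (w \<xi>) (w \<zeta>) = 0" using b\<tau>[OF X\<xi>(2) X\<zeta>(2)] w(1) X\<xi> X\<zeta> by metis
    show "b (e \<xi>) (w \<zeta>) = (if \<xi> = \<zeta> then 1 else 0)"
    proof (cases "\<xi> = \<zeta>")
      case False
      then have "\<tau> \<zeta> \<noteq> \<tau> \<xi>" using \<tau>(2) X\<xi> X\<zeta> by metis
      then show ?thesis using b\<tau>[OF X\<xi>(1) X\<zeta>(2)] e_P w(1) X\<xi> X\<zeta> False by metis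
    qed (use w(2) X\<xi> in simp)
  qed
qed

end

section \<open>Clifford algebras of quadratic spaces\<close>

lemma ideal_generated_superset: "R \<subseteq> ideal_generated R"
  by (auto simp: ideal_generated_def)

lemma tensor_algebra_quotient_relation:
  assumes "tensor_algebra_quotient s R sC c" "r \<in> multilinear_rels s 1 \<union> R"
  shows "lin_ext sC (\<lambda>w. prod_list (map c w)) r = 0"
proof -
  have "{p. lin_ext sC (\<lambda>w. prod_list (map c w)) p = 0} = ideal_generated (multilinear_rels s 1 \<union> R)"
    using assms(1) by (simp add: tensor_algebra_quotient_def Let_def)
  then show ?thesis using assms(2) ideal_generated_superset by blast
qed

lemma tensor_algebra_quotient_linear:
  assumes "vector_space s" and ta: "tensor_algebra_quotient s R sC c"
  shows "Vector_Spaces.linear s sC c"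
proof -
  have vC: "vector_space sC" using ta by (simp add: tensor_algebra_quotient_def k_algebra_vector_space)
  interpret C: vector_space sC by (rule vC)
  note \<pi> = linear_lin_ext[OF vC, of "\<lambda>w. prod_list (map c w)"]
  have "c (x + y) = c x + c y" for x y
  proof -
    have "gen ([] @ [x + y] @ []) - gen ([] @ [x] @ []) - gen ([] @ [y] @ []) \<in> multilinear_rels s 1"
      unfolding multilinear_rels_def by fastforce
    from tensor_algebra_quotient_relation[OF ta UnI1[OF this]] show ?thesis
      by (simp add: linear_diffD[OF \<pi>] linear_addD[OF \<pi>] lin_ext_single[OF vC] algebra_simps)
  qed
  moreover have "c (s k x) = sC k (c x)" for k x
  proof -
    have "gen ([] @ [s k x] @ []) - Poly_Mapping.single ([] @ [x] @ []) k \<in> multilinear_rels s 1"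
      unfolding multilinear_rels_def by fastforce
    from tensor_algebra_quotient_relation[OF ta UnI1[OF this]] show ?thesis
      by (simp add: linear_diffD[OF \<pi>] lin_ext_single[OF vC])
  qed
  ultimately show ?thesis using assms(1) vC by (simp add: Vector_Spaces.linear_iff)
qed

lemma quadratic_clifford_square:
  assumes qc: "quadratic_clifford_algebra sV q sC i"
  shows "i v * i v = sC (q v) 1"
proof -
  have ta: "tensor_algebra_quotient sV {gen [v, v] - Poly_Mapping.single [] (q v) | v. True} sC i"
    using qc by (simp add: quadratic_clifford_algebra_def)
  then have vC: "vector_space sC" by (simp add: tensor_algebra_quotient_def k_algebra_vector_space)
  interpret C: vector_space sC by (rule vC)
  note \<pi> = linear_lin_ext[OF vC, of "\<lambda>w. prod_list (map i w)"]
  have "gen [v, v] - Poly_Mapping.single [] (q v) \<in> {gen [v, v] - Poly_Mapping.single [] (q v) | v. True}" by blast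
  from tensor_algebra_quotient_relation[OF ta UnI2[OF this]] show ?thesis
    by (simp add: linear_diffD[OF \<pi>] lin_ext_single[OF vC])
qed

lemma quadratic_clifford_polar:
  assumes "vector_space sV" and qc: "quadratic_clifford_algebra sV q sC i"
  shows "i v * i w + i w * i v = sC (polar q v w) 1"
proof -
  have ta: "tensor_algebra_quotient sV {gen [v, v] - Poly_Mapping.single [] (q v) | v. True} sC i"
    using qc by (simp add: quadratic_clifford_algebra_def)
  then have vC: "vector_space sC" by (simp add: tensor_algebra_quotient_def k_algebra_vector_space)
  interpret C: vector_space sC by (rule vC)
  have "i (v + w) = i v + i w" by (rule linear_addD[OF tensor_algebra_quotient_linear[OF assms(1) ta]])
  then have "i (v + w) * i (v + w) = i v * i v + i w * i w + (i v * i w + i w * i v)"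
    by (simp add: algebra_simps)
  then show ?thesis
    by (simp add: quadratic_clifford_square[OF qc] polar_def C.scale_left_diff_distrib algebra_simps)
qed

text \<open>\<open>unit\<close> is a completeness relation. Applied to a vector it expands the
  vector in the frame, and multiplied by an element of \<open>A\<^sub>s\<close> it writes that
  element as a sum of tensors.\<close>

locale hyperbolic_frame = split_quadratic_space sAs sV \<Phi> q \<sigma>s
  for sAs :: "'s::field \<Rightarrow> 'as::ring_1 \<Rightarrow> 'as" and sV :: "'s \<Rightarrow> 'v::ab_group_add \<Rightarrow> 'v"
    and \<Phi> :: "'as \<Rightarrow> 'v \<Rightarrow> 'v" and q :: "'v \<Rightarrow> 's" and \<sigma>s :: "'as \<Rightarrow> 'as" +
  fixes \<omega> :: "'i set" and u w :: "'i \<Rightarrow> 'v"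
  assumes fin: "finite \<omega>"
    and b_uw: "\<xi> \<in> \<omega> \<Longrightarrow> \<zeta> \<in> \<omega> \<Longrightarrow> polar q (u \<xi>) (w \<zeta>) = (if \<xi> = \<zeta> then 1 else 0)"
    and b_uu: "\<xi> \<in> \<omega> \<Longrightarrow> \<zeta> \<in> \<omega> \<Longrightarrow> polar q (u \<xi>) (u \<zeta>) = 0"
    and b_ww: "\<xi> \<in> \<omega> \<Longrightarrow> \<zeta> \<in> \<omega> \<Longrightarrow> polar q (w \<xi>) (w \<zeta>) = 0"
    and q_u: "\<xi> \<in> \<omega> \<Longrightarrow> q (u \<xi>) = 0" and q_w: "\<xi> \<in> \<omega> \<Longrightarrow> q (w \<xi>) = 0"
    and unit: "(\<Sum>\<xi>\<in>\<omega>. vtens sV q \<Phi> (u \<xi>) (w \<xi>) + vtens sV q \<Phi> (w \<xi>) (u \<xi>)) = 1"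
begin

lemma b_wu: "\<xi> \<in> \<omega> \<Longrightarrow> \<zeta> \<in> \<omega> \<Longrightarrow> b (w \<xi>) (u \<zeta>) = (if \<xi> = \<zeta> then 1 else 0)"
  using b_uw[of \<zeta> \<xi>] by (simp add: polar_sym[of q "w \<xi>"])

lemma V_expand: "x = (\<Sum>\<xi>\<in>\<omega>. sV (b (w \<xi>) x) (u \<xi>) + sV (b (u \<xi>) x) (w \<xi>))"
proof -
  have "x = \<Phi> (\<Sum>\<xi>\<in>\<omega>. tens (u \<xi>) (w \<xi>) + tens (w \<xi>) (u \<xi>)) x" by (simp add: unit \<Phi>_1)
  then show ?thesis by (simp add: \<Phi>_sum \<Phi>_add \<Phi>_tens)
qed

lemma A_expand: "x = (\<Sum>\<xi>\<in>\<omega>. tens (\<Phi> x (u \<xi>)) (w \<xi>) + tens (\<Phi> x (w \<xi>)) (u \<xi>))"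
proof -
  have "x = x * (\<Sum>\<xi>\<in>\<omega>. tens (u \<xi>) (w \<xi>) + tens (w \<xi>) (u \<xi>))" by (simp add: unit)
  then show ?thesis by (simp add: sum_distrib_left distrib_left mult_tens)
qed

text \<open>The left factor is the projection of \<open>V\<close> onto the span of the
  \<open>u \<xi>\<close> along the span of the \<open>w \<xi>\<close>, so the condition says that
  the endomorphism \<open>x\<close> has its image in the span of the \<open>u \<xi>\<close>.\<close>

definition ideal :: "'as set" where
  "ideal = {x. (\<Sum>\<xi>\<in>\<omega>. tens (u \<xi>) (w \<xi>)) * x = x}"

lemma ideal_expand: "x \<in> ideal \<Longrightarrow> x = (\<Sum>\<xi>\<in>\<omega>. tens (u \<xi>) (\<Phi> (\<sigma>s x) (w \<xi>)))"
  by (simp add: ideal_def sum_distrib_right tens_mult)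

lemma tens_in_ideal:
  assumes "\<xi> \<in> \<omega>"
  shows "tens (u \<xi>) v \<in> ideal"
proof -
  have "\<Phi> (\<Sum>\<zeta>\<in>\<omega>. tens (u \<zeta>) (w \<zeta>)) (u \<xi>) = (\<Sum>\<zeta>\<in>\<omega>. if \<zeta> = \<xi> then u \<xi> else 0)"
    using assms by (auto simp: \<Phi>_sum \<Phi>_tens b_wu intro!: sum.cong)
  then show ?thesis using assms fin by (simp add: ideal_def mult_tens)
qed

text \<open>The involution exchanges the tensor factors and thus puts the \<open>u \<xi>\<close> in
  the second place, the one that the bimodule map sends to the Clifford algebra. This is where the
  conditions \<open>i (u \<xi>) * x = 0\<close> come from.\<close>

lemma \<sigma>s_ideal: "x \<in> ideal \<Longrightarrow> \<sigma>s x = (\<Sum>\<xi>\<in>\<omega>. tens (\<Phi> (\<sigma>s x) (w \<xi>)) (u \<xi>))"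
  using ideal_expand[of x] linear_sumD[OF \<sigma>s_lin] \<sigma>s_tens by (metis (no_types, lifting) sum.cong)

definition basis :: "'i \<times> bool \<Rightarrow> 'v" where
  "basis = (\<lambda>(\<xi>, s). if s then u \<xi> else w \<xi>)"

section \<open>Dimension and isotropy of the ideal\<close>

lemma sum_basis: "(\<Sum>p\<in>\<omega> \<times> UNIV. f p (basis p)) = (\<Sum>\<xi>\<in>\<omega>. f (\<xi>, True) (u \<xi>) + f (\<xi>, False) (w \<xi>))"
proof -
  have "(\<Sum>p\<in>\<omega> \<times> UNIV. f p (basis p)) = (\<Sum>\<xi>\<in>\<omega>. \<Sum>s\<in>UNIV. f (\<xi>, s) (basis (\<xi>, s)))"
    by (simp add: sum.cartesian_product case_prod_beta)
  then show ?thesis by (simp add: basis_def UNIV_bool add.commute)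
qed

lemma basis_independent: "independent_on sV (\<omega> \<times> UNIV) basis"
  unfolding independent_on_def
proof (intro allI impI ballI)
  fix a p assume zero: "(\<Sum>p\<in>\<omega> \<times> UNIV. sV (a p) (basis p)) = 0" and p: "p \<in> \<omega> \<times> (UNIV :: bool set)"
  obtain \<xi> s where ps: "p = (\<xi>, s)" "\<xi> \<in> \<omega>" using p by auto
  have z: "(\<Sum>\<xi>\<in>\<omega>. sV (a (\<xi>, True)) (u \<xi>) + sV (a (\<xi>, False)) (w \<xi>)) = 0"
    using zero unfolding sum_basis[of "\<lambda>p. sV (a p)"] .
  have "0 = b (w \<xi>) (\<Sum>\<xi>\<in>\<omega>. sV (a (\<xi>, True)) (u \<xi>) + sV (a (\<xi>, False)) (w \<xi>))"
    by (simp add: z b_0)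
  also have "\<dots> = (\<Sum>\<zeta>\<in>\<omega>. if \<zeta> = \<xi> then a (\<xi>, True) else 0)"
    using ps(2) by (auto simp: b_sum b_add b_scale b_wu b_ww intro!: sum.cong)
  finally have t: "a (\<xi>, True) = 0" using fin ps(2) by simp
  have "0 = b (u \<xi>) (\<Sum>\<xi>\<in>\<omega>. sV (a (\<xi>, True)) (u \<xi>) + sV (a (\<xi>, False)) (w \<xi>))"
    by (simp add: z b_0)
  also have "\<dots> = (\<Sum>\<zeta>\<in>\<omega>. if \<zeta> = \<xi> then a (\<xi>, False) else 0)"
    using ps(2) by (auto simp: b_sum b_add b_scale b_uu b_uw intro!: sum.cong)
  finally have f: "a (\<xi>, False) = 0" using fin ps(2) by simp
  show "a p = 0" using t f ps(1) by (cases s) auto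
qed

lemma u_independent: "independent_on sV \<omega> u"
  unfolding independent_on_def
proof (intro allI impI ballI)
  fix a \<xi> assume z: "(\<Sum>\<xi>\<in>\<omega>. sV (a \<xi>) (u \<xi>)) = 0" and \<xi>: "\<xi> \<in> \<omega>"
  have "0 = b (w \<xi>) (\<Sum>\<xi>\<in>\<omega>. sV (a \<xi>) (u \<xi>))" by (simp add: z b_0)
  also have "\<dots> = (\<Sum>\<zeta>\<in>\<omega>. if \<zeta> = \<xi> then a \<xi> else 0)"
    using \<xi> by (auto simp: b_sum b_scale b_wu intro!: sum.cong)
  finally show "a \<xi> = 0" using fin \<xi> by simp
qed

lemma dim_ideal: "vector_space.dim sAs ideal = 2 * (card \<omega>)\<^sup>2"
proof -
  let ?I = "\<omega> \<times> (\<omega> \<times> (UNIV :: bool set))" and ?g = "\<lambda>(\<xi>, p). tens (u \<xi>) (basis p)"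
  have "independent_on sAs ?I ?g"
    using fin u_independent basis_independent by (intro independent_on_tens) auto
  then have inj: "inj_on ?g ?I" and ind: "A.independent (?g ` ?I)"
    using independent_on_imp[OF vA, of ?I ?g] fin by auto
  have "?g ` ?I \<subseteq> ideal" using tens_in_ideal by auto
  moreover have "ideal \<subseteq> A.span (?g ` ?I)"
  proof
    fix x assume "x \<in> ideal"
    have "tens (u \<xi>) v \<in> A.span (?g ` ?I)" if \<xi>: "\<xi> \<in> \<omega>" for \<xi> v
    proof -
      have base: "tens (u \<xi>) (u \<zeta>) \<in> A.span (?g ` ?I)" "tens (u \<xi>) (w \<zeta>) \<in> A.span (?g ` ?I)" if "\<zeta> \<in> \<omega>" for \<zeta>
      proof -
        have "tens (u \<xi>) (u \<zeta>) \<in> ?g ` ?I"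
          by (rule image_eqI[of _ _ "(\<xi>, \<zeta>, True)"]) (use \<xi> that in \<open>simp_all add: basis_def\<close>)
        moreover have "tens (u \<xi>) (w \<zeta>) \<in> ?g ` ?I"
          by (rule image_eqI[of _ _ "(\<xi>, \<zeta>, False)"]) (use \<xi> that in \<open>simp_all add: basis_def\<close>)
        ultimately show "tens (u \<xi>) (u \<zeta>) \<in> A.span (?g ` ?I)" "tens (u \<xi>) (w \<zeta>) \<in> A.span (?g ` ?I)"
          by (simp_all only: A.span_base)
      qed
      have "tens (u \<xi>) v = tens (u \<xi>) (\<Sum>\<zeta>\<in>\<omega>. sV (b (w \<zeta>) v) (u \<zeta>) + sV (b (u \<zeta>) v) (w \<zeta>))"
        using V_expand[of v] by simp
      also have "\<dots> \<in> A.span (?g ` ?I)"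
        using base by (auto simp: linear_sumD[OF tens_linear_right] linear_addD[OF tens_linear_right]
            linear_scaleD[OF tens_linear_right] intro!: A.span_sum A.span_add A.span_scale)
      finally show ?thesis .
    qed
    then show "x \<in> A.span (?g ` ?I)"
      by (subst ideal_expand[OF \<open>x \<in> ideal\<close>]) (auto intro!: A.span_sum)
  qed
  ultimately have "A.dim ideal = card (?g ` ?I)"
    using ind by (intro A.dim_unique) auto
  also have "\<dots> = 2 * (card \<omega>)\<^sup>2"
    using inj by (simp add: card_image card_cartesian_product power2_eq_square)
  finally show ?thesis .
qed

text \<open>The element \<open>a\<close> stands for \<open>\<epsilon>(l)\<close> with
  \<open>l + \<sigma>L l = 1\<close>; it acts diagonally on the \<open>u \<xi>\<close>. For
  symmetric \<open>x\<close> in the ideal, \<open>a * x\<close> is a sum of tensors of multiples of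
  \<open>u \<xi>\<close> with \<open>\<Phi> x (w \<xi>)\<close>. Its trace vanishes because
  \<open>\<Phi> x (w \<xi>)\<close> lies in the totally isotropic span of the
  \<open>u \<xi>\<close>.\<close>

lemma ideal_isotropic:
  assumes fs: "\<And>x. \<sigma>s x = x \<Longrightarrow> fs x = trace (a * x)"
    and eigen: "\<And>\<xi>. \<xi> \<in> \<omega> \<Longrightarrow> \<Phi> a (u \<xi>) = sV (\<alpha> \<xi>) (u \<xi>)"
  shows "ideal \<in> isotropic_ideals sAs (card \<omega>) \<sigma>s fs"
proof -
  have "right_ideal ideal"
    by (auto simp: right_ideal_def ideal_def distrib_left) (simp flip: mult.assoc)
  moreover have "\<sigma>s x * y = 0" if "x \<in> ideal" "y \<in> ideal" for x y
  proof -
    have "\<sigma>s x * y = (\<Sum>\<xi>\<in>\<omega>. tens (\<Phi> (\<sigma>s x) (w \<xi>)) (u \<xi>)) * (\<Sum>\<zeta>\<in>\<omega>. tens (u \<zeta>) (\<Phi> (\<sigma>s y) (w \<zeta>)))"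
      using \<sigma>s_ideal[OF that(1)] ideal_expand[OF that(2)] by simp
    also have "\<dots> = 0"
      by (auto simp: sum_product tens_mult_tens b_uu intro!: sum.neutral)
    finally show ?thesis .
  qed
  moreover have "fs x = 0" if x: "x \<in> ideal" "\<sigma>s x = x" for x
  proof -
    have xw: "b (\<Phi> x v) (u \<xi>) = 0" if "\<xi> \<in> \<omega>" for \<xi> v
    proof -
      have "\<Phi> x v = \<Phi> (\<Sum>\<zeta>\<in>\<omega>. tens (u \<zeta>) (w \<zeta>)) (\<Phi> x v)" using x(1) by (simp add: ideal_def flip: \<Phi>_mult)
      also have "\<dots> = (\<Sum>\<zeta>\<in>\<omega>. sV (b (w \<zeta>) (\<Phi> x v)) (u \<zeta>))" by (simp add: \<Phi>_sum \<Phi>_tens)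
      finally have "b (\<Phi> x v) (u \<xi>) = b (\<Sum>\<zeta>\<in>\<omega>. sV (b (w \<zeta>) (\<Phi> x v)) (u \<zeta>)) (u \<xi>)" by simp
      then show ?thesis using that by (simp add: b_sum_left b_scale_left b_uu)
    qed
    have "a * x = (\<Sum>\<xi>\<in>\<omega>. tens (sV (\<alpha> \<xi>) (u \<xi>)) (\<Phi> x (w \<xi>)))"
      using arg_cong[OF ideal_expand[OF x(1)], of "\<lambda>x. a * x"]
      by (simp add: sum_distrib_left mult_tens eigen x(2))
    then show ?thesis
      by (simp add: fs[OF x(2)] linear_sumD[OF trace_linear] trace_tens b_scale xw)
  qed
  ultimately show ?thesis by (simp add: isotropic_ideals_def dim_ideal)
qed

context
  fixes sCl :: "'s \<Rightarrow> 'cl::ring_1 \<Rightarrow> 'cl" and i :: "'v \<Rightarrow> 'cl"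
  assumes qc: "quadratic_clifford_algebra sV q sCl i"
begin

lemma kCl: "k_algebra sCl"
  using qc by (simp add: quadratic_clifford_algebra_def tensor_algebra_quotient_def)

interpretation Cl: k_algebra sCl by (rule kCl)

lemma i_linear: "Vector_Spaces.linear sV sCl i"
  using qc tensor_algebra_quotient_linear[OF vV] by (auto simp: quadratic_clifford_algebra_def)

lemma i_uw: "\<xi> \<in> \<omega> \<Longrightarrow> i (u \<xi>) * i (w \<xi>) + i (w \<xi>) * i (u \<xi>) = 1"
  by (simp add: quadratic_clifford_polar[OF vV qc] b_uw)

lemma i_uu: "\<xi> \<in> \<omega> \<Longrightarrow> i (u \<xi>) * i (u \<xi>) = 0"
  by (simp add: quadratic_clifford_square[OF qc] q_u)

text \<open>An enumeration of \<omega> turns the frame into \<open>hyperbolic_pairs\<close>; the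
  frame expansion of vectors shows that every \<open>i v\<close> lies in the span of the generators
  used there.\<close>

lemma annihilator_basis:
  assumes "card \<omega> \<ge> 1"
  obtains W where "Cl.independent W" "card W = 2 ^ (card \<omega> - 1)" "finite W"
    "{z \<in> clifford_even sCl i. \<forall>\<xi>\<in>\<omega>. i (u \<xi>) * z = 0} = Cl.span W"
proof -
  let ?n = "card \<omega>"
  obtain h where h: "bij_betw h {..<?n} \<omega>"
    using ex_bij_betw_nat_finite[OF fin] by (auto simp: atLeast0LessThan)
  have hin: "h k \<in> \<omega>" if "k < ?n" for k using h that by (auto simp: bij_betw_def)
  have hinj: "h k = h l \<longleftrightarrow> k = l" if "k < ?n" "l < ?n" for k l
    using h that by (auto simp: bij_betw_def inj_on_eq_iff)
  have anti: "i x * i y = - (i y * i x)" if "b x y = 0" for x y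
    using quadratic_clifford_polar[OF vV qc, of x y] that by (simp add: eq_neg_iff_add_eq_0)
  interpret H: hyperbolic_pairs ?n "\<lambda>k. i (u (h k))" "\<lambda>k. i (w (h k))"
    by unfold_locales
      (auto intro!: anti simp: quadratic_clifford_square[OF qc] q_u q_w hin i_uw b_uu b_ww b_uw hinj)
  have reindex: "(\<lambda>k. g (h k)) ` {..<?n} = g ` \<omega>" for g :: "'i \<Rightarrow> 'cl"
    using h by (metis bij_betw_imp_surj_on image_image)
  have "i v \<in> Cl.span ((\<lambda>k. i (u (h k))) ` {..<?n} \<union> (\<lambda>k. i (w (h k))) ` {..<?n})" for v
  proof -
    have "i v = (\<Sum>\<xi>\<in>\<omega>. sCl (b (w \<xi>) v) (i (u \<xi>)) + sCl (b (u \<xi>) v) (i (w \<xi>)))"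
      using arg_cong[OF V_expand[of v], of i]
      by (simp add: linear_sumD[OF i_linear] linear_addD[OF i_linear] linear_scaleD[OF i_linear])
    then show ?thesis unfolding reindex[of "\<lambda>\<xi>. i (u \<xi>)"] reindex[of "\<lambda>\<xi>. i (w \<xi>)"]
      by (auto intro!: Cl.span_sum Cl.span_add Cl.span_scale intro: Cl.span_base)
  qed
  then have "{z \<in> Cl.span {prod_list vs | vs. set vs \<subseteq> range i \<and> even (length vs)}. \<forall>k<?n. i (u (h k)) * z = 0}
      = Cl.span (H.weights True)"
    by (intro H.annihilator_eq_span_weights[OF kCl]) auto
  moreover have "{prod_list vs | vs. set vs \<subseteq> range i \<and> even (length vs)} = {prod_list (map i vs) | vs. even (length vs)}"
  proof -
    have "set vs \<subseteq> range i \<longleftrightarrow> (\<exists>xs. vs = map i xs)" for vs by (auto simp: ex_map_conv image_iff)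
    then show ?thesis by auto
  qed
  moreover have "(\<forall>k<?n. i (u (h k)) * z = 0) \<longleftrightarrow> (\<forall>\<xi>\<in>\<omega>. i (u \<xi>) * z = 0)" for z
    using h hin by (metis bij_betw_iff_bijections lessThan_iff)
  ultimately have "{z \<in> clifford_even sCl i. \<forall>\<xi>\<in>\<omega>. i (u \<xi>) * z = 0} = Cl.span (H.weights True)"
    by (simp add: clifford_even_def)
  then show ?thesis using that H.weights_basis[OF kCl assms] by blast
qed

end

end

section \<open>The Clifford bimodule\<close>

lemma odd_mult_even:
  assumes kC: "k_algebra sC" and x: "x \<in> clifford_odd sC i" and y: "y \<in> clifford_even sC i"
  shows "x * y \<in> clifford_odd sC i"
proof -
  interpret k_algebra sC by (rule kC)
  have *: "prod_list (map i vs) * y \<in> clifford_odd sC i" if vs: "odd (length vs)" for vs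
    using y unfolding clifford_even_def clifford_odd_def
  proof (induction rule: span_induct_alt)
    case (step c z z')
    then obtain ws where ws: "z = prod_list (map i ws)" "even (length ws)" by auto
    have "prod_list (map i vs) * z = prod_list (map i (vs @ ws))" by (simp add: ws(1))
    moreover have "odd (length (vs @ ws))" using vs ws(2) by simp
    ultimately have "prod_list (map i vs) * z \<in> span {prod_list (map i vs) | vs. odd (length vs)}"
      by (intro span_base) blast
    then show ?case using step by (simp add: distrib_left span_add span_scale flip: scale_mult_right)
  qed (simp add: span_zero)
  show ?thesis using x unfolding clifford_odd_def
  proof (induction rule: span_induct_alt)
    case (step c z z')
    then have "z * y \<in> span {prod_list (map i vs) | vs. odd (length vs)}"
      using * by (auto simp: clifford_odd_def)
    then show ?case using step by (simp add: distrib_right span_add span_scale flip: scale_mult_left)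
  qed (simp add: span_zero)
qed

definition bilinear_on ::
  "('k::field \<Rightarrow> 'm::ab_group_add \<Rightarrow> 'm) \<Rightarrow> ('k \<Rightarrow> 'n::ab_group_add \<Rightarrow> 'n) \<Rightarrow> 'n set \<Rightarrow>
   ('k \<Rightarrow> 'w::ab_group_add \<Rightarrow> 'w) \<Rightarrow> ('m \<Rightarrow> 'n \<Rightarrow> 'w) \<Rightarrow> bool" where
  "bilinear_on sM sN N sW h \<longleftrightarrow>
     (\<forall>x x' y. y \<in> N \<longrightarrow> h (x + x') y = h x y + h x' y) \<and>
     (\<forall>x y y'. y \<in> N \<longrightarrow> y' \<in> N \<longrightarrow> h x (y + y') = h x y + h x y') \<and>
     (\<forall>c x y. y \<in> N \<longrightarrow> h (sM c x) y = sW c (h x y)) \<and>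
     (\<forall>c x y. y \<in> N \<longrightarrow> h x (sN c y) = sW c (h x y))"

section \<open>Universal property of the tensor product underlying the bimodule\<close>

lemma tensor_product_lift:
  assumes tp: "tensor_product sM UNIV sN N sT t" and vW: "vector_space sW" and h: "bilinear_on sM sN N sW h"
  shows "\<exists>G. Vector_Spaces.linear sT sW G \<and> (\<forall>x. \<forall>y\<in>N. G (t x y) = h x y)"
proof -
  interpret W: vector_space sW by (rule vW)
  note hl = linear_lin_ext[OF vW, of "\<lambda>(x, y). h x y"]
  have "lin_ext sW (\<lambda>(x, y). h x y) r = 0" if "r \<in> bilinear_rels sM UNIV sN N" for r
    using that h unfolding bilinear_rels_def bilinear_on_def
    by (auto simp: linear_diffD[OF hl] lin_ext_single[OF vW])
  then obtain G where "Vector_Spaces.linear sT sW G" "\<forall>p\<in>UNIV \<times> N. G ((\<lambda>(x, y). t x y) p) = (\<lambda>(x, y). h x y) p"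
    using presents_space_lift[OF tp[unfolded tensor_product_def] vW, of "\<lambda>(x, y). h x y"] by blast
  then show ?thesis by (intro exI[of _ G]) auto
qed

lemma tensor_product_bilinear:
  assumes tp: "tensor_product sM UNIV sN N sT t"
  shows "bilinear_on sM sN N sT t"
proof -
  have vT: "vector_space sT" and ker: "{p. Poly_Mapping.keys p \<subseteq> UNIV \<times> N \<and> lin_ext sT (\<lambda>(x, y). t x y) p = 0}
      = module.span pm_scale (bilinear_rels sM UNIV sN N)"
    using tp by (auto simp: tensor_product_def presents_space_def)
  interpret T: vector_space sT by (rule vT)
  interpret P: vector_space pm_scale by (rule vector_space_pm_scale)
  note hl = linear_lin_ext[OF vT, of "\<lambda>(x, y). t x y"]
  have zero: "lin_ext sT (\<lambda>(x, y). t x y) r = 0" if "r \<in> bilinear_rels sM UNIV sN N" for r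
    using that ker P.span_base by blast
  show ?thesis unfolding bilinear_on_def
  proof (intro conjI allI impI)
    fix x x' y assume "y \<in> N"
    then have "gen (x + x', y) - gen (x, y) - gen (x', y) \<in> bilinear_rels sM UNIV sN N"
      unfolding bilinear_rels_def by blast
    from zero[OF this] show "t (x + x') y = t x y + t x' y"
      by (simp add: linear_diffD[OF hl] linear_addD[OF hl] lin_ext_single[OF vT] algebra_simps)
  next
    fix x y y' assume "y \<in> N" "y' \<in> N"
    then have "gen (x, y + y') - gen (x, y) - gen (x, y') \<in> bilinear_rels sM UNIV sN N"
      unfolding bilinear_rels_def by blast
    from zero[OF this] show "t x (y + y') = t x y + t x y'"
      by (simp add: linear_diffD[OF hl] linear_addD[OF hl] lin_ext_single[OF vT] algebra_simps)
  next
    fix c x y assume "y \<in> N"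
    then have "gen (sM c x, y) - Poly_Mapping.single (x, y) c \<in> bilinear_rels sM UNIV sN N"
      unfolding bilinear_rels_def by blast
    from zero[OF this] show "t (sM c x) y = sT c (t x y)"
      by (simp add: linear_diffD[OF hl] lin_ext_single[OF vT])
  next
    fix c x y assume "y \<in> N"
    then have "gen (x, sN c y) - Poly_Mapping.single (x, y) c \<in> bilinear_rels sM UNIV sN N"
      unfolding bilinear_rels_def by blast
    from zero[OF this] show "t x (sN c y) = sT c (t x y)"
      by (simp add: linear_diffD[OF hl] lin_ext_single[OF vT])
  qed
qed

lemma tensor_product_span:
  assumes "tensor_product sM UNIV sN N sT t"
  shows "module.span sT ((\<lambda>(x, y). t x y) ` (UNIV \<times> N)) = UNIV"
  using assms unfolding tensor_product_def by (rule presents_space_span)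

text \<open>Apply the map \<phi> \<otimes> id to the tensor, where \<phi> is a functional with
  \<open>\<phi> x = 1\<close>.\<close>

lemma tensor_product_nonzero:
  assumes tp: "tensor_product sM UNIV sN N sT t" and vM: "vector_space sM" and vN: "vector_space sN"
    and "y \<in> N" "x \<noteq> 0" "t x y = 0"
  shows "y = 0"
proof -
  interpret M: vector_space sM by (rule vM)
  interpret N: vector_space sN by (rule vN)
  obtain \<phi> where \<phi>: "Vector_Spaces.linear sM (*) \<phi>" "\<phi> x = 1"
    using functional_separating[OF vM M.subspace_single_0, of x] \<open>x \<noteq> 0\<close> by (metis singletonD)
  have "bilinear_on sM sN N sN (\<lambda>x y. sN (\<phi> x) y)"
    by (auto simp: bilinear_on_def linear_addD[OF \<phi>(1)] linear_scaleD[OF \<phi>(1)] N.scale_left_distrib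
        N.scale_right_distrib mult.commute)
  then obtain G where G: "Vector_Spaces.linear sT sN G" "\<And>x y. y \<in> N \<Longrightarrow> G (t x y) = sN (\<phi> x) y"
    using tensor_product_lift[OF tp vN, of "\<lambda>x y. sN (\<phi> x) y"] by auto
  have "y = G (t x y)" by (simp add: G(2) \<open>y \<in> N\<close> \<phi>(2))
  then show ?thesis using \<open>t x y = 0\<close> linear_0D[OF G(1)] by simp
qed

section \<open>The map \<psi> at the ideal of a frame\<close>

context hyperbolic_frame
begin

context
  fixes sCl :: "'s \<Rightarrow> 'cl::ring_1 \<Rightarrow> 'cl" and i :: "'v \<Rightarrow> 'cl"
    and sB :: "'s \<Rightarrow> 'b::ab_group_add \<Rightarrow> 'b" and tB :: "'v \<Rightarrow> 'cl \<Rightarrow> 'b"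
  assumes qc: "quadratic_clifford_algebra sV q sCl i"
    and tp: "tensor_product sV UNIV sCl (clifford_odd sCl i) sB tB"
begin

interpretation Cl: k_algebra sCl by (rule kCl[OF qc])

lemma vB: "vector_space sB"
  using tp by (simp add: tensor_product_def presents_space_def)

lemma i_odd: "i v \<in> clifford_odd sCl i"
  unfolding clifford_odd_def by (rule Cl.span_base) (auto intro: exI[of _ "[v]"])

lemma tB_add_left: "z \<in> clifford_odd sCl i \<Longrightarrow> tB (v + v') z = tB v z + tB v' z"
  and tB_add_right: "z \<in> clifford_odd sCl i \<Longrightarrow> z' \<in> clifford_odd sCl i \<Longrightarrow> tB v (z + z') = tB v z + tB v z'"
  and tB_scale_left: "z \<in> clifford_odd sCl i \<Longrightarrow> tB (sV c v) z = sB c (tB v z)"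
  and tB_scale_right: "z \<in> clifford_odd sCl i \<Longrightarrow> tB v (sCl c z) = sB c (tB v z)"
  using tensor_product_bilinear[OF tp] by (auto simp: bilinear_on_def)

lemma tB_i_linear: "Vector_Spaces.linear sV sB (\<lambda>w. tB v (i w))"
  by (simp add: Vector_Spaces.linear_iff vV vB linear_addD[OF i_linear[OF qc]] linear_scaleD[OF i_linear[OF qc]]
      tB_add_right tB_scale_right i_odd)

lemma tens_span: "A.span ((\<lambda>(v, w). tens v w) ` UNIV) = UNIV"
proof -
  have "x \<in> A.span ((\<lambda>(v, w). tens v w) ` UNIV)" for x
  proof -
    have t: "tens v w' \<in> A.span ((\<lambda>(v, w). tens v w) ` UNIV)" for v w'
      by (rule A.span_base) (auto intro: image_eqI[of _ _ "(v, w')"])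
    show ?thesis by (subst A_expand[of x]) (intro A.span_sum A.span_add t)
  qed
  then show ?thesis by blast
qed

abbreviation "bmap \<equiv> bimodule_map sAs sV q \<Phi> i sB tB"

text \<open>The map \<open>G\<close> is what \<open>A_expand\<close> forces on a linear map sending
  \<open>v \<otimes> x\<close> to \<open>tB v (i x)\<close>. It is visibly linear, and expanding
  \<open>x\<close> in the frame shows that it has these values on all tensors.\<close>

lemma
  shows bimodule_map_linear: "Vector_Spaces.linear sAs sB (bmap)"
    and bimodule_map_tens: "bmap (tens v x) = tB v (i x)"
proof -
  define G where "G x = (\<Sum>\<xi>\<in>\<omega>. tB (\<Phi> x (u \<xi>)) (i (w \<xi>)) + tB (\<Phi> x (w \<xi>)) (i (u \<xi>)))" for x
  interpret B: vector_space sB by (rule vB)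
  have "G (x + y) = G x + G y" for x y
    by (simp add: G_def \<Phi>_add tB_add_left i_odd sum.distrib algebra_simps)
  moreover have "G (sAs c x) = sB c (G x)" for c x
    by (simp add: G_def \<Phi>_scale tB_scale_left i_odd B.scale_sum_right B.scale_right_distrib)
  ultimately have G: "Vector_Spaces.linear sAs sB G" by (simp add: Vector_Spaces.linear_iff vA vB)
  have Gt: "G (tens v x) = tB v (i x)" for v x
  proof -
    have "tB v (i x) = tB v (i (\<Sum>\<xi>\<in>\<omega>. sV (b (w \<xi>) x) (u \<xi>) + sV (b (u \<xi>) x) (w \<xi>)))"
      using V_expand[of x] by simp
    also have "\<dots> = (\<Sum>\<xi>\<in>\<omega>. sB (b (w \<xi>) x) (tB v (i (u \<xi>))) + sB (b (u \<xi>) x) (tB v (i (w \<xi>))))"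
      by (simp add: linear_sumD[OF tB_i_linear] linear_addD[OF tB_i_linear] linear_scaleD[OF tB_i_linear])
    also have "\<dots> = G (tens v x)"
      by (simp add: G_def \<Phi>_tens tB_scale_left i_odd polar_sym[of q x] add.commute)
    finally show ?thesis by simp
  qed
  have "bmap y = G y" for y
    unfolding bimodule_map_def by (rule induced_eq[OF G]) (use Gt tens_span in auto)
  then have "bmap = G" by (rule ext)
  then show "Vector_Spaces.linear sAs sB (bmap)"
    and "bmap (tens v x) = tB v (i x)" using G Gt by auto
qed

lemma
  assumes x: "x \<in> clifford_even sCl i"
  shows bimodule_act_linear: "Vector_Spaces.linear sB sB (\<lambda>y. bimodule_act sCl i sB tB y x)"
    and bimodule_act_tensor: "z \<in> clifford_odd sCl i \<Longrightarrow> bimodule_act sCl i sB tB (tB v z) x = tB v (z * x)"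
proof -
  have odd: "z * x \<in> clifford_odd sCl i" if "z \<in> clifford_odd sCl i" for z
    by (rule odd_mult_even[OF kCl[OF qc] that x])
  have "bilinear_on sV sCl (clifford_odd sCl i) sB (\<lambda>v z. tB v (z * x))"
    by (simp add: bilinear_on_def odd tB_add_left tB_scale_left tB_add_right tB_scale_right distrib_right
        flip: Cl.scale_mult_left)
  then obtain G where G: "Vector_Spaces.linear sB sB G" "\<And>v z. z \<in> clifford_odd sCl i \<Longrightarrow> G (tB v z) = tB v (z * x)"
    using tensor_product_lift[OF tp vB, of "\<lambda>v z. tB v (z * x)"] by auto
  have act: "bimodule_act sCl i sB tB y x = G y" for y
    unfolding bimodule_act_def by (rule induced_eq[OF G(1)]) (use G(2) tensor_product_span[OF tp] in auto)
  show "Vector_Spaces.linear sB sB (\<lambda>y. bimodule_act sCl i sB tB y x)"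
    and "z \<in> clifford_odd sCl i \<Longrightarrow> bimodule_act sCl i sB tB (tB v z) x = tB v (z * x)"
    using G by (auto simp: act)
qed

text \<open>For one inclusion, test with \<open>tens (u \<xi>) (u \<xi>)\<close>, which lies in the
  ideal and is fixed by \<open>\<sigma>s\<close>: it gives
  \<open>tB (u \<xi>) (i (u \<xi>) * \<Psi> x) = 0\<close> with \<open>u \<xi> \<noteq> 0\<close>.
  The other inclusion follows from \<open>\<sigma>s_ideal\<close>.\<close>

lemma psi_ideal:
  assumes \<Psi>: "\<And>x. \<Psi> x \<in> clifford_even sCl i"
  shows "psi sAs sV q \<Phi> \<sigma>s sCl i \<Psi> sB tB ideal = {x. \<forall>\<xi>\<in>\<omega>. i (u \<xi>) * \<Psi> x = 0}"
proof -
  let ?J = "psi sAs sV q \<Phi> \<sigma>s sCl i \<Psi> sB tB ideal"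
  let ?act = "bimodule_act sCl i sB tB"
  have act: "?act (bmap (tens v v')) (\<Psi> x) = tB v (i v' * \<Psi> x)" for v v' x
    by (simp add: bimodule_map_tens bimodule_act_tensor[OF \<Psi>] i_odd)
  have tB0: "tB v 0 = 0" for v using linear_0D[OF tB_i_linear, of v] linear_0D[OF i_linear[OF qc]] by simp
  show ?thesis
  proof (intro set_eqI iffI)
    fix x assume "x \<in> ?J"
    then have *: "?act (bmap (\<sigma>s y)) (\<Psi> x) = 0" if "y \<in> ideal" for y using that by (simp add: psi_def)
    have "i (u \<xi>) * \<Psi> x = 0" if \<xi>: "\<xi> \<in> \<omega>" for \<xi>
    proof (rule tensor_product_nonzero[OF tp vV Cl.vector_space_axioms])
      show "i (u \<xi>) * \<Psi> x \<in> clifford_odd sCl i" by (rule odd_mult_even[OF kCl[OF qc] i_odd \<Psi>])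
      show "u \<xi> \<noteq> 0" using b_uw[OF \<xi> \<xi>] by (auto simp: b_0_left)
      show "tB (u \<xi>) (i (u \<xi>) * \<Psi> x) = 0"
        using *[OF tens_in_ideal[OF \<xi>], of "u \<xi>"] by (simp add: \<sigma>s_tens act)
    qed
    then show "x \<in> {x. \<forall>\<xi>\<in>\<omega>. i (u \<xi>) * \<Psi> x = 0}" by simp
  next
    fix x assume x: "x \<in> {x. \<forall>\<xi>\<in>\<omega>. i (u \<xi>) * \<Psi> x = 0}"
    have "?act (bmap (\<sigma>s y)) (\<Psi> x) = 0" if "y \<in> ideal" for y
    proof -
      have "?act (bmap (\<sigma>s y)) (\<Psi> x) = ?act (bmap (\<Sum>\<xi>\<in>\<omega>. tens (\<Phi> (\<sigma>s y) (w \<xi>)) (u \<xi>))) (\<Psi> x)"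
        using \<sigma>s_ideal[OF that] by simp
      also have "\<dots> = 0" using x
        by (simp add: linear_sumD[OF bimodule_map_linear] linear_sumD[OF bimodule_act_linear[OF \<Psi>]] act tB0)
      finally show ?thesis .
    qed
    then show "x \<in> ?J" by (simp add: psi_def)
  qed
qed

lemma psi_ideal_severi_brauer:
  assumes vCs: "vector_space sCs" and \<Psi>: "alg_hom sCs sCl \<Psi>" "bij_betw \<Psi> UNIV (clifford_even sCl i)"
    and n: "card \<omega> \<ge> 1"
  shows "psi sAs sV q \<Phi> \<sigma>s sCl i \<Psi> sB tB ideal \<in> severi_brauer_points sCs (card \<omega>)"
proof -
  have even: "\<Psi> x \<in> clifford_even sCl i" for x using \<Psi>(2) by (auto simp: bij_betw_def)
  note psi = psi_ideal[OF even]
  have hom: "\<Psi> (x * y) = \<Psi> x * \<Psi> y" for x y using \<Psi>(1) by (simp add: alg_hom_on_def)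
  have lin: "Vector_Spaces.linear sCs sCl \<Psi>"
    using \<Psi>(1) vCs Cl.vector_space_axioms by (simp add: linear_iff_lin_on alg_hom_on_def)
  let ?J = "{x. \<forall>\<xi>\<in>\<omega>. i (u \<xi>) * \<Psi> x = 0}"
  have "right_ideal ?J"
    by (auto simp: right_ideal_def linear_0D[OF lin] linear_addD[OF lin] hom distrib_left)
      (simp flip: mult.assoc)
  moreover have "vector_space.dim sCs ?J = 2 ^ (card \<omega> - 1)"
  proof -
    interpret Cs: vector_space sCs by (rule vCs)
    obtain W where W: "Cl.independent W" "card W = 2 ^ (card \<omega> - 1)" "finite W"
      and P: "{z \<in> clifford_even sCl i. \<forall>\<xi>\<in>\<omega>. i (u \<xi>) * z = 0} = Cl.span W"
      by (rule annihilator_basis[OF qc n])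
    define g where "g = inv \<Psi>"
    have WP: "z \<in> clifford_even sCl i" "\<xi> \<in> \<omega> \<Longrightarrow> i (u \<xi>) * z = 0" if "z \<in> W" for z \<xi>
      using P Cl.span_base[OF that] by auto
    have \<Psi>g: "\<Psi> (g z) = z" if "z \<in> clifford_even sCl i" for z
      using \<Psi>(2) that unfolding g_def by (metis bij_betw_imp_surj_on f_inv_into_f)
    have g\<Psi>: "g (\<Psi> x) = x" for x
      using \<Psi>(2) unfolding g_def by (simp add: bij_betw_def)
    have "independent_on sCs W g"
      unfolding independent_on_def
    proof (intro allI impI ballI)
      fix a z assume z: "(\<Sum>z\<in>W. sCs (a z) (g z)) = 0" "z \<in> W"
      have "(\<Sum>z\<in>W. sCl (a z) z) = \<Psi> (\<Sum>z\<in>W. sCs (a z) (g z))"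
        by (simp add: linear_sumD[OF lin] linear_scaleD[OF lin] \<Psi>g WP)
      then have "(\<Sum>z\<in>W. sCl (a z) z) = 0" using z(1) by (simp add: linear_0D[OF lin])
      then show "a z = 0"
        using independent_imp_independent_on[OF Cl.vector_space_axioms W(3,1)] z(2) by (simp add: independent_on_def)
    qed
    then have g: "inj_on g W" "Cs.independent (g ` W)" using independent_on_imp[OF vCs W(3)] by auto
    have "g ` W \<subseteq> ?J" using WP \<Psi>g by auto
    moreover have "?J \<subseteq> Cs.span (g ` W)"
    proof
      fix x assume "x \<in> ?J"
      then have "\<Psi> x \<in> Cl.span W" using P even by auto
      then obtain r where "\<Psi> x = (\<Sum>z\<in>W. sCl (r z) z)" using W(3) by (auto simp: Cl.span_finite)
      also have "\<dots> = \<Psi> (\<Sum>z\<in>W. sCs (r z) (g z))"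
        by (simp add: linear_sumD[OF lin] linear_scaleD[OF lin] \<Psi>g WP)
      finally have "x = (\<Sum>z\<in>W. sCs (r z) (g z))" using g\<Psi> by metis
      then show "x \<in> Cs.span (g ` W)" by (auto intro!: Cs.span_sum Cs.span_scale intro: Cs.span_base)
    qed
    ultimately show ?thesis
      using g(2) W(2) card_image[OF g(1)] by (intro Cs.dim_unique[of "g ` W"]) simp_all
  qed
  ultimately show ?thesis by (simp add: severi_brauer_points_def psi)
qed

end

end

section \<open>Descent along the scalar extension\<close>

text \<open>Symmetric elements over \<open>F\<^sub>s\<close> come from symmetric elements over
  \<open>F\<close>, since the fixed space is the image of a projection
  \<open>a - \<rho> (\<sigma> a - a)\<close> defined over \<open>F\<close>. Its extension
  \<open>T\<close> maps \<open>j a\<close> to the image of a fixed element and leaves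
  \<open>x\<close> unchanged.\<close>

lemma fixed_points_scalar_extension:
  assumes se: "scalar_extension \<iota> sA sAs j" and hom: "field_hom \<iota>"
    and \<sigma>: "Vector_Spaces.linear sA sA \<sigma>" and \<sigma>s: "Vector_Spaces.linear sAs sAs \<sigma>s"
    and comp: "\<And>a. \<sigma>s (j a) = j (\<sigma> a)" and x: "\<sigma>s x = x"
  shows "x \<in> module.span sAs (j ` fixed_set \<sigma>)"
proof -
  have vA: "vector_space sA" and vAs: "vector_space sAs"
    using linear_domD[OF \<sigma>] linear_domD[OF \<sigma>s] by auto
  interpret As: vector_space sAs by (rule vAs)
  have j: "Vector_Spaces.linear sA (\<lambda>c. sAs (\<iota> c)) j" by (rule scalar_extension_linear[OF se hom])
  have h: "Vector_Spaces.linear sA sA (\<lambda>a. \<sigma> a - a)"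
    using \<sigma> by (auto simp: Vector_Spaces.linear_iff module.scale_right_diff_distrib module_iff_vector_space)
  obtain \<rho> where \<rho>: "Vector_Spaces.linear sA sA \<rho>" "\<And>a. \<sigma> (\<rho> (\<sigma> a - a)) - \<rho> (\<sigma> a - a) = \<sigma> a - a"
    using linear_generalized_inverse[OF h] by blast
  obtain R where R: "Vector_Spaces.linear sAs sAs R" "\<And>a. R (j a) = j (\<rho> a)"
    using scalar_extension_lift[OF se hom vAs linear_compose'[OF \<rho>(1) j]] by blast
  define T where "T y = y - R (\<sigma>s y - y)" for y
  have T: "Vector_Spaces.linear sAs sAs T"
    by (auto simp: Vector_Spaces.linear_iff vAs T_def linear_addD[OF R(1)] linear_diffD[OF R(1)] linear_scaleD[OF R(1)]
        linear_addD[OF \<sigma>s] linear_scaleD[OF \<sigma>s] As.scale_right_diff_distrib algebra_simps)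
  interpret T: Vector_Spaces.linear sAs sAs T by (rule T)
  have "T (j a) \<in> j ` fixed_set \<sigma>" for a
  proof (rule image_eqI)
    show "T (j a) = j (a - \<rho> (\<sigma> a - a))"
      by (simp add: T_def comp R(2) flip: linear_diffD[OF j])
    show "a - \<rho> (\<sigma> a - a) \<in> fixed_set \<sigma>"
      using \<rho>(2)[of a] by (simp add: linear_diffD[OF \<sigma>] algebra_simps)
  qed
  then have "T ` range j \<subseteq> j ` fixed_set \<sigma>" by auto
  moreover have "x \<in> T ` As.span (range j)"
    using x scalar_extension_span[OF se] linear_0D[OF R(1)] by (intro image_eqI[of _ _ x]) (auto simp: T_def)
  ultimately show ?thesis
    using As.span_mono[of "T ` range j"] T.span_image[of "range j"] by auto
qed

lemma central_simple_spanning_set: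
  assumes cs: "central_simple sA d" and se: "scalar_extension \<iota> sA sAs j" and hom: "field_hom \<iota>"
  obtains G where "module.span sAs G = UNIV" "finite G" "card G \<le> d\<^sup>2"
proof -
  have vA: "vector_space sA" and vAs: "vector_space sAs"
    using se by (auto simp: scalar_extension_def k_algebra_vector_space)
  interpret A: vector_space sA by (rule vA)
  interpret As: vector_space sAs by (rule vAs)
  interpret AF: vector_space "\<lambda>c. sAs (\<iota> c)" by (rule vector_space_restrict[OF vAs hom])
  interpret j: Vector_Spaces.linear sA "\<lambda>c. sAs (\<iota> c)" j by (rule scalar_extension_linear[OF se hom])
  obtain D where D: "finite D" "A.span D = UNIV" and dim: "A.dim UNIV = d\<^sup>2"
    using cs by (auto simp: central_simple_def)
  obtain G where G: "A.independent G" "UNIV \<subseteq> A.span G" "card G = A.dim UNIV"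
    by (rule A.basis_exists[of UNIV])
  have "finite G" using A.independent_span_bound[OF D(1) G(1)] D(2) by simp
  have "AF.subspace (As.span (j ` G))"
    by (rule AF.subspaceI) (auto intro: As.span_add As.span_scale As.span_zero)
  then have "AF.span (j ` G) \<subseteq> As.span (j ` G)"
    using As.span_superset by (rule AF.span_minimal[rotated])
  moreover have "range j \<subseteq> AF.span (j ` G)" using G(2) by (auto simp: j.span_image)
  ultimately have "As.span (j ` G) = UNIV"
    using scalar_extension_span[OF se] As.span_minimal[of "range j" "As.span (j ` G)"] by auto
  then show ?thesis
    using that[of "j ` G"] \<open>finite G\<close> card_image_le[of G j] G(3) dim by simp
qed

text \<open>Injectivity survives the extension: composing \<xi> with an \<open>F\<close>-linear left
  inverse of \<epsilon> and extending gives a functional on \<open>A\<^sub>s\<close> whose composite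
  with \<open>Es\<close> is \<open>ev \<xi>\<close>, and that is 1 at
  \<open>E \<xi>\<close>.\<close>

lemma (in etale_coordinates) extend_embedding:
  assumes se: "scalar_extension \<iota> sA sAs jA" and \<epsilon>: "alg_hom sL sA \<epsilon>" "inj \<epsilon>"
  obtains Es where "Vector_Spaces.linear sLs sAs Es" "\<And>l. Es (jL l) = jA (\<epsilon> l)"
    "\<And>x y. Es (x * y) = Es x * Es y" "\<And>\<xi>. \<xi> \<in> X \<Longrightarrow> Es (E \<xi>) \<noteq> 0"
proof -
  have vA: "vector_space sA" and kAs: "k_algebra sAs" and jA: "\<And>a b. jA (a * b) = jA a * jA b"
    using se by (auto simp: scalar_extension_def k_algebra_vector_space alg_hom_on_def)
  have vAs: "vector_space sAs" by (rule k_algebra_vector_space[OF kAs])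
  have \<epsilon>_mult: "\<epsilon> (a * b) = \<epsilon> a * \<epsilon> b" for a b using \<epsilon>(1) by (simp add: alg_hom_on_def)
  have \<epsilon>_lin: "Vector_Spaces.linear sL sA \<epsilon>"
    using \<epsilon>(1) vA vs_L by (simp add: linear_iff_lin_on alg_hom_on_def)
  obtain Es where Es: "Vector_Spaces.linear sLs sAs Es" "\<And>l. Es (jL l) = jA (\<epsilon> l)"
    using scalar_extension_lift[OF ext hom vAs linear_compose'[OF \<epsilon>_lin scalar_extension_linear[OF se hom]]] by blast
  have "Es (x * y) = Es x * Es y" for x y
    by (rule scalar_extension_mult[OF ext kAs Es(1)]) (simp add: Es(2) \<epsilon>_mult jA)
  moreover have "Es (E \<xi>) \<noteq> 0" if \<xi>: "\<xi> \<in> X" for \<xi>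
  proof
    assume zero: "Es (E \<xi>) = 0"
    obtain \<rho> where \<rho>: "Vector_Spaces.linear sA sL \<rho>" "\<And>l. \<rho> (\<epsilon> l) = l"
      using linear_left_inverse[OF \<epsilon>_lin \<epsilon>(2)] by blast
    obtain H where H: "Vector_Spaces.linear sAs (*) H" "\<And>a. H (jA a) = \<xi> (\<rho> a)"
      using scalar_extension_lift[OF se hom vector_space_mult linear_compose'[OF \<rho>(1) point_linear[OF \<xi>]]] by blast
    have "H (Es y) = ev \<xi> y" for y
      by (rule scalar_extension_ext[OF ext linear_compose'[OF Es(1) H(1)] ev_linear[OF \<xi>]])
        (simp add: Es(2) H(2) \<rho>(2) ev_j[OF \<xi>])
    then have "H (Es (E \<xi>)) = 1" by (simp add: ev_E \<xi>)
    then show False using zero linear_0D[OF H(1)] by simp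
  qed
  ultimately show ?thesis using that Es by blast
qed

theorem proposition4p20:
  fixes n :: nat
    and \<iota> :: "'f::field \<Rightarrow> 's::field"
    and sA :: "'f \<Rightarrow> 'a::ring_1 \<Rightarrow> 'a" and trd :: "'a \<Rightarrow> 'f"
    and \<sigma> :: "'a \<Rightarrow> 'a" and f :: "'a \<Rightarrow> 'f"
    and sAs :: "'s \<Rightarrow> 'as::ring_1 \<Rightarrow> 'as" and jA :: "'a \<Rightarrow> 'as"
    and \<sigma>s :: "'as \<Rightarrow> 'as" and fs :: "'as \<Rightarrow> 's"
    and sV :: "'s \<Rightarrow> 'v::ab_group_add \<Rightarrow> 'v" and q :: "'v \<Rightarrow> 's" and \<Phi> :: "'as \<Rightarrow> 'v \<Rightarrow> 'v"
    and sL :: "'f \<Rightarrow> 'l::comm_ring_1 \<Rightarrow> 'l" and \<sigma>L :: "'l \<Rightarrow> 'l"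
    and sLs :: "'s \<Rightarrow> 'ls::comm_ring_1 \<Rightarrow> 'ls" and jL :: "'l \<Rightarrow> 'ls"
    and \<epsilon> :: "'l \<Rightarrow> 'a"
    and sT :: "'f \<Rightarrow> 't::comm_ring_1 \<Rightarrow> 't" and t :: "'l list \<Rightarrow> 't" and e :: 't
    and sC :: "'f \<Rightarrow> 'c::ring_1 \<Rightarrow> 'c" and cA :: "'a \<Rightarrow> 'c"
    and sCs :: "'s \<Rightarrow> 'cs::ring_1 \<Rightarrow> 'cs" and cAs :: "'as \<Rightarrow> 'cs" and jC :: "'c \<Rightarrow> 'cs"
    and C\<epsilon> :: "'t \<Rightarrow> 'c"
    and sCl :: "'s \<Rightarrow> 'cl::ring_1 \<Rightarrow> 'cl" and i :: "'v \<Rightarrow> 'cl" and \<Psi> :: "'cs \<Rightarrow> 'cl"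
    and sB :: "'s \<Rightarrow> 'b::ab_group_add \<Rightarrow> 'b" and tB :: "'v \<Rightarrow> 'cl \<Rightarrow> 'b"
  assumes "n \<ge> 1"
    and "separable_closure \<iota>"
    \<comment> \<open>the algebra with quadratic pair \<open>(A, \<sigma>, f)\<close>, and \<open>(A\<^sub>s, \<sigma>\<^sub>s, f\<^sub>s) = End V\<close>\<close>
    and "central_simple sA (2 * n)"
    and "scalar_extension \<iota> sA sAs jA"
    and "splitting sAs sV \<Phi>"
    and "reduced_trace \<iota> jA sV \<Phi> trd"
    and "quadratic_pair sA trd n \<sigma> f"
    and "pair_extension \<iota> sAs jA \<sigma> f \<sigma>s fs"
    and "hyperbolic sV q"
    and "adjoint_pair sV q \<Phi> \<sigma>s fs"
    \<comment> \<open>the etale algebra with involution \<open>(L, \<sigma>\<^sub>L)\<close> and the embedding \<open>\<epsilon>\<close>\<close>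
    and "etale \<iota> sL sLs jL (2 * n)"
    and "etale_involution \<iota> sL \<sigma>L"
    and "involution_embedding sL \<sigma>L sA trd \<sigma> f \<epsilon>"
    \<comment> \<open>the Clifford algebras \<open>C(L, \<sigma>\<^sub>L)\<close>, \<open>C(A, \<sigma>, f)\<close>, \<open>C(A, \<sigma>, f)\<^sub>s = C(A\<^sub>s, \<sigma>\<^sub>s, f\<^sub>s)\<close>
         and the embedding \<open>C(\<epsilon>)\<close>\<close>
    and "tensor_power sL n sT t"
    and "clifford_idempotent \<iota> sL \<sigma>L n sT t e"
    and "clifford_algebra sA trd \<sigma> f sC cA"
    and "clifford_algebra sAs (\<lambda>x. endo_trace sV (\<Phi> x)) \<sigma>s fs sCs cAs"
    and "scalar_extension \<iota> sC sCs jC"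
    and "\<forall>a. jC (cA a) = cAs (jA a)"
    and "clifford_embedding n sT t e sC cA \<epsilon> C\<epsilon>"
    \<comment> \<open>\<open>C(A\<^sub>s, \<sigma>\<^sub>s, f\<^sub>s) = C\<^sub>0(V, q)\<close> and the Clifford bimodule \<open>V \<otimes> C\<^sub>1(V, q)\<close>\<close>
    and "quadratic_clifford_algebra sV q sCl i"
    and "even_clifford_iso sV q \<Phi> sCs cAs sCl i \<Psi>"
    and "tensor_product sV UNIV sCl (clifford_odd sCl i) sB tB"
  shows "\<forall>\<omega> \<in> CY \<iota> sL \<sigma>L n.
           C_eps_star sAs jA \<epsilon> \<omega> \<in> isotropic_ideals sAs n \<sigma>s fs \<and>
           CY_point \<iota> n sT t e \<omega> \<in> alg_points \<iota> sT (etale_clifford n sT t e) e \<and>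
           psi sAs sV q \<Phi> \<sigma>s sCl i \<Psi> sB tB (C_eps_star sAs jA \<epsilon> \<omega>)
             \<in> severi_brauer_points sCs n \<and>
           psi sAs sV q \<Phi> \<sigma>s sCl i \<Psi> sB tB (C_eps_star sAs jA \<epsilon> \<omega>)
             = Ceps_star sCs jC (etale_clifford n sT t e) C\<epsilon> (CY_point \<iota> n sT t e \<omega>)"
proof
  fix \<omega> assume \<omega>: "\<omega> \<in> CY \<iota> sL \<sigma>L n"
  have n: "n \<ge> 1" and hom: "field_hom \<iota>" and seA: "scalar_extension \<iota> sA sAs jA"
    using assms(1,2,4) by (simp_all add: separable_closure_field_hom)
  have kAs: "k_algebra sAs" and kCs: "k_algebra sCs" and vA: "vector_space sA"
    and jA: "jA 1 = 1" "\<And>a b. jA (a * b) = jA a * jA b"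
    and jC: "jC 1 = 1" "\<And>a b. jC (a * b) = jC a * jC b"
    using seA assms(18) by (auto simp: scalar_extension_def alg_hom_on_def k_algebra_vector_space)
  have vAs: "vector_space sAs" and vCs: "vector_space sCs"
    using kAs kCs by (simp_all add: k_algebra_vector_space)
  have \<sigma>L: "alg_hom sL sL \<sigma>L" "\<sigma>L \<circ> \<sigma>L = id"
    using assms(12) by (auto simp: etale_involution_def)
  have \<epsilon>: "alg_hom sL sA \<epsilon>" "inj \<epsilon>" and \<epsilon>\<sigma>: "\<And>l. \<epsilon> (\<sigma>L l) = \<sigma> (\<epsilon> l)"
    and f_trd: "\<And>x l. \<sigma> x = x \<Longrightarrow> l + \<sigma>L l = 1 \<Longrightarrow> f x = trd (\<epsilon> l * x)"
    using assms(13) by (auto simp: involution_embedding_def fun_eq_iff)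
  have \<sigma>_lin: "Vector_Spaces.linear sA sA \<sigma>"
    using assms(7) vA by (simp add: quadratic_pair_def linear_iff_lin_on)
  have \<sigma>s_lin: "lin_on sAs sAs UNIV \<sigma>s" and \<sigma>s_jA: "\<And>a. \<sigma>s (jA a) = jA (\<sigma> a)"
    and fs_lin: "lin_on sAs (*) (Sym \<sigma>s) fs" and fs_jA: "\<And>a. \<sigma> a = a \<Longrightarrow> fs (jA a) = \<iota> (f a)"
    using assms(8) by (auto simp: pair_extension_def)
  obtain ev E where ec: "etale_coordinates \<iota> sL sLs jL ev E" and cardX: "card (alg_points \<iota> sL UNIV 1) = 2 * n"
    using etale_imp_coordinates[OF assms(11) hom] by blast
  interpret etale_clifford_point \<iota> sL sLs jL ev E \<sigma>L n sT t e \<omega>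
    using ec assms(14,15) \<sigma>L cardX \<omega>
    by (simp add: etale_clifford_point_def etale_clifford_point_axioms_def etale_clifford_algebra_def
        etale_clifford_algebra_axioms_def)
  interpret split_quadratic_space sAs sV \<Phi> q \<sigma>s
    using assms(5,9,10) kAs \<sigma>s_lin
    by (intro split_quadratic_space.intro) (auto simp: hyperbolic_def adjoint_pair_def)
  have fs_tens: "fs (tens v v) = q v" for v using assms(10) by (simp add: adjoint_pair_def)
  define \<tau> :: "('l \<Rightarrow> 's) \<Rightarrow> 'l \<Rightarrow> 's" where "\<tau> \<xi> = \<xi> \<circ> \<sigma>L" for \<xi>
  have \<tau>\<tau>: "\<tau> (\<tau> \<xi>) = \<xi>" for \<xi> using \<sigma>L(2) by (simp add: \<tau>_def comp_assoc)
  have \<tau>X: "\<tau> \<xi> \<in> X" if "\<xi> \<in> X" for \<xi>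
    using that \<sigma>L(1) by (auto simp: \<tau>_def alg_points_def alg_hom_on_def lin_on_def)
  have part: "\<xi> \<in> \<omega> \<longleftrightarrow> \<tau> \<xi> \<notin> \<omega>" if "\<xi> \<in> X" for \<xi>
    unfolding \<tau>_def by (rule CY_partition[OF \<sigma>L fin cardX \<omega> that])
  have X_eq: "X = \<omega> \<union> \<tau> ` \<omega>"
  proof
    show "X \<subseteq> \<omega> \<union> \<tau> ` \<omega>"
    proof
      fix \<xi> assume "\<xi> \<in> X"
      then have "\<xi> \<in> \<omega> \<or> \<tau> \<xi> \<in> \<omega>" using part by blast
      then show "\<xi> \<in> \<omega> \<union> \<tau> ` \<omega>" using \<tau>\<tau>[of \<xi>] by (metis UnI1 UnI2 image_eqI)
    qed
    show "\<omega> \<union> \<tau> ` \<omega> \<subseteq> X" using \<omega>D(1) \<tau>X by auto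
  qed
  have disj: "\<omega> \<inter> \<tau> ` \<omega> = {}" using part \<omega>D(1) by blast
  have inj_\<tau>: "inj_on \<tau> \<omega>" by (rule inj_onI) (metis \<tau>\<tau>)

  obtain Es where Es: "Vector_Spaces.linear sLs sAs Es" "\<And>l. Es (jL l) = jA (\<epsilon> l)"
    "\<And>x y. Es (x * y) = Es x * Es y" "\<And>\<xi>. \<xi> \<in> X \<Longrightarrow> Es (E \<xi>) \<noteq> 0"
    using extend_embedding[OF seA \<epsilon>] by blast
  have \<epsilon>1: "\<epsilon> 1 = 1" using \<epsilon>(1) by (simp add: alg_hom_on_def)
  define P where "P \<xi> = Es (E \<xi>)" for \<xi>
  have P_orth: "P \<xi> * P \<zeta> = (if \<xi> = \<zeta> then P \<xi> else 0)" if "\<xi> \<in> X" "\<zeta> \<in> X" for \<xi> \<zeta>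
    using E_mult_E[OF that] linear_0D[OF Es(1)] by (simp add: P_def flip: Es(3))
  have P_sum: "(\<Sum>\<xi>\<in>X. P \<xi>) = 1"
    using Es(2)[of 1] by (simp add: P_def sum_E jL_hom \<epsilon>1 jA flip: linear_sumD[OF Es(1)])
  have jA\<epsilon>_P: "jA (\<epsilon> l) * P \<xi> = sAs (\<xi> l) (P \<xi>)" if "\<xi> \<in> X" for l \<xi>
    using mult_E[OF that, of "jL l"] linear_scaleD[OF Es(1)]
    by (simp add: P_def ev_j[OF that] flip: Es(2) Es(3))
  \<comment> \<open>On the image of \<open>P \<xi>\<close> the element \<open>\<epsilon> l\<close>
    acts by \<open>\<xi> l\<close>. Moved across \<open>b\<close> it becomes
    \<open>\<epsilon> (\<sigma>L l)\<close>, which acts by \<open>\<tau> \<xi> l\<close>. An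
    \<open>l\<close> at which \<zeta> and \<open>\<tau> \<xi>\<close> differ thus forces
    orthogonality.\<close>
  have b_eigen: "b (\<Phi> (P \<xi>) v) (\<Phi> (P \<zeta>) v') = 0" if pts: "\<xi> \<in> X" "\<zeta> \<in> X" "\<zeta> \<noteq> \<tau> \<xi>" for \<xi> \<zeta> v v'
  proof -
    obtain l where l: "\<zeta> l \<noteq> \<tau> \<xi> l" using pts(3) by (auto simp: fun_eq_iff)
    have ei: "\<Phi> (jA (\<epsilon> l)) (\<Phi> (P \<xi>) v) = sV (\<xi> l) (\<Phi> (P \<xi>) v)" if "\<xi> \<in> X" for \<xi> l v
      using arg_cong[OF jA\<epsilon>_P[OF that, of l], of "\<lambda>x. \<Phi> x v"] by (simp add: \<Phi>_mult \<Phi>_scale)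
    have "\<zeta> l * b (\<Phi> (P \<xi>) v) (\<Phi> (P \<zeta>) v') = b (\<Phi> (\<sigma>s (jA (\<epsilon> l))) (\<Phi> (P \<xi>) v)) (\<Phi> (P \<zeta>) v')"
      by (simp add: ei[OF pts(2)] b_scale flip: adjoint)
    also have "\<dots> = \<tau> \<xi> l * b (\<Phi> (P \<xi>) v) (\<Phi> (P \<zeta>) v')"
      by (simp add: \<sigma>s_jA ei[OF pts(1)] b_scale_left \<tau>_def flip: \<epsilon>\<sigma>)
    finally show ?thesis using l by simp
  qed
  \<comment> \<open>\<open>splitting\<close> leaves the dimension of \<open>V\<close> open; the
    degree \<open>2 * n\<close> of \<open>A\<close> bounds it by the number of points.\<close>
  obtain G where "module.span sAs G = UNIV" "finite G" "card G \<le> (2 * n)\<^sup>2"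
    by (rule central_simple_spanning_set[OF assms(3) seA hom])
  then have bound: "card B \<le> card X" if "\<not> V.dependent B" for B
    using independent_card_bound[of G "2 * n" B] that cardX by simp
  have P_nz: "P \<xi> \<noteq> 0" if "\<xi> \<in> X" for \<xi> using Es(4)[OF that] by (simp add: P_def)
  have "\<exists>u w. (\<forall>\<xi>\<in>\<omega>. P \<xi> = tens (u \<xi>) (w \<xi>) \<and> P (\<tau> \<xi>) = tens (w \<xi>) (u \<xi>)) \<and>
    (\<forall>\<xi>\<in>\<omega>. \<forall>\<zeta>\<in>\<omega>. b (u \<xi>) (w \<zeta>) = (if \<xi> = \<zeta> then 1 else 0) \<and> b (u \<xi>) (u \<zeta>) = 0 \<and> b (w \<xi>) (w \<zeta>) = 0)"
    by (rule idempotent_frame[of X P \<tau> \<omega>])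
      (rule fin, rule P_orth, assumption, assumption, rule P_sum, rule P_nz, assumption, rule bound, assumption,
        rule \<tau>X, assumption, rule \<tau>\<tau>, rule b_eigen, assumption, assumption, assumption, rule part, assumption,
        rule \<omega>D(1))
  then obtain u w where
    Pu: "\<And>\<xi>. \<xi> \<in> \<omega> \<Longrightarrow> P \<xi> = tens (u \<xi>) (w \<xi>)" and Pw: "\<And>\<xi>. \<xi> \<in> \<omega> \<Longrightarrow> P (\<tau> \<xi>) = tens (w \<xi>) (u \<xi>)"
    and b_uw: "\<And>\<xi> \<zeta>. \<xi> \<in> \<omega> \<Longrightarrow> \<zeta> \<in> \<omega> \<Longrightarrow> b (u \<xi>) (w \<zeta>) = (if \<xi> = \<zeta> then 1 else 0)"
    and b_uu: "\<And>\<xi> \<zeta>. \<xi> \<in> \<omega> \<Longrightarrow> \<zeta> \<in> \<omega> \<Longrightarrow> b (u \<xi>) (u \<zeta>) = 0"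
    and b_ww: "\<And>\<xi> \<zeta>. \<xi> \<in> \<omega> \<Longrightarrow> \<zeta> \<in> \<omega> \<Longrightarrow> b (w \<xi>) (w \<zeta>) = 0"
    by blast

  \<comment> \<open>Condition (b) on \<epsilon> quantifies over such elements, so it says something
    only once one is known to exist.\<close>
  obtain l\<^sub>1 where l\<^sub>1: "l\<^sub>1 + \<sigma>L l\<^sub>1 = 1"
    using exists_trace_one[OF \<sigma>L(1) part[unfolded \<tau>_def] \<omega>D(1)] by blast
  \<comment> \<open>Condition (b) gives the formula on \<open>Sym \<sigma>\<close>. Both sides are
    linear once \<open>fs\<close> has been extended from \<open>Sym \<sigma>s\<close>, and
    \<open>Sym \<sigma>s\<close> is spanned by the image of \<open>Sym \<sigma>\<close>.\<close>
  have fs_trace: "fs x = trace (jA (\<epsilon> l\<^sub>1) * x)" if x: "\<sigma>s x = x" for x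
  proof -
    have lin: "Vector_Spaces.linear sAs (*) (\<lambda>x. trace (jA (\<epsilon> l\<^sub>1) * x))"
      by (rule linear_compose'[OF linear_mult_right[OF kAs] trace_linear])
    have sub: "A.subspace (Sym \<sigma>s)"
      by (rule A.subspaceI) (simp_all add: linear_0D[OF \<sigma>s_lin] linear_addD[OF \<sigma>s_lin] linear_scaleD[OF \<sigma>s_lin])
    obtain g where g: "Vector_Spaces.linear sAs (*) g" "\<And>x. x \<in> Sym \<sigma>s \<Longrightarrow> g x = fs x"
      using lin_on_extend[OF vAs vector_space_mult sub fs_lin] by blast
    have "g x = trace (jA (\<epsilon> l\<^sub>1) * x)"
    proof (rule linear_eq_spanD[OF g(1) lin])
      show "x \<in> A.span (jA ` fixed_set \<sigma>)"
        by (rule fixed_points_scalar_extension[OF seA hom \<sigma>_lin \<sigma>s_lin \<sigma>s_jA x])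
      fix y assume "y \<in> jA ` fixed_set \<sigma>"
      then obtain a where a: "\<sigma> a = a" "y = jA a" by auto
      then have "g y = fs y" using g(2) \<sigma>s_jA by simp
      then show "g y = trace (jA (\<epsilon> l\<^sub>1) * y)"
        using a f_trd[OF a(1) l\<^sub>1] assms(6) by (simp add: fs_jA reduced_trace_def flip: jA(2))
    qed
    then show ?thesis using g(2) x by simp
  qed
  have Pu_u: "\<Phi> (P \<xi>) (u \<xi>) = u \<xi>" "\<Phi> (P (\<tau> \<xi>)) (w \<xi>) = w \<xi>" if "\<xi> \<in> \<omega>" for \<xi>
    using that b_uw[OF that that] by (simp_all add: Pu Pw \<Phi>_tens polar_sym[of q "w \<xi>" "u \<xi>"])
  have eigen: "\<Phi> (jA (\<epsilon> l)) (u \<xi>) = sV (\<xi> l) (u \<xi>)" "\<Phi> (jA (\<epsilon> l)) (w \<xi>) = sV (\<tau> \<xi> l) (w \<xi>)" if "\<xi> \<in> \<omega>" for \<xi> l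
  proof -
    have X: "\<xi> \<in> X" "\<tau> \<xi> \<in> X" using that \<omega>D(1) \<tau>X by auto
    show "\<Phi> (jA (\<epsilon> l)) (u \<xi>) = sV (\<xi> l) (u \<xi>)"
      using arg_cong[OF jA\<epsilon>_P[OF X(1), of l], of "\<lambda>x. \<Phi> x (u \<xi>)"] by (simp add: \<Phi>_mult \<Phi>_scale Pu_u that)
    show "\<Phi> (jA (\<epsilon> l)) (w \<xi>) = sV (\<tau> \<xi> l) (w \<xi>)"
      using arg_cong[OF jA\<epsilon>_P[OF X(2), of l], of "\<lambda>x. \<Phi> x (w \<xi>)"] by (simp add: \<Phi>_mult \<Phi>_scale Pu_u that)
  qed
  \<comment> \<open>\<open>tens v v\<close> is symmetric, so \<open>q\<close> is expressed by a
    trace. For an eigenvector \<open>v\<close> of \<open>jA (\<epsilon> l\<^sub>1)\<close> this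
    makes \<open>q v\<close> a multiple of \<open>b v v\<close>, hence 0 for \<open>u \<xi>\<close>
    and \<open>w \<xi>\<close>, in characteristic 2 as well.\<close>
  have q_eq: "q v = trace (jA (\<epsilon> l\<^sub>1) * tens v v)" for v
    using fs_trace[OF \<sigma>s_tens] fs_tens by simp
  have sum_X: "(\<Sum>\<xi>\<in>X. g \<xi>) = (\<Sum>\<xi>\<in>\<omega>. g \<xi> + g (\<tau> \<xi>))" for g :: "('l \<Rightarrow> 's) \<Rightarrow> 'z::comm_monoid_add"
    unfolding X_eq using \<omega>D(2) disj by (simp add: sum.union_disjoint sum.reindex[OF inj_\<tau>] sum.distrib)
  interpret hyperbolic_frame sAs sV \<Phi> q \<sigma>s \<omega> u w
  proof unfold_locales
    show "q (u \<xi>) = 0" "q (w \<xi>) = 0" if "\<xi> \<in> \<omega>" for \<xi>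
      using that by (simp_all add: q_eq mult_tens eigen trace_tens b_scale b_uu b_ww)
    have "(\<Sum>\<xi>\<in>\<omega>. tens (u \<xi>) (w \<xi>) + tens (w \<xi>) (u \<xi>)) = (\<Sum>\<xi>\<in>X. P \<xi>)"
      by (simp add: sum_X Pu Pw)
    then show "(\<Sum>\<xi>\<in>\<omega>. tens (u \<xi>) (w \<xi>) + tens (w \<xi>) (u \<xi>)) = 1" using P_sum by simp
  qed (use \<omega>D(2) b_uw b_uu b_ww in auto)

  \<comment> \<open>The condition over all \<open>l\<close> extends linearly to
    \<open>L\<^sub>s\<close>; at \<open>E \<xi>\<close> it reads \<open>P \<xi> * x = x\<close>, and
    this single equation gives back all the others.\<close>
  have eps_star: "eps_star sAs jA \<epsilon> \<xi> = {x. P \<xi> * x = x}" if \<xi>: "\<xi> \<in> X" for \<xi>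
  proof (intro set_eqI iffI)
    fix x assume "x \<in> eps_star sAs jA \<epsilon> \<xi>"
    then have x: "sAs (\<xi> l) x = jA (\<epsilon> l) * x" for l by (simp add: eps_star_def)
    have "Es y * x = sAs (ev \<xi> y) x" for y
    proof (rule scalar_extension_ext[OF ext])
      show "Vector_Spaces.linear sLs sAs (\<lambda>y. Es y * x)"
        by (rule linear_compose'[OF Es(1) linear_mult_left[OF kAs]])
      show "Vector_Spaces.linear sLs sAs (\<lambda>y. sAs (ev \<xi> y) x)"
        by (simp add: Vector_Spaces.linear_iff vs_Ls vAs ev_add[OF \<xi>] ev_scale[OF \<xi>] A.scale_left_distrib)
      show "Es (jL l) * x = sAs (ev \<xi> (jL l)) x" for l by (simp add: Es(2) ev_j[OF \<xi>] x)
    qed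
    then show "x \<in> {x. P \<xi> * x = x}" by (simp add: P_def ev_E[OF \<xi> \<xi>])
  next
    fix x assume "x \<in> {x. P \<xi> * x = x}"
    then have x: "P \<xi> * x = x" by simp
    have "sAs (\<xi> l) x = jA (\<epsilon> l) * x" for l
    proof -
      have "jA (\<epsilon> l) * (P \<xi> * x) = sAs (\<xi> l) (P \<xi> * x)"
        by (simp add: jA\<epsilon>_P[OF \<xi>] A.scale_mult_left flip: mult.assoc)
      then show ?thesis by (simp add: x)
    qed
    then show "x \<in> eps_star sAs jA \<epsilon> \<xi>" by (simp add: eps_star_def)
  qed
  have I_eq: "C_eps_star sAs jA \<epsilon> \<omega> = ideal"
  proof (intro set_eqI iffI)
    fix x assume "x \<in> C_eps_star sAs jA \<epsilon> \<omega>"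
    then obtain y where y: "x = (\<Sum>\<xi>\<in>\<omega>. y \<xi>)" "\<And>\<xi>. \<xi> \<in> \<omega> \<Longrightarrow> P \<xi> * y \<xi> = y \<xi>"
      using eps_star \<omega>D(1) by (auto simp: C_eps_star_def subset_eq)
    have "(\<Sum>\<zeta>\<in>\<omega>. P \<zeta>) * y \<xi> = y \<xi>" if \<xi>: "\<xi> \<in> \<omega>" for \<xi>
    proof -
      have "P \<zeta> * (P \<xi> * y \<xi>) = (if \<zeta> = \<xi> then y \<xi> else 0)" if "\<zeta> \<in> \<omega>" for \<zeta>
      proof -
        have "\<zeta> \<in> X" "\<xi> \<in> X" using that \<xi> \<omega>D(1) by auto
        from P_orth[OF this] have "P \<zeta> * (P \<xi> * y \<xi>) = (if \<zeta> = \<xi> then P \<zeta> else 0) * y \<xi>"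
          by (simp flip: mult.assoc)
        then show ?thesis using y(2)[OF \<xi>] by simp
      qed
      then have "(\<Sum>\<zeta>\<in>\<omega>. P \<zeta>) * (P \<xi> * y \<xi>) = (\<Sum>\<zeta>\<in>\<omega>. if \<zeta> = \<xi> then y \<xi> else 0)"
        unfolding sum_distrib_right by (intro sum.cong) simp_all
      then show ?thesis using \<xi> \<omega>D(2) y(2) by simp
    qed
    then have "(\<Sum>\<zeta>\<in>\<omega>. P \<zeta>) * x = x" unfolding y(1) by (simp add: sum_distrib_left)
    then show "x \<in> ideal" by (simp add: ideal_def Pu)
  next
    fix x assume "x \<in> ideal"
    then have "x = (\<Sum>\<xi>\<in>\<omega>. P \<xi> * x)" by (simp add: ideal_def Pu sum_distrib_right)
    moreover have "P \<xi> * x \<in> eps_star sAs jA \<epsilon> \<xi>" if "\<xi> \<in> \<omega>" for \<xi>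
    proof -
      have "\<xi> \<in> X" using that \<omega>D(1) by auto
      then show ?thesis using P_orth[of \<xi> \<xi>] by (simp add: eps_star flip: mult.assoc)
    qed
    ultimately show "x \<in> C_eps_star sAs jA \<epsilon> \<omega>"
      unfolding C_eps_star_def by blast
  qed
  have isotropic: "ideal \<in> isotropic_ideals sAs n \<sigma>s fs"
    using ideal_isotropic[OF fs_trace, of "\<lambda>\<xi>. \<xi> l\<^sub>1"] eigen(1) by (simp add: \<omega>D(3))

  have qc: "quadratic_clifford_algebra sV q sCl i" by (rule assms(21))
  have kCl: "k_algebra sCl" by (rule kCl[OF qc])
  interpret Cs: k_algebra sCs by (rule kCs)
  interpret Cl: k_algebra sCl by (rule kCl)
  have \<Psi>: "alg_hom sCs sCl \<Psi>" "bij_betw \<Psi> UNIV (clifford_even sCl i)"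
    and \<Psi>_tens: "\<And>v w. \<Psi> (cAs (tens v w)) = i v * i w"
    using assms(22) by (auto simp: even_clifford_iso_def)
  have \<Psi>_lin: "Vector_Spaces.linear sCs sCl \<Psi>" and \<Psi>_mult: "\<And>x y. \<Psi> (x * y) = \<Psi> x * \<Psi> y"
    using \<Psi>(1) vCs Cl.vector_space_axioms by (simp_all add: linear_iff_lin_on alg_hom_on_def)
  have \<Psi>_inj: "\<Psi> x = \<Psi> y \<Longrightarrow> x = y" for x y using \<Psi>(2) by (metis bij_betw_imp_inj_on injD)
  have cAs_lin: "Vector_Spaces.linear sAs sCs cAs"
    using assms(17) tensor_algebra_quotient_linear[OF vAs] by (auto simp: clifford_algebra_def)
  have C\<epsilon>: "lin_on sT sC CL C\<epsilon>" "C\<epsilon> e = 1" "\<And>x y. x \<in> CL \<Longrightarrow> y \<in> CL \<Longrightarrow> C\<epsilon> (x * y) = C\<epsilon> x * C\<epsilon> y"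
    "\<And>l. C\<epsilon> (cL l) = cA (\<epsilon> l)"
    using assms(20) by (auto simp: clifford_embedding_def alg_hom_on_def)
  \<comment> \<open>The \<open>F\<^sub>s\<close>-linear extension to \<open>L\<^sub>s\<close> of the
    map sending \<open>l\<close> to \<open>C\<epsilon> (cL l)\<close>, read in the Clifford algebra
    of \<open>q\<close>. It is what allows the argument \<open>E \<xi>\<close>.\<close>
  define K where "K y = \<Psi> (cAs (Es y))" for y
  have K_lin: "Vector_Spaces.linear sLs sCl K"
    unfolding K_def by (intro linear_compose'[OF linear_compose'[OF Es(1) cAs_lin] \<Psi>_lin])
  have K_jL: "K (jL l) = \<Psi> (jC (C\<epsilon> (cL l)))" for l
    using assms(19) by (simp add: K_def Es(2) C\<epsilon>(4))
  have K_E: "K (E \<xi>) = i (u \<xi>) * i (w \<xi>)" "K (E (\<tau> \<xi>)) = i (w \<xi>) * i (u \<xi>)" if "\<xi> \<in> \<omega>" for \<xi>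
    using Pu[OF that] Pw[OF that] by (simp_all add: K_def \<Psi>_tens flip: P_def)
  let ?J = "psi sAs sV q \<Phi> \<sigma>s sCl i \<Psi> sB tB ideal"
  have psi_eq: "?J = {x. \<forall>\<xi>\<in>\<omega>. i (u \<xi>) * \<Psi> x = 0}"
    using \<Psi>(2) \<omega>D(3) n by (intro psi_ideal[OF qc assms(23)]) (auto simp: bij_betw_def)
  have commutes: "?J = Ceps_star sCs jC CL C\<epsilon> \<eta>"
    unfolding psi_eq
  proof (intro set_eqI iffI)
    fix x assume "x \<in> {x. \<forall>\<xi>\<in>\<omega>. i (u \<xi>) * \<Psi> x = 0}"
    then have x: "i (u \<xi>) * \<Psi> x = 0" if "\<xi> \<in> \<omega>" for \<xi> using that by simp
    have KE: "K (E \<xi>) * \<Psi> x = \<Psi> x" "K (E (\<tau> \<xi>)) * \<Psi> x = 0" if \<xi>: "\<xi> \<in> \<omega>" for \<xi>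
    proof -
      show zero: "K (E (\<tau> \<xi>)) * \<Psi> x = 0" by (simp add: K_E[OF \<xi>] x[OF \<xi>] mult.assoc)
      have "(K (E \<xi>) + K (E (\<tau> \<xi>))) * \<Psi> x = \<Psi> x" by (simp add: K_E[OF \<xi>] i_uw[OF qc \<xi>])
      then show "K (E \<xi>) * \<Psi> x = \<Psi> x" by (simp add: distrib_right zero)
    qed
    have act: "jC (C\<epsilon> (cL l)) * x = sCs (\<Sum>\<xi>\<in>\<omega>. \<xi> l) x" for l
    proof (rule \<Psi>_inj)
      have "K (jL l) = (\<Sum>\<xi>\<in>X. sCl (\<xi> l) (K (E \<xi>)))"
        using arg_cong[OF expand[of "jL l"], of K]
        by (simp add: linear_sumD[OF K_lin] linear_scaleD[OF K_lin] ev_j cong: sum.cong)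
      then have "K (jL l) * \<Psi> x = (\<Sum>\<xi>\<in>X. sCl (\<xi> l) (K (E \<xi>) * \<Psi> x))"
        by (simp add: sum_distrib_right Cl.scale_mult_left)
      also have "\<dots> = (\<Sum>\<xi>\<in>\<omega>. sCl (\<xi> l) (\<Psi> x))" by (simp add: sum_X KE)
      finally show "\<Psi> (jC (C\<epsilon> (cL l)) * x) = \<Psi> (sCs (\<Sum>\<xi>\<in>\<omega>. \<xi> l) x)"
        by (simp add: \<Psi>_mult linear_scaleD[OF \<Psi>_lin] Cl.scale_sum_left flip: K_jL)
    qed
    have jC_lin: "Vector_Spaces.linear sC (\<lambda>c. sCs (\<iota> c)) jC"
      by (rule scalar_extension_linear[OF assms(18) hom])
    \<comment> \<open>The uniqueness of characters is applied to the map sending \<open>c\<close> to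
      \<open>jC (C\<epsilon> c) * x\<close>. The unit of \<open>CL\<close> is \<open>e\<close>, and
      \<open>C\<epsilon> e = 1\<close>, so this is the condition defining
      \<open>Ceps_star\<close>.\<close>
    have "jC (C\<epsilon> c) * x = sCs (\<eta> c) (jC (C\<epsilon> e) * x)" if "c \<in> CL" for c
    proof (rule character_unique[OF vCs _ _ that])
      show "lin_on sT (\<lambda>c. sCs (\<iota> c)) CL (\<lambda>c. jC (C\<epsilon> c) * x)"
        using C\<epsilon>(1) by (simp add: lin_on_def linear_addD[OF jC_lin] linear_scaleD[OF jC_lin] distrib_right Cs.scale_mult_left)
      show "jC (C\<epsilon> (c * cL l)) * x = sCs (\<Sum>\<xi>\<in>\<omega>. \<xi> l) (jC (C\<epsilon> c) * x)" if "c \<in> CL" for c l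
        by (simp add: C\<epsilon>(3) that cL_in_CL jC(2) mult.assoc act Cs.scale_mult_right)
    qed
    then show "x \<in> Ceps_star sCs jC CL C\<epsilon> \<eta>" by (simp add: Ceps_star_def C\<epsilon>(2) jC(1))
  next
    fix x assume "x \<in> Ceps_star sCs jC CL C\<epsilon> \<eta>"
    then have x: "sCs (\<eta> c) x = jC (C\<epsilon> c) * x" if "c \<in> CL" for c using that by (simp add: Ceps_star_def)
    \<comment> \<open>The condition at the elements \<open>cL l\<close> extends linearly to
      \<open>L\<^sub>s\<close>. At \<open>y = E \<xi>\<close> the scalar is 1, so
      \<open>i (u \<xi>) * i (w \<xi>)\<close> fixes \<open>\<Psi> x\<close>, and left
      multiplication by \<open>i (u \<xi>)\<close>, whose square is 0, gives the claim.\<close>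
    have K_act: "K y * \<Psi> x = sCl (\<Sum>\<xi>\<in>\<omega>. ev \<xi> y) (\<Psi> x)" for y
    proof (rule scalar_extension_ext[OF ext])
      show "Vector_Spaces.linear sLs sCl (\<lambda>y. K y * \<Psi> x)"
        by (rule linear_compose'[OF K_lin linear_mult_left[OF kCl]])
      have "(\<Sum>\<xi>\<in>\<omega>. ev \<xi> (y + y')) = (\<Sum>\<xi>\<in>\<omega>. ev \<xi> y) + (\<Sum>\<xi>\<in>\<omega>. ev \<xi> y')"
        "(\<Sum>\<xi>\<in>\<omega>. ev \<xi> (sLs c y)) = c * (\<Sum>\<xi>\<in>\<omega>. ev \<xi> y)" for c y y'
        using \<omega>D(1) by (auto simp: ev_add ev_scale sum_distrib_left subset_eq simp flip: sum.distrib intro!: sum.cong)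
      then show "Vector_Spaces.linear sLs sCl (\<lambda>y. sCl (\<Sum>\<xi>\<in>\<omega>. ev \<xi> y) (\<Psi> x))"
        by (simp add: Vector_Spaces.linear_iff vs_Ls Cl.vector_space_axioms Cl.scale_left_distrib)
      fix l
      have "(\<Sum>\<xi>\<in>\<omega>. ev \<xi> (jL l)) = \<eta> (cL l)"
        unfolding \<eta>_cL using \<omega>D(1) by (intro sum.cong) (auto simp: ev_j)
      then show "K (jL l) * \<Psi> x = sCl (\<Sum>\<xi>\<in>\<omega>. ev \<xi> (jL l)) (\<Psi> x)"
        using arg_cong[OF x[OF cL_in_CL, of l], of \<Psi>]
        by (simp add: K_jL \<Psi>_mult linear_scaleD[OF \<Psi>_lin])
    qed
    have "i (u \<xi>) * \<Psi> x = 0" if \<xi>: "\<xi> \<in> \<omega>" for \<xi>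
    proof -
      have "(\<Sum>\<zeta>\<in>\<omega>. ev \<zeta> (E \<xi>)) = (\<Sum>\<zeta>\<in>\<omega>. if \<zeta> = \<xi> then 1 else 0)"
        using \<omega>D(1) \<xi> by (intro sum.cong) (auto simp: ev_E subset_eq)
      then have "K (E \<xi>) * \<Psi> x = \<Psi> x" using K_act[of "E \<xi>"] \<omega>D(2) \<xi> by simp
      then have "i (u \<xi>) * \<Psi> x = i (u \<xi>) * (i (u \<xi>) * i (w \<xi>) * \<Psi> x)" by (simp add: K_E[OF \<xi>])
      then show ?thesis by (simp add: i_uu[OF qc \<xi>] flip: mult.assoc)
    qed
    then show "x \<in> {x. \<forall>\<xi>\<in>\<omega>. i (u \<xi>) * \<Psi> x = 0}" by simp
  qed
  have "?J \<in> severi_brauer_points sCs n"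
    using psi_ideal_severi_brauer[OF qc assms(23) vCs \<Psi>] n by (simp add: \<omega>D(3))
  then show "C_eps_star sAs jA \<epsilon> \<omega> \<in> isotropic_ideals sAs n \<sigma>s fs \<and>
      \<eta> \<in> alg_points \<iota> sT CL e \<and>
      psi sAs sV q \<Phi> \<sigma>s sCl i \<Psi> sB tB (C_eps_star sAs jA \<epsilon> \<omega>)
        \<in> severi_brauer_points sCs n \<and>
      psi sAs sV q \<Phi> \<sigma>s sCl i \<Psi> sB tB (C_eps_star sAs jA \<epsilon> \<omega>)
        = Ceps_star sCs jC CL C\<epsilon> (\<eta>)"
    using isotropic \<eta>_point commutes by (simp add: I_eq)
qed

end
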